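(* Let $X_1$ and $X_2$ be nonsingular integral complex varieties, and let $D_1$ and $D_2$ be non-zero effective Cartier divisors on $X_1$ and $X_2$ respectively. Let $D_1\otimes D_2$ be the Cartier divisor on $X_1\times X_2$ locally defined by the tensor product of local equations of $D_1$ and $D_2$. Then $$b_{D_1}(s)\cdot b_{D_2}(s)=b_{D_1\otimes D_2}(s).$$
   Context: Bernstein-Sato polynomial of a function. Let $X=\mathrm{Spec}\,A$ be a nonsingular integral complex affine variety and $f\in A\setminus\{0\}$. Let $D(A)=\Gamma(X,\mathscr D_X)$ be the ring of differential operators, i.e. the $\mathbb C$-subalgebra of $\mathrm{End}_{\mathbb C}(A)$ generated by $A$ and $\mathrm{Der}_{\mathbb C}(A)$. Let $s$ be a variable and $f^s$ a formal symbol; the free rank-one $A_f[s]$-module $A_f[s]\cdot f^s$ is a left $D(A)[s]$-module, where $A[s]$ acts by multiplication and $\delta\in\mathrm{Der}_{\mathbb C}(A)$ acts by $\delta(h f^s)=\left(\delta(h)+s\,h\,\frac{\delta(f)}{f}\right)f^s$. Write $f^{s+1}:=f\cdot f^s$. Then $b_f(s)\in\mathbb C[s]$ is the non-zero monic polynomial of minimal degree such that $b_f(s)\cdot f^s\in D(A)[s]\cdot f^{s+1}$ (it exists). Bernstein-Sato polynomial of a divisor. Let $X$ be a nonsingular integral complex variety and $D$ a non-zero effective Cartier divisor on $X$. Choose an affine open covering $\{U_i\}_i$ of $X$ and $f_i\in\Gamma(U_i,\mathcal O_X)$ with $D|_{U_i}=\mathrm{div}(f_i)$. Then $b_D(s):=\mathrm{lcm}_i\,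 b_{f_i}(s)$ (monic); this is independent of the choices. Tensor product of divisors. Given affine open coverings $\{U_i\}$ of $X_1$ and $\{V_j\}$ of $X_2$ with $D_1|_{U_i}=\mathrm{div}(f_i)$ and $D_2|_{V_j}=\mathrm{div}(g_j)$, the Cartier divisor $D_1\otimes D_2$ on $X_1\times X_2$ is defined on each $U_i\times V_j$ by the equation $f_i\otimes g_j$. *)

theory Defs
  imports
    "HOL-Analysis.Abstract_Topology"
    "HOL-Algebra.Ring_Divisibility"
    "HOL-Library.Function_Algebras"
    "HOL-Library.Extended_Nat"
    "HOL-Library.FuncSet"
    "HOL-Computational_Algebra.Polynomial_Factorial"
    "HOL-Computational_Algebra.Field_as_Ring"
begin

text \<open>
  Integral complex varieties are treated classically, as spaces of closed points with a sheaf
  of complex-valued regular functions (Serre, Kempf, Springer). A function on \<open>U\<close> is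
  represented by a total function that vanishes outside \<open>U\<close>, so that sums and products of
  functions on \<open>U\<close> are the pointwise ones and the unit of the algebra of functions on \<open>U\<close>
  is the indicator function of \<open>U\<close>.
\<close>

definition res :: "'a set \<Rightarrow> ('a \<Rightarrow> complex) \<Rightarrow> 'a \<Rightarrow> complex" where
  "res U h = (\<lambda>x. if x \<in> U then h x else 0)"

definition cst :: "'a set \<Rightarrow> complex \<Rightarrow> 'a \<Rightarrow> complex" where
  "cst U c = res U (\<lambda>_. c)"

definition nonvan :: "('a \<Rightarrow> complex) \<Rightarrow> 'a set" where
  "nonvan h = {x. h x \<noteq> 0}"

section \<open>Differential operators and the Bernstein-Sato polynomial of a function\<close>

text \<open>
  In this section \<open>A\<close> is a \<open>\<complex>\<close>-algebra of functions on some set, and \<open>f \<in> A\<close>.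
  The localization \<open>A\<^sub>f\<close> is an algebra of functions on the set where \<open>f\<close> does not vanish.
\<close>

definition fraction :: "('a \<Rightarrow> complex) \<Rightarrow> ('a \<Rightarrow> complex) \<Rightarrow> nat \<Rightarrow> 'a \<Rightarrow> complex" where
  "fraction f a n = res (nonvan f) (\<lambda>x. a x / f x ^ n)"

definition localization :: "('a \<Rightarrow> complex) set \<Rightarrow> ('a \<Rightarrow> complex) \<Rightarrow> ('a \<Rightarrow> complex) set" where
  "localization A f = {fraction f a n | a n. a \<in> A}"

definition derivations ::
  "('a \<Rightarrow> complex) set \<Rightarrow> (('a \<Rightarrow> complex) \<Rightarrow> ('a \<Rightarrow> complex)) set" where
  "derivations A = {\<delta> \<in> A \<rightarrow>\<^sub>E A.
     (\<forall>a\<in>A. \<forall>b\<in>A. \<delta> (a + b) = \<delta> a + \<delta> b) \<and>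
     (\<forall>c. \<forall>a\<in>A. \<delta> (\<lambda>x. c * a x) = (\<lambda>x. c * \<delta> a x)) \<and>
     (\<forall>a\<in>A. \<forall>b\<in>A. \<delta> (a * b) = a * \<delta> b + \<delta> a * b)}"

text \<open>
  \<open>D(A)\<close> as a subalgebra of the endomorphisms of \<open>A\<close>. The scalars, and in particular the
  identity, are multiplications by elements of \<open>A\<close>.
\<close>

inductive_set diff_ops ::
  "('a \<Rightarrow> complex) set \<Rightarrow> (('a \<Rightarrow> complex) \<Rightarrow> ('a \<Rightarrow> complex)) set"
  for A :: "('a \<Rightarrow> complex) set" where
  mult: "a \<in> A \<Longrightarrow> (\<lambda>h\<in>A. a * h) \<in> diff_ops A"
| der: "\<delta> \<in> derivations A \<Longrightarrow> \<delta> \<in> diff_ops A"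
| add: "P \<in> diff_ops A \<Longrightarrow> Q \<in> diff_ops A \<Longrightarrow> (\<lambda>h\<in>A. P h + Q h) \<in> diff_ops A"
| comp: "P \<in> diff_ops A \<Longrightarrow> Q \<in> diff_ops A \<Longrightarrow> compose A P Q \<in> diff_ops A"

text \<open>The extension of a derivation of \<open>A\<close> to \<open>A\<^sub>f\<close>, given by the quotient rule.\<close>

definition der_loc ::
  "('a \<Rightarrow> complex) set \<Rightarrow> ('a \<Rightarrow> complex) \<Rightarrow> (('a \<Rightarrow> complex) \<Rightarrow> ('a \<Rightarrow> complex))
     \<Rightarrow> ('a \<Rightarrow> complex) \<Rightarrow> 'a \<Rightarrow> complex" where
  "der_loc A f \<delta> h = (THE k. \<exists>a n. a \<in> A \<and> h = fraction f a n \<and>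
      k = fraction f (\<delta> a * f - of_nat n * a * \<delta> f) (Suc n))"

text \<open>
  An element \<open>p \<cdot> f\<^sup>s\<close> of the free module \<open>A\<^sub>f[s] \<cdot> f\<^sup>s\<close> is represented by
  the polynomial \<open>p\<close> in \<open>s\<close> with coefficients in \<open>A\<^sub>f\<close>. The following is
  \<open>\<delta>(h f\<^sup>s) = (\<delta>(h) + s h \<delta>(f)/f) f\<^sup>s\<close>, extended \<open>\<complex>[s]\<close>-linearly.
\<close>

definition der_act ::
  "('a \<Rightarrow> complex) set \<Rightarrow> ('a \<Rightarrow> complex) \<Rightarrow> (('a \<Rightarrow> complex) \<Rightarrow> ('a \<Rightarrow> complex))
     \<Rightarrow> ('a \<Rightarrow> complex) poly \<Rightarrow> ('a \<Rightarrow> complex) poly" where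
  "der_act A f \<delta> p = map_poly (der_loc A f \<delta>) p + [:0, 1:] * smult (fraction f (\<delta> f) 1) p"

text \<open>
  \<open>diff_ops_act A f P T\<close>: the differential operator \<open>P \<in> D(A)\<close> acts on
  \<open>A\<^sub>f[s] \<cdot> f\<^sup>s\<close> as \<open>T\<close>. This is the graph of the module structure, which is
  determined by the action of the generators.
\<close>

inductive diff_ops_act ::
  "('a \<Rightarrow> complex) set \<Rightarrow> ('a \<Rightarrow> complex) \<Rightarrow> (('a \<Rightarrow> complex) \<Rightarrow> ('a \<Rightarrow> complex))
     \<Rightarrow> (('a \<Rightarrow> complex) poly \<Rightarrow> ('a \<Rightarrow> complex) poly) \<Rightarrow> bool"
  for A :: "('a \<Rightarrow> complex) set" and f :: "'a \<Rightarrow> complex" where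
  mult: "a \<in> A \<Longrightarrow> diff_ops_act A f (\<lambda>h\<in>A. a * h) (smult a)"
| der: "\<delta> \<in> derivations A \<Longrightarrow> diff_ops_act A f \<delta> (der_act A f \<delta>)"
| add: "diff_ops_act A f P S \<Longrightarrow> diff_ops_act A f Q T \<Longrightarrow>
    diff_ops_act A f (\<lambda>h\<in>A. P h + Q h) (\<lambda>p. S p + T p)"
| comp: "diff_ops_act A f P S \<Longrightarrow> diff_ops_act A f Q T \<Longrightarrow>
    diff_ops_act A f (compose A P Q) (S \<circ> T)"

lemma diff_ops_iff_act: "P \<in> diff_ops A \<longleftrightarrow> (\<exists>T. diff_ops_act A f P T)"
proof
  assume "P \<in> diff_ops A"
  then show "\<exists>T. diff_ops_act A f P T"
    by induction (blast intro: diff_ops_act.intros)+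
next
  assume "\<exists>T. diff_ops_act A f P T"
  then obtain T where "diff_ops_act A f P T" ..
  then show "P \<in> diff_ops A"
    by induction (blast intro: diff_ops.intros)+
qed

text \<open>
  The submodule \<open>D(A)[s] \<cdot> u\<close>, whose elements are
  \<open>(\<Sum>k\<le>n. P\<^sub>k s\<^sup>k) \<cdot> u\<close> with \<open>P\<^sub>k \<in> D(A)\<close>.
\<close>

definition diff_ops_s_submodule ::
  "('a \<Rightarrow> complex) set \<Rightarrow> ('a \<Rightarrow> complex) \<Rightarrow> ('a \<Rightarrow> complex) poly
     \<Rightarrow> ('a \<Rightarrow> complex) poly set" where
  "diff_ops_s_submodule A f u = {\<Sum>k\<le>n. [:0, 1:] ^ k * T k u | (n :: nat) T.
      \<forall>k. \<exists>P\<in>diff_ops A. diff_ops_act A f P (T k)}"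

text \<open>
  \<open>bs_ideal A f\<close> consists of the \<open>b \<in> \<complex>[s]\<close> with
  \<open>b(s) f\<^sup>s \<in> D(A)[s] f\<^sup>s\<^sup>+\<^sup>1\<close>; here \<open>f\<^sup>s\<^sup>+\<^sup>1 = f \<cdot> f\<^sup>s\<close> is
  represented by the constant polynomial \<open>f\<close>.
\<close>

definition bs_ideal :: "('a \<Rightarrow> complex) set \<Rightarrow> ('a \<Rightarrow> complex) \<Rightarrow> complex poly set" where
  "bs_ideal A f = {b. map_poly (cst (nonvan f)) b \<in> diff_ops_s_submodule A f [:f:]}"

definition is_bs_poly ::
  "('a \<Rightarrow> complex) set \<Rightarrow> ('a \<Rightarrow> complex) \<Rightarrow> complex poly \<Rightarrow> bool" where
  "is_bs_poly A f b \<longleftrightarrow> b \<in> bs_ideal A f \<and> lead_coeff b = 1 \<and>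
     (\<forall>c\<in>bs_ideal A f. c \<noteq> 0 \<longrightarrow> degree b \<le> degree c)"

text \<open>
  By a theorem of Bernstein the polynomial exists when \<open>A\<close> is the coordinate ring of a
  nonsingular affine variety; the value \<open>0\<close> is a dummy.
\<close>

definition bs_poly :: "('a \<Rightarrow> complex) set \<Rightarrow> ('a \<Rightarrow> complex) \<Rightarrow> complex poly" where
  "bs_poly A f = (if \<exists>b. is_bs_poly A f b then THE b. is_bs_poly A f b else 0)"

section \<open>Complex varieties\<close>

record 'a funsp =
  spc :: "'a topology"
  reg :: "'a set \<Rightarrow> ('a \<Rightarrow> complex) set"

abbreviation opn :: "('a, 'm) funsp_scheme \<Rightarrow> 'a set \<Rightarrow> bool" where
  "opn X U \<equiv> openin (spc X) U"

abbreviation pts :: "('a, 'm) funsp_scheme \<Rightarrow> 'a set" where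
  "pts X \<equiv> topspace (spc X)"

definition algebra_of_functions :: "'a set \<Rightarrow> ('a \<Rightarrow> complex) set \<Rightarrow> bool" where
  "algebra_of_functions U A \<longleftrightarrow>
     (\<forall>h\<in>A. \<forall>x. x \<notin> U \<longrightarrow> h x = 0) \<and> (\<forall>c. cst U c \<in> A) \<and>
     (\<forall>h\<in>A. \<forall>k\<in>A. h + k \<in> A \<and> h * k \<in> A)"

definition space_with_functions :: "'a funsp \<Rightarrow> bool" where
  "space_with_functions X \<longleftrightarrow>
     (\<forall>U. opn X U \<longrightarrow> algebra_of_functions U (reg X U)) \<and>
     (\<forall>U V h. opn X U \<longrightarrow> opn X V \<longrightarrow> V \<subseteq> U \<longrightarrow> h \<in> reg X U \<longrightarrow> res V h \<in> reg X V) \<and>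
     (\<forall>U h. opn X U \<longrightarrow> (\<forall>x. x \<notin> U \<longrightarrow> h x = 0) \<longrightarrow>
        (\<forall>x\<in>U. \<exists>V. opn X V \<and> x \<in> V \<and> V \<subseteq> U \<and> res V h \<in> reg X V) \<longrightarrow> h \<in> reg X U) \<and>
     (\<forall>U h. opn X U \<longrightarrow> h \<in> reg X U \<longrightarrow>
        opn X (nonvan h) \<and> res (nonvan h) (\<lambda>x. 1 / h x) \<in> reg X (nonvan h))"

inductive_set alg_gen :: "'a set \<Rightarrow> ('a \<Rightarrow> complex) set \<Rightarrow> ('a \<Rightarrow> complex) set"
  for U :: "'a set" and G :: "('a \<Rightarrow> complex) set" where
  cst: "cst U c \<in> alg_gen U G"
| gen: "g \<in> G \<Longrightarrow> g \<in> alg_gen U G"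
| add: "h \<in> alg_gen U G \<Longrightarrow> k \<in> alg_gen U G \<Longrightarrow> h + k \<in> alg_gen U G"
| mult: "h \<in> alg_gen U G \<Longrightarrow> k \<in> alg_gen U G \<Longrightarrow> h * k \<in> alg_gen U G"

definition alg_hom_to_complex ::
  "'a set \<Rightarrow> ('a \<Rightarrow> complex) set \<Rightarrow> (('a \<Rightarrow> complex) \<Rightarrow> complex) \<Rightarrow> bool" where
  "alg_hom_to_complex U A \<phi> \<longleftrightarrow>
     (\<forall>c. \<phi> (cst U c) = c) \<and>
     (\<forall>h\<in>A. \<forall>k\<in>A. \<phi> (h + k) = \<phi> h + \<phi> k \<and> \<phi> (h * k) = \<phi> h * \<phi> k)"

text \<open>
  \<open>U\<close> is affine: with \<open>A\<close> the algebra of regular functions on \<open>U\<close>, the algebra \<open>A\<close> is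
  finitely generated and \<open>U\<close> with its structure sheaf is the maximal spectrum of \<open>A\<close>. The
  points of the maximal spectrum are taken to be the \<open>\<complex>\<close>-algebra homomorphisms \<open>A \<rightarrow> \<complex>\<close>.
\<close>

definition affine_open :: "'a funsp \<Rightarrow> 'a set \<Rightarrow> bool" where
  "affine_open X U \<longleftrightarrow> opn X U \<and>
     (\<exists>G. finite G \<and> reg X U = alg_gen U G) \<and>
     (\<forall>\<phi>. alg_hom_to_complex U (reg X U) \<phi> \<longrightarrow> (\<exists>!x. x \<in> U \<and> (\<forall>h\<in>reg X U. \<phi> h = h x))) \<and>
     (\<forall>W\<subseteq>U. opn X W \<longleftrightarrow> (\<exists>H\<subseteq>reg X U. W = (\<Union>h\<in>H. nonvan h))) \<and>
     (\<forall>h\<in>reg X U. reg X (nonvan h) = localization (reg X U) h)"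

text \<open>The product of two spaces with functions.\<close>

definition tensor_fun :: "('a \<Rightarrow> complex) \<Rightarrow> ('b \<Rightarrow> complex) \<Rightarrow> 'a \<times> 'b \<Rightarrow> complex"
  where "tensor_fun f g = (\<lambda>(x, y). f x * g y)"

definition tensor_alg ::
  "('a \<Rightarrow> complex) set \<Rightarrow> ('b \<Rightarrow> complex) set \<Rightarrow> ('a \<times> 'b \<Rightarrow> complex) set" where
  "tensor_alg A B = {\<Sum>i<n. tensor_fun (a i) (b i) | (n :: nat) a b. a \<in> {..<n} \<rightarrow> A \<and> b \<in> {..<n} \<rightarrow> B}"

definition prod_space :: "'a funsp \<Rightarrow> 'b funsp \<Rightarrow> ('a \<times> 'b) funsp" where
  "prod_space X Y = \<lparr>
     spc = topology_generated_by
       {nonvan t | t U V. opn X U \<and> opn Y V \<and> t \<in> tensor_alg (reg X U) (reg Y V)},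
     reg = (\<lambda>W. {h. (\<forall>p. p \<notin> W \<longrightarrow> h p = 0) \<and>
       (\<forall>p\<in>W. \<exists>U V t u. opn X U \<and> opn Y V \<and>
          t \<in> tensor_alg (reg X U) (reg Y V) \<and> u \<in> tensor_alg (reg X U) (reg Y V) \<and>
          p \<in> nonvan u \<and> nonvan u \<subseteq> W \<and> (\<forall>q\<in>nonvan u. h q = t q / u q))})\<rparr>"

definition separated :: "'a funsp \<Rightarrow> bool" where
  "separated X \<longleftrightarrow> closedin (spc (prod_space X X)) {(x, x) | x. x \<in> pts X}"

definition irreducible_space :: "'a topology \<Rightarrow> bool" where
  "irreducible_space T \<longleftrightarrow> topspace T \<noteq> {} \<and>
     (\<forall>U V. openin T U \<longrightarrow> openin T V \<longrightarrow> U \<noteq> {} \<longrightarrow> V \<noteq> {} \<longrightarrow> U \<inter> V \<noteq> {})"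

text \<open>Algebras of functions are reduced, so that integral means irreducible.\<close>

definition integral_complex_variety :: "'a funsp \<Rightarrow> bool" where
  "integral_complex_variety X \<longleftrightarrow>
     space_with_functions X \<and>
     (\<exists>\<U>. finite \<U> \<and> (\<forall>U\<in>\<U>. affine_open X U) \<and> \<Union>\<U> = pts X) \<and>
     separated X \<and> irreducible_space (spc X)"

section \<open>Nonsingularity\<close>

definition krull_dim :: "('r, 'm) ring_scheme \<Rightarrow> enat" where
  "krull_dim R = Sup {enat n | n. \<exists>P. (\<forall>i\<le>n. primeideal (P i) R) \<and> (\<forall>i<n. P i \<subset> P (Suc i))}"

definition regular_local_ring :: "('r, 'm) ring_scheme \<Rightarrow> bool" where
  "regular_local_ring R \<longleftrightarrow> cring R \<and> noetherian_ring R \<and>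
     (\<exists>M. {I. maximalideal I R} = {M} \<and>
        (\<exists>G\<subseteq>carrier R. finite G \<and> M = genideal R G \<and> enat (card G) = krull_dim R))"

text \<open>A germ is an equivalence class of functions defined on open neighbourhoods.\<close>

definition germ ::
  "'a funsp \<Rightarrow> 'a \<Rightarrow> 'a set \<Rightarrow> ('a \<Rightarrow> complex) \<Rightarrow> ('a set \<times> ('a \<Rightarrow> complex)) set" where
  "germ X x U h = {(V, k). opn X V \<and> x \<in> V \<and> k \<in> reg X V \<and>
     (\<exists>W. opn X W \<and> x \<in> W \<and> W \<subseteq> U \<inter> V \<and> (\<forall>y\<in>W. h y = k y))}"

definition stalk :: "'a funsp \<Rightarrow> 'a \<Rightarrow> ('a set \<times> ('a \<Rightarrow> complex)) set ring" where
  "stalk X x = \<lparr>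
     carrier = {germ X x U h | U h. opn X U \<and> x \<in> U \<and> h \<in> reg X U},
     mult = (\<lambda>G H. \<Union>(U, h)\<in>G. \<Union>(V, k)\<in>H. germ X x (U \<inter> V) (res (U \<inter> V) (h * k))),
     one = germ X x (pts X) (cst (pts X) 1),
     zero = germ X x (pts X) (cst (pts X) 0),
     add = (\<lambda>G H. \<Union>(U, h)\<in>G. \<Union>(V, k)\<in>H. germ X x (U \<inter> V) (res (U \<inter> V) (h + k)))\<rparr>"

definition nonsingular :: "'a funsp \<Rightarrow> bool" where
  "nonsingular X \<longleftrightarrow> (\<forall>x\<in>pts X. regular_local_ring (stalk X x))"

section \<open>Effective Cartier divisors and their Bernstein-Sato polynomials\<close>

text \<open>
  An effective Cartier divisor \<open>D\<close> on an integral variety is given by its ideal sheaf: \<open>D U\<close>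
  is the ideal of the regular functions on \<open>U\<close> that are multiples of a local equation.
  \<open>local_equation X D U f\<close> says that \<open>D\<close> restricted to \<open>U\<close> is \<open>div(f)\<close>.
\<close>

definition local_equation ::
  "'a funsp \<Rightarrow> ('a set \<Rightarrow> ('a \<Rightarrow> complex) set) \<Rightarrow> 'a set \<Rightarrow> ('a \<Rightarrow> complex) \<Rightarrow> bool" where
  "local_equation X D U f \<longleftrightarrow> opn X U \<and> f \<in> reg X U \<and> f \<noteq> 0 \<and>
     (\<forall>V\<subseteq>U. opn X V \<longrightarrow> D V = {res V f * k | k. k \<in> reg X V})"

definition ideal_sheaf :: "'a funsp \<Rightarrow> ('a set \<Rightarrow> ('a \<Rightarrow> complex) set) \<Rightarrow> bool" where
  "ideal_sheaf X D \<longleftrightarrow>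
     (\<forall>U. opn X U \<longrightarrow> D U \<subseteq> reg X U \<and> 0 \<in> D U \<and>
        (\<forall>h\<in>D U. \<forall>k\<in>D U. h + k \<in> D U) \<and> (\<forall>h\<in>D U. \<forall>k\<in>reg X U. k * h \<in> D U)) \<and>
     (\<forall>U V h. opn X U \<longrightarrow> opn X V \<longrightarrow> V \<subseteq> U \<longrightarrow> h \<in> D U \<longrightarrow> res V h \<in> D V) \<and>
     (\<forall>U h. opn X U \<longrightarrow> h \<in> reg X U \<longrightarrow>
        (\<forall>x\<in>U. \<exists>V. opn X V \<and> x \<in> V \<and> V \<subseteq> U \<and> res V h \<in> D V) \<longrightarrow> h \<in> D U)"

definition effective_cartier_divisor ::
  "'a funsp \<Rightarrow> ('a set \<Rightarrow> ('a \<Rightarrow> complex) set) \<Rightarrow> bool" where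
  "effective_cartier_divisor X D \<longleftrightarrow> ideal_sheaf X D \<and>
     (\<forall>x\<in>pts X. \<exists>U f. x \<in> U \<and> affine_open X U \<and> local_equation X D U f)"

text \<open>The ideal sheaf of the zero divisor is the whole structure sheaf.\<close>

definition nonzero_cartier_divisor ::
  "'a funsp \<Rightarrow> ('a set \<Rightarrow> ('a \<Rightarrow> complex) set) \<Rightarrow> bool" where
  "nonzero_cartier_divisor X D \<longleftrightarrow> (\<exists>U. opn X U \<and> D U \<noteq> reg X U)"

definition affine_equations ::
  "'a funsp \<Rightarrow> ('a set \<Rightarrow> ('a \<Rightarrow> complex) set) \<Rightarrow> ('a set \<times> ('a \<Rightarrow> complex)) set \<Rightarrow> bool" where
  "affine_equations X D E \<longleftrightarrow>
     (\<forall>(U, f)\<in>E. affine_open X U \<and> local_equation X D U f) \<and> (\<Union>(U, f)\<in>E. U) = pts X"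

text \<open>
  \<open>Lcm\<close> of complex polynomials is normalized to be monic. The result does not depend on the
  chosen covering and equations.
\<close>

definition bs_poly_div ::
  "'a funsp \<Rightarrow> ('a set \<Rightarrow> ('a \<Rightarrow> complex) set) \<Rightarrow> complex poly" where
  "bs_poly_div X D =
     (let E = (SOME E. affine_equations X D E) in Lcm ((\<lambda>(U, f). bs_poly (reg X U) f) ` E))"

text \<open>
  The tensor product of two divisors: the ideal sheaf on the product of the functions which are
  locally multiples of some \<open>f \<otimes> g\<close>, with \<open>f\<close> and \<open>g\<close> local equations of the two divisors.
\<close>

definition tensor_div ::
  "'a funsp \<Rightarrow> 'b funsp \<Rightarrow> ('a set \<Rightarrow> ('a \<Rightarrow> complex) set) \<Rightarrow> ('b set \<Rightarrow> ('b \<Rightarrow> complex) set)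
     \<Rightarrow> ('a \<times> 'b) set \<Rightarrow> ('a \<times> 'b \<Rightarrow> complex) set" where
  "tensor_div X Y D E W = {h \<in> reg (prod_space X Y) W. \<forall>p\<in>W. \<exists>U V f g W'.
      affine_open X U \<and> local_equation X D U f \<and> affine_open Y V \<and> local_equation Y E V g \<and>
      opn (prod_space X Y) W' \<and> p \<in> W' \<and> W' \<subseteq> W \<inter> (U \<times> V) \<and>
      (\<exists>k\<in>reg (prod_space X Y) W'. res W' h = res W' (tensor_fun f g) * k)}"

end

theory Submission
  imports Defs "HOL-Analysis.Continuum_Not_Denumerable" "HOL-Computational_Algebra.Fundamental_Theorem_Algebra"
begin

text \<open>
  Let \<open>M\<^sub>f = D(A)[s] f\<^sup>s\<^sup>+\<^sup>1\<close>, so that \<open>b\<^sub>f\<close> generates the ideal of all \<open>b\<close> with \<open>b f\<^sup>s \<in> M\<^sub>f\<close>. Derivations of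
  \<open>A \<otimes> B\<close> are combinations of derivations of \<open>A\<close> and of \<open>B\<close>, whence \<open>M\<^bsub>f \<otimes> g\<^esub>\<close> is the image of
  \<open>M\<^sub>f \<otimes>\<^bsub>\<complex>[s]\<^esub> M\<^sub>g\<close>; in particular \<open>b\<^bsub>f \<otimes> g\<^esub>\<close> divides \<open>b\<^sub>f b\<^sub>g\<close>. If it were a proper divisor, then for some
  \<open>\<alpha>\<close> the tensor \<open>b\<^sub>f f\<^sup>s \<otimes> b\<^sub>g g\<^sup>s\<close> would be divisible by \<open>s - \<alpha>\<close> in \<open>M\<^sub>f \<otimes> M\<^sub>g\<close>. The modules are
  torsion-free over \<open>\<complex>[s]\<close>, so that \<open>b\<^sub>f f\<^sup>s\<close> would be divisible by \<open>s - \<alpha>\<close> in \<open>M\<^sub>f\<close> or \<open>b\<^sub>g g\<^sup>s\<close> in \<open>M\<^sub>g\<close>,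
  contrary to the minimality of \<open>b\<^sub>f\<close> and \<open>b\<^sub>g\<close>.

  For divisors, \<open>b f\<^sup>s \<in> M\<^sub>f\<close> is a local condition by the Nullstellensatz and it does not change if \<open>f\<close> is
  multiplied by a unit. Hence the lcm over any covering can be used, and
  \<open>lcm\<^sub>i\<^sub>j (a\<^sub>i b\<^sub>j) = lcm\<^sub>i a\<^sub>i \<cdot> lcm\<^sub>j b\<^sub>j\<close>.
\<close>

section \<open>Polynomials with coefficients in functions\<close>

text \<open>Tensor products are realized by functions on the product, and elements of
  \<open>A\<^sub>f[s] f\<^sup>s\<close> by polynomials over functions, so that identities are tested
  by \<open>ev\<close> at points, in the domain \<complex>[s], and torsion-freeness is immediate.
  There are two costs: on a slice of the product \<open>f \<otimes> g\<close> becomes a multiple of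
  \<open>f\<close> by a constant which may be 0, and the tensors on \<open>U \<times> V\<close> have
  to be identified with the regular functions there, which takes the Nullstellensatz again.

  The quotient of a module by \<open>s - \<alpha>\<close> does not consist of functions.
  Divisibility of a tensor is therefore treated by elimination inside the modules, with relations
  that come from evaluating one factor at a point.

  Bernstein-Sato polynomials are compared through their multiples only. This suits the lcm over a
  covering of any size, and it includes the value 0 of \<open>bs_poly\<close>, which generates the
  zero ideal.

  Finite generation of \<open>A\<close> makes the decomposition of derivations finite, yields one
  denominator for all values of a derivation, and keeps the dimension of \<open>A\<close> countable
  for the Nullstellensatz.\<close>

definition ev :: "'a \<Rightarrow> ('a \<Rightarrow> complex) poly \<Rightarrow> complex poly" where
  "ev x = map_poly (\<lambda>h. h x)"

text \<open>The constants are not cut off to an open set, so that this is a unital homomorphism of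
  rings. Elements that vanish off \<open>U\<close> do not distinguish it from
  \<open>cst U\<close>.\<close>

definition constant_poly :: "complex poly \<Rightarrow> ('a \<Rightarrow> complex) poly" where
  "constant_poly = map_poly (\<lambda>c _. c)"

lemma coeff_ev [simp]: "coeff (ev x p) n = coeff p n x"
  by (simp add: ev_def coeff_map_poly)

lemma coeff_constant_poly [simp]: "coeff (constant_poly c) n = (\<lambda>_. coeff c n)"
  by (simp add: constant_poly_def coeff_map_poly zero_fun_def)

lemma sum_fun_apply: "(\<Sum>i\<in>I. f i) x = (\<Sum>i\<in>I. f i x)"
  by (induction I rule: infinite_finite_induct) auto

lemma power_fun_apply: "(f ^ n) x = f x ^ n" for f :: "'a \<Rightarrow> 'b::monoid_mult"
  by (induction n) auto

text \<open>Functions form a ring with zero divisors; at a point, cancellation in \<complex>[s]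
  becomes available.\<close>

lemma poly_fun_eqI: "(\<And>x. ev x p = ev x q) \<Longrightarrow> p = q"
  by (metis coeff_ev ext poly_eqI)

lemma ev_0 [simp]: "ev x 0 = 0"
  and ev_add [simp]: "ev x (p + q) = ev x p + ev x q"
  and ev_diff [simp]: "ev x (p - q) = ev x p - ev x q"
  and ev_smult [simp]: "ev x (smult a p) = smult (a x) (ev x p)"
  and ev_mult [simp]: "ev x (p * q) = ev x p * ev x q"
  and ev_pCons [simp]: "ev x (pCons a p) = pCons (a x) (ev x p)"
  and ev_constant_poly [simp]: "ev x (constant_poly c) = c"
  by (auto intro!: poly_eqI simp: coeff_mult sum_fun_apply coeff_pCons split: nat.split)

lemma ev_1 [simp]: "ev x 1 = 1"
  by (simp add: one_pCons del: One_nat_def)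

lemma ev_sum [simp]: "ev x (\<Sum>i\<in>I. p i) = (\<Sum>i\<in>I. ev x (p i))"
  by (induction I rule: infinite_finite_induct) auto

lemma constant_poly_simps:
  "constant_poly (c + d) = constant_poly c + constant_poly d"
  "constant_poly (c * d) = constant_poly c * constant_poly d"
  "constant_poly 0 = 0" "constant_poly 1 = 1"
  "constant_poly (pCons a c) = smult (\<lambda>_. a) 1 + [:0, 1:] * constant_poly c"
  by (auto intro!: poly_fun_eqI)

section \<open>Algebras of functions\<close>

lemma res_apply: "res U h x = (if x \<in> U then h x else 0)"
  by (simp add: res_def)

lemma cst_apply: "cst U c x = (if x \<in> U then c else 0)"
  by (simp add: cst_def res_def)

lemma mem_nonvan: "x \<in> nonvan h \<longleftrightarrow> h x \<noteq> 0"
  by (simp add: nonvan_def)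

lemma nonvan_eq_empty: "nonvan h = {} \<longleftrightarrow> h = 0"
  by (auto simp: nonvan_def fun_eq_iff)

lemma fraction_apply: "fraction f a n x = a x / f x ^ n * (if f x = 0 then 0 else 1)"
  by (simp add: fraction_def res_def nonvan_def)

lemma fraction_eq: "f x \<noteq> 0 \<Longrightarrow> fraction f a n x = a x / f x ^ n"
  by (simp add: fraction_apply)

lemma fraction_outside: "f x = 0 \<Longrightarrow> fraction f a n x = 0"
  by (simp add: fraction_apply)

lemma in_localization: "a \<in> A \<Longrightarrow> fraction f a n \<in> localization A f"
  by (auto simp: localization_def)

lemma localization_outside: "k \<in> localization A f \<Longrightarrow> f x = 0 \<Longrightarrow> k x = 0"
  by (auto simp: localization_def fraction_apply)

locale function_algebra =
  fixes U :: "'a set" and A :: "('a \<Rightarrow> complex) set"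
  assumes algebra_of_functions: "algebra_of_functions U A"
begin

lemma vanishes: "h \<in> A \<Longrightarrow> x \<notin> U \<Longrightarrow> h x = 0"
  and cst_closed: "cst U c \<in> A"
  and add_closed: "h \<in> A \<Longrightarrow> k \<in> A \<Longrightarrow> h + k \<in> A"
  and mult_closed: "h \<in> A \<Longrightarrow> k \<in> A \<Longrightarrow> h * k \<in> A"
  using algebra_of_functions by (auto simp: algebra_of_functions_def)

lemma unit_mult: "h \<in> A \<Longrightarrow> cst U 1 * h = h"
  using vanishes by (fastforce simp: cst_apply)

lemma scale_closed: "h \<in> A \<Longrightarrow> (\<lambda>x. c * h x) \<in> A"
proof -
  assume "h \<in> A"
  moreover from this have "cst U c * h = (\<lambda>x. c * h x)"
    using vanishes by (fastforce simp: cst_apply)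
  ultimately show ?thesis
    using mult_closed[OF cst_closed[of c]] by metis
qed

lemma zero_closed: "0 \<in> A"
  using cst_closed[of 0] by (simp add: cst_def res_def zero_fun_def)

lemma diff_closed: "h \<in> A \<Longrightarrow> k \<in> A \<Longrightarrow> h - k \<in> A"
proof -
  assume "h \<in> A" "k \<in> A"
  moreover have "h - k = h + (\<lambda>x. - 1 * k x)"
    by auto
  ultimately show ?thesis
    using add_closed scale_closed by metis
qed

lemma of_nat_closed: "h \<in> A \<Longrightarrow> of_nat n * h \<in> A"
proof -
  have "of_nat n * h = (\<lambda>x. of_nat n * h x)"
    by auto
  then show "h \<in> A \<Longrightarrow> of_nat n * h \<in> A"
    using scale_closed by metis
qed

lemma sum_closed: "(\<And>i. i \<in> I \<Longrightarrow> h i \<in> A) \<Longrightarrow> (\<Sum>i\<in>I. h i) \<in> A"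
  by (induction I rule: infinite_finite_induct) (auto intro: zero_closed add_closed)

lemma power_mult_closed: "h \<in> A \<Longrightarrow> k \<in> A \<Longrightarrow> h ^ n * k \<in> A"
  by (induction n) (auto intro: mult_closed simp: mult.assoc)

lemma nonvan_subset: "h \<in> A \<Longrightarrow> nonvan h \<subseteq> U"
  using vanishes by (auto simp: nonvan_def)

text \<open>The power \<open>f ^ 0\<close> is \<open>1\<close> everywhere, whereas the unit of \<open>A\<close> is \<open>cst U 1\<close>.\<close>

lemma power_closed: "f \<in> A \<Longrightarrow> cst U 1 * f ^ n \<in> A"
  using power_mult_closed[OF _ cst_closed[of 1], of f n] by (simp add: mult.commute)

text \<open>This form frees the quotient rule from exponents: a denominator \<open>d\<close> is any
  element of \<open>A\<close> that vanishes nowhere on the set where \<open>f\<close> is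
  nonzero.\<close>

lemma localization_witness:
  assumes "k \<in> localization A f" "f \<in> A"
  obtains d a where "d \<in> A" "a \<in> A" "\<And>x. f x \<noteq> 0 \<Longrightarrow> d x \<noteq> 0" "\<And>x. f x \<noteq> 0 \<Longrightarrow> d x * k x = a x"
proof -
  obtain a n where "a \<in> A" "k = fraction f a n"
    using assms by (auto simp: localization_def)
  then show ?thesis
    using vanishes[OF assms(2)]
    by (intro that[of "cst U 1 * f ^ n" a] power_closed[OF assms(2)])
      (auto simp: cst_apply power_fun_apply fraction_apply)
qed

lemma algebra_of_functions_localization:
  assumes "f \<in> A"
  shows "algebra_of_functions (nonvan f) (localization A f)"
  unfolding algebra_of_functions_def
proof (intro conjI ballI allI impI)
  fix c
  have "cst (nonvan f) c = fraction f (cst U c) 0"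
    using vanishes[OF assms] by (auto simp: fraction_apply cst_apply mem_nonvan)
  then show "cst (nonvan f) c \<in> localization A f"
    using in_localization cst_closed by metis
next
  fix h k assume "h \<in> localization A f" "k \<in> localization A f"
  then obtain a n b m where h: "a \<in> A" "h = fraction f a n" and k: "b \<in> A" "k = fraction f b m"
    by (auto simp: localization_def)
  have "h + k = fraction f (f ^ m * a + f ^ n * b) (n + m)"
  proof
    fix x
    show "(h + k) x = fraction f (f ^ m * a + f ^ n * b) (n + m) x"
      unfolding h(2) k(2) by (cases "f x = 0") (simp_all add: fraction_eq fraction_outside power_fun_apply power_add add_frac_eq mult.commute)
  qed
  then show "h + k \<in> localization A f"
    using h k assms by (metis in_localization power_mult_closed add_closed)
  have "h * k = fraction f (a * b) (n + m)"
    by (auto simp: h k fraction_apply power_add)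
  then show "h * k \<in> localization A f"
    using h k by (metis in_localization mult_closed)
qed (auto simp: localization_def fraction_apply mem_nonvan)

lemma function_algebra_localization: "f \<in> A \<Longrightarrow> function_algebra (nonvan f) (localization A f)"
  by (simp add: function_algebra_def algebra_of_functions_localization)

lemma res_in_localization: "a \<in> A \<Longrightarrow> res (nonvan f) a \<in> localization A f"
proof -
  have "res (nonvan f) a = fraction f a 0"
    by (simp add: fraction_def)
  then show "a \<in> A \<Longrightarrow> res (nonvan f) a \<in> localization A f"
    using in_localization by metis
qed

end

section \<open>Derivations\<close>

context function_algebra
begin

context
  fixes \<delta> assumes der: "\<delta> \<in> derivations A"
begin

lemma der_closed: "a \<in> A \<Longrightarrow> \<delta> a \<in> A"
  and der_add: "a \<in> A \<Longrightarrow> b \<in> A \<Longrightarrow> \<delta> (a + b) = \<delta> a + \<delta> b"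
  and der_scale: "a \<in> A \<Longrightarrow> \<delta> (\<lambda>x. c * a x) = (\<lambda>x. c * \<delta> a x)"
  and der_mult: "a \<in> A \<Longrightarrow> b \<in> A \<Longrightarrow> \<delta> (a * b) = a * \<delta> b + \<delta> a * b"
  using der by (auto simp: derivations_def)

lemma der_zero: "\<delta> 0 = 0"
  using der_add[OF zero_closed zero_closed] by simp

lemma der_cst: "\<delta> (cst U c) = 0"
proof -
  have 1: "\<delta> (cst U 1) = \<delta> (cst U 1) + \<delta> (cst U 1)"
    using der_mult[OF cst_closed cst_closed, of 1 1] unit_mult[OF cst_closed, of 1]
      unit_mult[OF der_closed[OF cst_closed], of 1]
    by (simp add: mult.commute)
  have "cst U c = (\<lambda>x. c * cst U 1 x)"
    by (auto simp: cst_apply)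
  then have "\<delta> (cst U c) = (\<lambda>x. c * \<delta> (cst U 1) x)"
    using der_scale[OF cst_closed, of c 1] by metis
  moreover have "\<delta> (cst U 1) = 0"
    using 1 by simp
  ultimately show ?thesis
    by auto
qed

text \<open>The form \<open>n f^n \<delta>(f) / f\<close> avoids the exponent \<open>n - 1\<close>,
  so that \<open>n = 0\<close> is no exception.\<close>

lemma der_power: "f \<in> A \<Longrightarrow> f x \<noteq> 0 \<Longrightarrow> \<delta> (cst U 1 * f ^ n) x = of_nat n * f x ^ n * \<delta> f x / f x"
proof (induction n)
  case 0
  then show ?case by (simp add: der_cst)
next
  case (Suc n)
  then have "x \<in> U"
    using vanishes by blast
  have "\<delta> (cst U 1 * f ^ Suc n) = \<delta> (f * (cst U 1 * f ^ n))"
    by (simp add: mult_ac)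
  also have "\<dots> = f * \<delta> (cst U 1 * f ^ n) + \<delta> f * (cst U 1 * f ^ n)"
    using Suc.prems by (intro der_mult power_closed)
  finally have *: "\<delta> (cst U 1 * f ^ Suc n) x = f x * \<delta> (cst U 1 * f ^ n) x + \<delta> f x * f x ^ n"
    using \<open>x \<in> U\<close> by (simp only: plus_fun_apply times_fun_apply power_fun_apply cst_apply) simp
  show ?case
    unfolding * Suc.IH[OF Suc.prems] using Suc.prems by (simp add: field_simps)
qed

text \<open>Both \<open>a / d\<close> and \<open>b / e\<close> represent \<open>k\<close>, but
  \<open>d * b = e * a\<close> is known only where \<open>f\<close> is nonzero. Multiplied by
  \<open>f\<close> it is an identity in \<open>A\<close> to which \<open>\<delta>\<close> can be
  applied; at \<open>x\<close> the factor \<open>f x\<close> cancels again.\<close>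

lemma quotient_rule_unique:
  assumes "f \<in> A" "a \<in> A" "d \<in> A" "b \<in> A" "e \<in> A"
    and "\<And>y. f y \<noteq> 0 \<Longrightarrow> d y * k y = a y" "\<And>y. f y \<noteq> 0 \<Longrightarrow> e y * k y = b y"
    and "f x \<noteq> 0"
  shows "d x * (\<delta> b x - k x * \<delta> e x) = e x * (\<delta> a x - k x * \<delta> d x)"
proof -
  have "f * (d * b) = f * (e * a)"
  proof
    fix y show "(f * (d * b)) y = (f * (e * a)) y"
      using assms(6,7)[of y] by (cases "f y = 0") (auto simp flip: assms(6,7))
  qed
  then have "\<delta> (f * (d * b)) x = \<delta> (f * (e * a)) x"
    by simp
  then have "f x * \<delta> (d * b) x + \<delta> f x * (d x * b x) = f x * \<delta> (e * a) x + \<delta> f x * (e x * a x)"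
    using assms by (simp add: der_mult mult_closed)
  moreover have "d x * b x = e x * a x"
    using assms(8) by (simp add: mult_ac flip: assms(6,7))
  ultimately have "\<delta> (d * b) x = \<delta> (e * a) x"
    using assms(8) by simp
  moreover have "\<delta> (d * b) x = d x * \<delta> b x + \<delta> d x * b x" "\<delta> (e * a) x = e x * \<delta> a x + \<delta> e x * a x"
    using assms by (simp_all add: der_mult)
  moreover have "b x = e x * k x" "a x = d x * k x"
    using assms by simp_all
  ultimately show ?thesis
    by (simp add: algebra_simps)
qed

text \<open>This makes the definite description in \<open>der_loc\<close> meaningful: two
  representations of one fraction yield the same value, by \<open>quotient_rule_unique\<close> with
  powers of \<open>f\<close> as denominators.\<close>

lemma der_loc_fraction:
  assumes "f \<in> A" "a \<in> A"
  shows "der_loc A f \<delta> (fraction f a n) = fraction f (\<delta> a * f - of_nat n * a * \<delta> f) (Suc n)"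
  unfolding der_loc_def
proof (rule the_equality)
  fix k assume "\<exists>b m. b \<in> A \<and> fraction f a n = fraction f b m \<and>
    k = fraction f (\<delta> b * f - of_nat m * b * \<delta> f) (Suc m)"
  then obtain b m where b: "b \<in> A" "fraction f a n = fraction f b m"
    and k: "k = fraction f (\<delta> b * f - of_nat m * b * \<delta> f) (Suc m)"
    by blast
  show "k = fraction f (\<delta> a * f - of_nat n * a * \<delta> f) (Suc n)"
  proof
    fix x
    show "k x = fraction f (\<delta> a * f - of_nat n * a * \<delta> f) (Suc n) x"
    proof (cases "f x = 0")
      case False
      have *: "a y = b y / f y ^ m * f y ^ n" "y \<in> U" if "f y \<noteq> 0" for y
        using fun_cong[OF b(2), of y] that vanishes[OF assms(1), of y] by (auto simp: fraction_apply field_simps)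
      have kk: "fraction f a n x = b x / f x ^ m" "fraction f a n x = a x / f x ^ n"
        using False fun_cong[OF b(2), of x] by (auto simp: fraction_apply)
      have "(cst U 1 * f ^ n) x * (\<delta> b x - fraction f a n x * \<delta> (cst U 1 * f ^ m) x) =
        (cst U 1 * f ^ m) x * (\<delta> a x - fraction f a n x * \<delta> (cst U 1 * f ^ n) x)"
        using * False
        by (intro quotient_rule_unique[OF assms(1)] power_closed assms b)
          (auto simp: cst_apply fraction_apply power_fun_apply)
      then have "f x ^ n * (\<delta> b x - b x / f x ^ m * (of_nat m * f x ^ m * \<delta> f x / f x)) =
        f x ^ m * (\<delta> a x - a x / f x ^ n * (of_nat n * f x ^ n * \<delta> f x / f x))"
        using der_power[OF assms(1) False] *(2)[OF False] kk
        by (simp add: cst_apply power_fun_apply)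
      then have "f x ^ n * (\<delta> b x - b x * of_nat m * \<delta> f x / f x) =
        f x ^ m * (\<delta> a x - a x * of_nat n * \<delta> f x / f x)"
        using False by (simp add: mult.assoc)
      moreover have "(\<delta> b x * f x - of_nat m * b x * \<delta> f x) / f x ^ Suc m = (\<delta> b x - b x * of_nat m * \<delta> f x / f x) / f x ^ m"
        "(\<delta> a x * f x - of_nat n * a x * \<delta> f x) / f x ^ Suc n = (\<delta> a x - a x * of_nat n * \<delta> f x / f x) / f x ^ n"
        using False by (simp_all add: diff_divide_distrib mult_ac)
      ultimately have "(\<delta> b x * f x - of_nat m * b x * \<delta> f x) / f x ^ Suc m =
        (\<delta> a x * f x - of_nat n * a x * \<delta> f x) / f x ^ Suc n"
        using False by (simp add: frac_eq_eq mult.commute)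
      then show ?thesis
        using False unfolding k by (simp add: fraction_eq)
    qed (simp add: k fraction_apply)
  qed
qed (use assms in blast)

text \<open>The rule for arbitrary denominators. A sum or product of \<open>a / d\<close> and
  \<open>b / e\<close> has the denominator \<open>d * e\<close>, and the rules for
  \<open>der_loc\<close> become instances of the Leibniz rule in \<open>A\<close>.\<close>

lemma der_loc_quotient_rule:
  assumes "f \<in> A" "k \<in> localization A f" "d \<in> A" "a \<in> A"
    and "\<And>y. f y \<noteq> 0 \<Longrightarrow> d y * k y = a y" and "f x \<noteq> 0"
  shows "d x * der_loc A f \<delta> k x = \<delta> a x - k x * \<delta> d x"
proof -
  obtain b n where b: "b \<in> A" "k = fraction f b n"
    using assms by (auto simp: localization_def)
  have U: "y \<in> U" if "f y \<noteq> 0" for y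
    using vanishes[OF assms(1)] that by blast
  have "d x * (\<delta> b x - k x * \<delta> (cst U 1 * f ^ n) x) = (cst U 1 * f ^ n) x * (\<delta> a x - k x * \<delta> d x)"
    using assms(1,3-6) U
    by (intro quotient_rule_unique[OF assms(1) _ assms(3)] power_closed b)
      (auto simp: cst_apply b(2) fraction_apply power_fun_apply)
  moreover have kx: "k x = b x / f x ^ n"
    using assms(6) by (simp add: b(2) fraction_eq)
  ultimately have *: "f x ^ n * (\<delta> a x - k x * \<delta> d x) = d x * (\<delta> b x - b x * of_nat n * \<delta> f x / f x)"
    using assms(6) U[OF assms(6)] der_power[OF assms(1,6)]
    by (simp add: power_fun_apply cst_apply mult.assoc)
  have "\<delta> a x - k x * \<delta> d x = d x * (\<delta> b x - b x * of_nat n * \<delta> f x / f x) / f x ^ n"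
    using assms(6) unfolding *[symmetric] by simp
  then show ?thesis
    using assms(6) by (simp add: b(2) der_loc_fraction[OF assms(1) b(1)] fraction_eq divide_simps mult_ac)
qed

lemma der_loc_closed: "f \<in> A \<Longrightarrow> k \<in> localization A f \<Longrightarrow> der_loc A f \<delta> k \<in> localization A f"
proof -
  assume "f \<in> A" "k \<in> localization A f"
  moreover from this obtain b n where b: "b \<in> A" "k = fraction f b n"
    by (auto simp: localization_def)
  ultimately show ?thesis
    by (simp add: der_loc_fraction)
      (intro in_localization diff_closed mult_closed of_nat_closed der_closed;
        simp add: mult.assoc mult_closed of_nat_closed der_closed)
qed

lemma der_loc_outside: "f \<in> A \<Longrightarrow> k \<in> localization A f \<Longrightarrow> f x = 0 \<Longrightarrow> der_loc A f \<delta> k x = 0"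
  using der_loc_closed localization_outside by metis

lemma der_loc_eqI:
  assumes "f \<in> A" "k \<in> localization A f" "f x \<noteq> 0"
    and "d \<in> A" "a \<in> A" "\<And>y. f y \<noteq> 0 \<Longrightarrow> d y * k y = a y"
    and "d x \<noteq> 0" "d x * v = \<delta> a x - k x * \<delta> d x"
  shows "der_loc A f \<delta> k x = v"
  using der_loc_quotient_rule[OF assms(1,2,4,5,6,3)] assms(7,8) by (metis mult_left_cancel)

lemma der_loc_res:
  assumes "f \<in> A" "a \<in> A"
  shows "der_loc A f \<delta> (res (nonvan f) a) = res (nonvan f) (\<delta> a)"
proof -
  have "res (nonvan f) a = fraction f a 0"
    by (simp add: fraction_def)
  then show ?thesis
    using assms by (auto simp: der_loc_fraction fraction_apply res_apply mem_nonvan)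
qed

lemma der_loc_0: "f \<in> A \<Longrightarrow> der_loc A f \<delta> 0 = 0"
proof -
  have "res (nonvan f) 0 = 0"
    by (auto simp: res_apply)
  then show "f \<in> A \<Longrightarrow> der_loc A f \<delta> 0 = 0"
    using der_loc_res[OF _ zero_closed, of f] by (simp only: der_zero)
qed

lemma der_loc_add:
  assumes "f \<in> A" "h \<in> localization A f" "k \<in> localization A f"
  shows "der_loc A f \<delta> (h + k) = der_loc A f \<delta> h + der_loc A f \<delta> k"
proof
  fix x
  interpret L: function_algebra "nonvan f" "localization A f"
    using assms by (rule_tac function_algebra_localization)
  obtain d a where d: "d \<in> A" "a \<in> A" "\<And>x. f x \<noteq> 0 \<Longrightarrow> d x \<noteq> 0" "\<And>x. f x \<noteq> 0 \<Longrightarrow> d x * h x = a x"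
    using localization_witness[OF assms(2,1)] by metis
  obtain e b where e: "e \<in> A" "b \<in> A" "\<And>x. f x \<noteq> 0 \<Longrightarrow> e x \<noteq> 0" "\<And>x. f x \<noteq> 0 \<Longrightarrow> e x * k x = b x"
    using localization_witness[OF assms(3,1)] by metis
  show "der_loc A f \<delta> (h + k) x = (der_loc A f \<delta> h + der_loc A f \<delta> k) x"
  proof (cases "f x = 0")
    case True
    then show ?thesis
      using assms by (simp add: der_loc_outside L.add_closed)
  next
    case False
    have h': "d x * der_loc A f \<delta> h x = \<delta> a x - h x * \<delta> d x"
      using der_loc_quotient_rule[OF assms(1,2) d(1,2,4) False] .
    have k': "e x * der_loc A f \<delta> k x = \<delta> b x - k x * \<delta> e x"
      using der_loc_quotient_rule[OF assms(1,3) e(1,2,4) False] .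
    have "d x * e x * (der_loc A f \<delta> h x + der_loc A f \<delta> k x)
      = e x * (d x * der_loc A f \<delta> h x) + d x * (e x * der_loc A f \<delta> k x)"
      by (simp add: algebra_simps)
    also have "\<dots> = e x * (\<delta> a x - h x * \<delta> d x) + d x * (\<delta> b x - k x * \<delta> e x)"
      by (simp only: h' k')
    finally have *: "d x * e x * (der_loc A f \<delta> h x + der_loc A f \<delta> k x)
      = e x * (\<delta> a x - h x * \<delta> d x) + d x * (\<delta> b x - k x * \<delta> e x)" .
    have "\<delta> (e * a + d * b) x = e x * \<delta> a x + \<delta> e x * a x + (d x * \<delta> b x + \<delta> d x * b x)"
      "\<delta> (d * e) x = d x * \<delta> e x + \<delta> d x * e x" "a x = d x * h x" "b x = e x * k x"
      using d e False by (simp_all add: der_mult der_add mult_closed)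
    with * have "(d * e) x * (der_loc A f \<delta> h + der_loc A f \<delta> k) x =
      \<delta> (e * a + d * b) x - (h + k) x * \<delta> (d * e) x"
      by (simp add: algebra_simps)
    moreover have "(d * e) y * (h + k) y = (e * a + d * b) y" if "f y \<noteq> 0" for y
      using d(4)[OF that, symmetric] e(4)[OF that, symmetric] by (simp add: algebra_simps)
    ultimately show ?thesis
      using d(1-3) e(1-3) False assms
      by (intro der_loc_eqI[where d = "d * e" and a = "e * a + d * b"])
        (auto intro: mult_closed add_closed L.add_closed)
  qed
qed

lemma der_loc_mult:
  assumes "f \<in> A" "h \<in> localization A f" "k \<in> localization A f"
  shows "der_loc A f \<delta> (h * k) = h * der_loc A f \<delta> k + der_loc A f \<delta> h * k"
proof
  fix x
  interpret L: function_algebra "nonvan f" "localization A f"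
    using assms by (rule_tac function_algebra_localization)
  obtain d a where d: "d \<in> A" "a \<in> A" "\<And>x. f x \<noteq> 0 \<Longrightarrow> d x \<noteq> 0" "\<And>x. f x \<noteq> 0 \<Longrightarrow> d x * h x = a x"
    using localization_witness[OF assms(2,1)] by metis
  obtain e b where e: "e \<in> A" "b \<in> A" "\<And>x. f x \<noteq> 0 \<Longrightarrow> e x \<noteq> 0" "\<And>x. f x \<noteq> 0 \<Longrightarrow> e x * k x = b x"
    using localization_witness[OF assms(3,1)] by metis
  show "der_loc A f \<delta> (h * k) x = (h * der_loc A f \<delta> k + der_loc A f \<delta> h * k) x"
  proof (cases "f x = 0")
    case True
    then show ?thesis
      using assms by (simp add: der_loc_outside L.mult_closed)
  next
    case False
    have h': "d x * der_loc A f \<delta> h x = \<delta> a x - h x * \<delta> d x"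
      using der_loc_quotient_rule[OF assms(1,2) d(1,2,4) False] .
    have k': "e x * der_loc A f \<delta> k x = \<delta> b x - k x * \<delta> e x"
      using der_loc_quotient_rule[OF assms(1,3) e(1,2,4) False] .
    have "d x * e x * (h x * der_loc A f \<delta> k x + der_loc A f \<delta> h x * k x)
      = d x * h x * (e x * der_loc A f \<delta> k x) + e x * k x * (d x * der_loc A f \<delta> h x)"
      by (simp add: algebra_simps)
    also have "\<dots> = d x * h x * (\<delta> b x - k x * \<delta> e x) + e x * k x * (\<delta> a x - h x * \<delta> d x)"
      by (simp only: h' k')
    finally have *: "d x * e x * (h x * der_loc A f \<delta> k x + der_loc A f \<delta> h x * k x)
      = d x * h x * (\<delta> b x - k x * \<delta> e x) + e x * k x * (\<delta> a x - h x * \<delta> d x)" .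
    have "\<delta> (a * b) x = a x * \<delta> b x + \<delta> a x * b x"
      "\<delta> (d * e) x = d x * \<delta> e x + \<delta> d x * e x" "a x = d x * h x" "b x = e x * k x"
      using d e False by (simp_all add: der_mult)
    with * have "(d * e) x * (h * der_loc A f \<delta> k + der_loc A f \<delta> h * k) x =
      \<delta> (a * b) x - (h * k) x * \<delta> (d * e) x"
      by (simp add: algebra_simps)
    moreover have "(d * e) y * (h * k) y = (a * b) y" if "f y \<noteq> 0" for y
      using d(4)[OF that, symmetric] e(4)[OF that, symmetric] by (simp add: algebra_simps)
    ultimately show ?thesis
      using d(1-3) e(1-3) False assms
      by (intro der_loc_eqI[where d = "d * e" and a = "a * b"])
        (auto intro: mult_closed L.mult_closed)
  qed
qed

lemma der_loc_scale:
  assumes "f \<in> A" "k \<in> localization A f"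
  shows "der_loc A f \<delta> (\<lambda>x. c * k x) = (\<lambda>x. c * der_loc A f \<delta> k x)"
proof -
  have "(\<lambda>x. c * k x) = res (nonvan f) (cst U c) * k"
    using localization_outside[OF assms(2)] vanishes[OF assms(1)]
    by (auto simp: fun_eq_iff res_apply cst_apply mem_nonvan)
  then have "der_loc A f \<delta> (\<lambda>x. c * k x) = res (nonvan f) (cst U c) * der_loc A f \<delta> k"
    using assms der_loc_mult[OF assms(1) res_in_localization[OF cst_closed] assms(2), of c]
    by (simp add: der_loc_res cst_closed der_cst) (simp add: res_def zero_fun_def fun_eq_iff)
  then show ?thesis
    using der_loc_outside[OF assms] vanishes[OF assms(1)]
    by (auto simp: fun_eq_iff res_apply cst_apply mem_nonvan)
qed

lemma derivation_localization:
  assumes "f \<in> A"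
  shows "restrict (der_loc A f \<delta>) (localization A f) \<in> derivations (localization A f)"
proof -
  interpret L: function_algebra "nonvan f" "localization A f"
    using assms by (rule function_algebra_localization)
  show ?thesis
    using assms unfolding derivations_def
    by (auto simp: der_loc_closed der_loc_add der_loc_scale der_loc_mult L.add_closed L.mult_closed
        L.scale_closed)
qed

end

end


section \<open>The module generated by \<open>f\<^sup>s\<^sup>+\<^sup>1\<close>\<close>

definition loc_polys :: "('a \<Rightarrow> complex) set \<Rightarrow> ('a \<Rightarrow> complex) \<Rightarrow> ('a \<Rightarrow> complex) poly set" where
  "loc_polys A f = {p. \<forall>n. coeff p n \<in> localization A f}"

inductive_set bs_module ::
  "('a \<Rightarrow> complex) set \<Rightarrow> ('a \<Rightarrow> complex) \<Rightarrow> ('a \<Rightarrow> complex) poly set"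
  for A :: "('a \<Rightarrow> complex) set" and f :: "'a \<Rightarrow> complex" where
  gen: "[:f:] \<in> bs_module A f"
| add: "p \<in> bs_module A f \<Longrightarrow> q \<in> bs_module A f \<Longrightarrow> p + q \<in> bs_module A f"
| shift: "p \<in> bs_module A f \<Longrightarrow> [:0, 1:] * p \<in> bs_module A f"
| smult: "a \<in> A \<Longrightarrow> p \<in> bs_module A f \<Longrightarrow> smult a p \<in> bs_module A f"
| der: "\<delta> \<in> derivations A \<Longrightarrow> p \<in> bs_module A f \<Longrightarrow> der_act A f \<delta> p \<in> bs_module A f"

definition bs_vec :: "('a \<Rightarrow> complex) \<Rightarrow> complex poly \<Rightarrow> ('a \<Rightarrow> complex) poly" where
  "bs_vec f b = smult (cst (nonvan f) 1) (constant_poly b)"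

text \<open>
  \<open>loc_polys A f\<close>, \<open>bs_module A f\<close> and \<open>bs_vec f b\<close> stand for \<open>A\<^sub>f[s] f\<^sup>s\<close>, \<open>D(A)[s] f\<^sup>s\<^sup>+\<^sup>1\<close> and \<open>b(s) f\<^sup>s\<close>.
\<close>

lemma ev_bs_vec: "ev x (bs_vec f b) = (if f x = 0 then 0 else b)"
  by (simp add: bs_vec_def cst_apply mem_nonvan)

lemma normalize_monic_poly: "lead_coeff p = 1 \<Longrightarrow> normalize p = p"
  for p :: "complex poly"
  by (simp add: normalize_poly_eq_map_poly)

lemma smult_sum_right: "smult a (\<Sum>i\<in>I. p i) = (\<Sum>i\<in>I. smult a (p i))"
  by (induction I rule: infinite_finite_induct) (auto simp: smult_add_right)

lemma map_poly_cst: "map_poly (cst (nonvan f)) b = bs_vec f b"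
  by (rule poly_eqI) (auto simp: coeff_map_poly bs_vec_def cst_def res_def zero_fun_def)

context function_algebra
begin

context
  fixes f assumes f: "f \<in> A"
begin

interpretation L: function_algebra "nonvan f" "localization A f"
  using f by (rule function_algebra_localization)

lemma in_nonvan_U: "f x \<noteq> 0 \<Longrightarrow> x \<in> U"
  using vanishes[OF f] by blast

lemma f_in_localization: "f \<in> localization A f"
proof -
  have "f = res (nonvan f) f"
    by (auto simp: res_apply mem_nonvan)
  then show ?thesis
    using res_in_localization[OF f, of f] by simp
qed

lemma loc_polys_outside: "p \<in> loc_polys A f \<Longrightarrow> f x = 0 \<Longrightarrow> ev x p = 0"
  by (rule poly_eqI) (simp add: loc_polys_def localization_outside[of _ A f])

lemma loc_polys_add: "p \<in> loc_polys A f \<Longrightarrow> q \<in> loc_polys A f \<Longrightarrow> p + q \<in> loc_polys A f"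
  by (simp add: loc_polys_def L.add_closed)

lemma loc_polys_shift: "p \<in> loc_polys A f \<Longrightarrow> [:0, 1:] * p \<in> loc_polys A f"
  by (auto simp: loc_polys_def coeff_pCons L.zero_closed split: nat.split)

lemma loc_polys_smult: "p \<in> loc_polys A f \<Longrightarrow> k \<in> localization A f \<Longrightarrow> smult k p \<in> loc_polys A f"
  by (simp add: loc_polys_def L.mult_closed)

text \<open>Elements of \<open>loc_polys\<close> vanish where \<open>f\<close> does, so an element
  of \<open>A\<close> acts through its image in the localization.\<close>

lemma smult_res: "p \<in> loc_polys A f \<Longrightarrow> smult a p = smult (res (nonvan f) a) p"
  by (rule poly_fun_eqI) (auto simp: res_apply mem_nonvan loc_polys_outside)

lemma loc_polys_smult': "p \<in> loc_polys A f \<Longrightarrow> a \<in> A \<Longrightarrow> smult a p \<in> loc_polys A f"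
  by (subst smult_res) (auto intro: loc_polys_smult res_in_localization)

lemma loc_polys_0: "0 \<in> loc_polys A f"
  by (simp add: loc_polys_def L.zero_closed)

lemma loc_polys_gen: "[:f:] \<in> loc_polys A f"
  by (auto simp: loc_polys_def coeff_pCons f_in_localization L.zero_closed split: nat.split)

lemma loc_polys_sum: "(\<And>i. i \<in> I \<Longrightarrow> p i \<in> loc_polys A f) \<Longrightarrow> (\<Sum>i\<in>I. p i) \<in> loc_polys A f"
  by (induction I rule: infinite_finite_induct) (auto intro: loc_polys_0 loc_polys_add)

lemma loc_polys_constant: "p \<in> loc_polys A f \<Longrightarrow> smult (\<lambda>_. c) p \<in> loc_polys A f"
proof -
  assume p: "p \<in> loc_polys A f"
  have "smult (\<lambda>_. c) p = smult (cst U c) p"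
    by (rule poly_fun_eqI) (use loc_polys_outside[OF p] in_nonvan_U in \<open>auto simp: cst_apply\<close>)
  then show ?thesis
    using p by (simp add: loc_polys_smult' cst_closed)
qed

lemma loc_polys_constant_poly: "p \<in> loc_polys A f \<Longrightarrow> constant_poly c * p \<in> loc_polys A f"
proof (induction c)
  case (pCons a c)
  then show ?case
    using loc_polys_add[OF loc_polys_constant[of p a] loc_polys_shift[of "constant_poly c * p"]]
    by (simp add: constant_poly_simps ring_distribs mult.assoc)
qed (simp add: constant_poly_simps loc_polys_0)

section \<open>The action of a derivation on \<open>A\<^sub>f[s] f\<^sup>s\<close>\<close>

context
  fixes \<delta> assumes \<delta>: "\<delta> \<in> derivations A"
begin

lemma coeff_der_act:
  "coeff (der_act A f \<delta> p) n = der_loc A f \<delta> (coeff p n) +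
     (case n of 0 \<Rightarrow> 0 | Suc m \<Rightarrow> fraction f (\<delta> f) 1 * coeff p m)"
  using der_loc_0[OF \<delta> f] by (simp add: der_act_def coeff_map_poly coeff_pCons split: nat.split)

lemma loc_polys_der_act: "p \<in> loc_polys A f \<Longrightarrow> der_act A f \<delta> p \<in> loc_polys A f"
  by (auto simp: loc_polys_def coeff_der_act
      intro!: L.add_closed L.mult_closed L.zero_closed der_loc_closed[OF \<delta> f]
        in_localization der_closed[OF \<delta> f] split: nat.split)

lemma der_act_add:
  "p \<in> loc_polys A f \<Longrightarrow> q \<in> loc_polys A f \<Longrightarrow>
    der_act A f \<delta> (p + q) = der_act A f \<delta> p + der_act A f \<delta> q"
  by (rule poly_eqI)
    (simp add: loc_polys_def coeff_der_act der_loc_add[OF \<delta> f] algebra_simps split: nat.split)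

lemma der_act_shift:
  "p \<in> loc_polys A f \<Longrightarrow> der_act A f \<delta> ([:0, 1:] * p) = [:0, 1:] * der_act A f \<delta> p"
  by (rule poly_eqI)
    (simp add: loc_polys_def coeff_der_act coeff_pCons der_loc_0[OF \<delta> f] split: nat.split)

lemma der_act_smult_loc:
  "p \<in> loc_polys A f \<Longrightarrow> k \<in> localization A f \<Longrightarrow>
    der_act A f \<delta> (smult k p) = smult k (der_act A f \<delta> p) + smult (der_loc A f \<delta> k) p"
  by (rule poly_eqI)
    (simp add: loc_polys_def coeff_der_act der_loc_mult[OF \<delta> f] algebra_simps split: nat.split)

lemma der_act_smult:
  assumes "p \<in> loc_polys A f" "a \<in> A"
  shows "der_act A f \<delta> (smult a p) = smult a (der_act A f \<delta> p) + smult (\<delta> a) p"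
  using der_act_smult_loc[OF assms(1) res_in_localization[OF assms(2)]] assms
  by (simp add: der_loc_res[OF \<delta> f] loc_polys_der_act flip: smult_res)

lemma der_act_constant:
  assumes p: "p \<in> loc_polys A f"
  shows "der_act A f \<delta> (smult (\<lambda>_. c) p) = smult (\<lambda>_. c) (der_act A f \<delta> p)"
proof -
  have *: "smult (\<lambda>_. c) q = smult (cst U c) q" if "q \<in> loc_polys A f" for q
    by (rule poly_fun_eqI) (use loc_polys_outside[OF that] in_nonvan_U in \<open>auto simp: cst_apply\<close>)
  show ?thesis
    using der_act_smult[OF p cst_closed, of c]
    by (simp add: * p loc_polys_der_act der_cst[OF \<delta>])
qed

lemma der_act_0: "der_act A f \<delta> 0 = 0"
  by (rule poly_eqI) (simp add: coeff_der_act der_loc_0[OF \<delta> f] split: nat.split)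

lemma der_act_constant_poly:
  "p \<in> loc_polys A f \<Longrightarrow>
    der_act A f \<delta> (constant_poly c * p) = constant_poly c * der_act A f \<delta> p"
proof (induction c)
  case (pCons a c)
  then have "der_act A f \<delta> (smult (\<lambda>_. a) p + [:0, 1:] * (constant_poly c * p)) =
    smult (\<lambda>_. a) (der_act A f \<delta> p) + [:0, 1:] * (constant_poly c * der_act A f \<delta> p)"
    by (simp only: der_act_add loc_polys_constant loc_polys_shift loc_polys_constant_poly
        der_act_constant der_act_shift)
  then show ?case
    by (simp only: constant_poly_simps ring_distribs mult.assoc mult_smult_left mult_1_left)
qed (simp add: constant_poly_simps der_act_0)

end

lemma bs_module_loc_polys: "p \<in> bs_module A f \<Longrightarrow> p \<in> loc_polys A f"
  by (induction rule: bs_module.induct)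
    (auto intro: loc_polys_gen loc_polys_add loc_polys_shift loc_polys_smult' loc_polys_der_act
      simp del: mult_pCons_left)

lemma bs_module_0: "0 \<in> bs_module A f"
  using bs_module.smult[OF zero_closed bs_module.gen, of f] by simp

lemma bs_module_sum: "(\<And>i. i \<in> I \<Longrightarrow> p i \<in> bs_module A f) \<Longrightarrow> (\<Sum>i\<in>I. p i) \<in> bs_module A f"
  by (induction I rule: infinite_finite_induct) (auto intro: bs_module_0 bs_module.add)

lemma bs_module_constant: "p \<in> bs_module A f \<Longrightarrow> smult (\<lambda>_. c) p \<in> bs_module A f"
proof -
  assume p: "p \<in> bs_module A f"
  have "smult (\<lambda>_. c) p = smult (cst U c) p"
    by (rule poly_fun_eqI)
      (use loc_polys_outside[OF bs_module_loc_polys[OF p]] in_nonvan_U in \<open>auto simp: cst_apply\<close>)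
  then show ?thesis
    using p by (simp add: bs_module.smult cst_closed)
qed

lemma bs_module_diff: "p \<in> bs_module A f \<Longrightarrow> q \<in> bs_module A f \<Longrightarrow> p - q \<in> bs_module A f"
proof -
  have "p - q = p + smult (\<lambda>_. -1) q"
    by (rule poly_fun_eqI) simp
  then show "p \<in> bs_module A f \<Longrightarrow> q \<in> bs_module A f \<Longrightarrow> p - q \<in> bs_module A f"
    by (simp only: bs_module.add bs_module_constant)
qed

lemma bs_module_constant_poly: "p \<in> bs_module A f \<Longrightarrow> constant_poly c * p \<in> bs_module A f"
proof (induction c)
  case (pCons a c)
  then show ?case
    using bs_module.add[OF bs_module_constant[of p a] bs_module.shift[of "constant_poly c * p"]]
    by (simp add: constant_poly_simps ring_distribs mult.assoc)
qed (simp add: constant_poly_simps bs_module_0)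

lemma bs_module_power: "p \<in> bs_module A f \<Longrightarrow> [:0, 1:] ^ k * p \<in> bs_module A f"
  by (induction k) (auto simp only: power_0 power_Suc mult_1_left mult.assoc intro: bs_module.shift)

lemma bs_module_smult_power: "a \<in> A \<Longrightarrow> p \<in> bs_module A f \<Longrightarrow> smult (a ^ n) p \<in> bs_module A f"
proof (induction n)
  case (Suc n)
  then show ?case
    using bs_module.smult[of a A "smult (a ^ n) p" f] by (simp only: smult_smult power_Suc)
qed (simp only: power_0 smult_1_left)

section \<open>Agreement with the definition by differential operators\<close>

lemma diff_ops_act_bs_module: "diff_ops_act A f P T \<Longrightarrow> p \<in> bs_module A f \<Longrightarrow> T p \<in> bs_module A f"
  by (induction arbitrary: p rule: diff_ops_act.induct) (auto intro: bs_module.intros)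

lemma diff_ops_act_linear:
  "diff_ops_act A f P T \<Longrightarrow>
    (\<forall>p\<in>loc_polys A f. T p \<in> loc_polys A f \<and> T ([:0, 1:] * p) = [:0, 1:] * T p) \<and>
    (\<forall>p\<in>loc_polys A f. \<forall>q\<in>loc_polys A f. T (p + q) = T p + T q)"
proof (induction rule: diff_ops_act.induct)
  case (der \<delta>)
  then show ?case
    using der_act_shift der_act_add loc_polys_der_act by blast
qed (simp_all del: mult_pCons_left add: loc_polys_smult' loc_polys_add smult_add_right algebra_simps)

lemma diff_ops_act_sum:
  assumes T: "diff_ops_act A f P T" and q: "\<And>k. k \<le> n \<Longrightarrow> q k \<in> loc_polys A f"
  shows "T (\<Sum>k\<le>n. [:0, 1:] ^ k * q k) = (\<Sum>k\<le>n. [:0, 1:] ^ k * T (q k))"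
proof -
  have *: "[:0, 1:] ^ k * p \<in> loc_polys A f \<and> T ([:0, 1:] ^ k * p) = [:0, 1:] ^ k * T p"
    if "p \<in> loc_polys A f" for p k
    using that diff_ops_act_linear[OF T] 
    by (induction k) (auto simp only: power_0 power_Suc mult_1_left mult.assoc intro: loc_polys_shift)
  show ?thesis
    using q
  proof (induction n)
    case (Suc n)
    have "(\<Sum>k\<le>n. [:0, 1:] ^ k * q k) \<in> loc_polys A f"
      using * Suc.prems by (intro loc_polys_sum) auto
    moreover have "[:0, 1:] ^ Suc n * q (Suc n) \<in> loc_polys A f"
      using * Suc.prems by blast
    ultimately have "T ((\<Sum>k\<le>n. [:0, 1:] ^ k * q k) + [:0, 1:] ^ Suc n * q (Suc n)) =
      T (\<Sum>k\<le>n. [:0, 1:] ^ k * q k) + T ([:0, 1:] ^ Suc n * q (Suc n))"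
      using diff_ops_act_linear[OF T] by blast
    also have "T ([:0, 1:] ^ Suc n * q (Suc n)) = [:0, 1:] ^ Suc n * T (q (Suc n))"
      using * Suc.prems by blast
    also have "T (\<Sum>k\<le>n. [:0, 1:] ^ k * q k) = (\<Sum>k\<le>n. [:0, 1:] ^ k * T (q k))"
      using Suc.prems by (intro Suc.IH) simp
    finally show ?case
      by (simp only: sum.atMost_Suc)
  qed (simp only: atMost_0 sum.insert finite.emptyI sum.empty empty_iff not_False_eq_True power_0 mult_1_left add_0_right)
qed

text \<open>The closure is easier to use, as it allows induction over its generation. For the
  inclusion from right to left a derivation has to pass the powers of \<open>s\<close> in a sum,
  which it does because its action is additive and commutes with multiplication by
  \<open>s\<close>.\<close>

lemma diff_ops_s_submodule_eq: "diff_ops_s_submodule A f [:f:] = bs_module A f"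
proof -
  have "p \<in> diff_ops_s_submodule A f [:f:] \<longleftrightarrow> (\<exists>n T. p = (\<Sum>k\<le>n. [:0, 1:] ^ k * T k [:f:]) \<and>
      (\<forall>k. \<exists>P. diff_ops_act A f P (T k)))" for p
    unfolding diff_ops_s_submodule_def using diff_ops_iff_act by blast
  note eq = this
  show ?thesis
  proof (intro equalityI subsetI)
    fix p assume "p \<in> diff_ops_s_submodule A f [:f:]"
    then show "p \<in> bs_module A f"
      unfolding eq
      by (auto intro!: bs_module_sum bs_module_power intro: diff_ops_act_bs_module bs_module.gen)
  next
    fix p assume "p \<in> bs_module A f"
    then show "p \<in> diff_ops_s_submodule A f [:f:]"
    proof (induction rule: bs_module.induct)
      case gen
      have "[:f:] = (\<Sum>k\<le>(0::nat). [:0, 1:] ^ k * smult (cst U 1) [:f:])"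
        using unit_mult[OF f] by simp
      then show ?case
        unfolding eq using diff_ops_act.mult[OF cst_closed]
        by (intro exI[of _ "0::nat"] exI[of _ "\<lambda>_. smult (cst U 1)"]) blast
    next
      case (add p q)
      obtain n S where p: "p = (\<Sum>k\<le>n. [:0, 1:] ^ k * S k [:f:])" "\<forall>k. \<exists>P. diff_ops_act A f P (S k)"
        using add.IH(1) unfolding eq by blast
      obtain m T where q: "q = (\<Sum>k\<le>m. [:0, 1:] ^ k * T k [:f:])" "\<forall>k. \<exists>P. diff_ops_act A f P (T k)"
        using add.IH(2) unfolding eq by blast
      \<comment> \<open>Sums of different lengths are padded with the zero operator, the
        multiplication by \<open>0 \<in> A\<close>.\<close>
      define S' T' where "S' k = (if k \<le> n then S k else smult 0)"
        and "T' k = (if k \<le> m then T k else smult 0)" for k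
      have "p = (\<Sum>k\<le>n + m. [:0, 1:] ^ k * S' k [:f:])" "q = (\<Sum>k\<le>n + m. [:0, 1:] ^ k * T' k [:f:])"
        unfolding p(1) q(1) by (intro sum.mono_neutral_cong_left; auto simp: S'_def T'_def)+
      then have "p + q = (\<Sum>k\<le>n + m. [:0, 1:] ^ k * (\<lambda>p. S' k p + T' k p) [:f:])"
        by (simp add: sum.distrib algebra_simps)
      moreover have "\<exists>P. diff_ops_act A f P (\<lambda>p. S' k p + T' k p)" for k
        using p(2) q(2) diff_ops_act.mult[OF zero_closed, of f]
        by (auto simp: S'_def T'_def intro: diff_ops_act.add)
          (metis diff_ops_act.add)+
      ultimately show ?case
        unfolding eq by (intro exI[of _ "n + m"] exI[of _ "\<lambda>k p. S' k p + T' k p"]) blast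
    next
      case (shift p)
      obtain n S where p: "p = (\<Sum>k\<le>n. [:0, 1:] ^ k * S k [:f:])" "\<forall>k. \<exists>P. diff_ops_act A f P (S k)"
        using shift.IH unfolding eq by blast
      \<comment> \<open>Multiplication by \<open>s\<close> moves every coefficient one degree up;
        the vacant constant term is the zero operator.\<close>
      define T where "T k = (case k of 0 \<Rightarrow> smult 0 | Suc j \<Rightarrow> S j)" for k
      have "[:0, 1:] * p = (\<Sum>k\<le>Suc n. [:0, 1:] ^ k * T k [:f:])"
        unfolding p(1) sum_distrib_left
        by (subst sum.atMost_Suc_shift) (simp add: T_def mult.assoc del: mult_pCons_left)
      moreover have "\<exists>P. diff_ops_act A f P (T k)" for k
        using p(2) diff_ops_act.mult[OF zero_closed, of f] by (auto simp: T_def split: nat.split)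
      ultimately show ?case
        unfolding eq by blast
    next
      case (smult a p)
      obtain n S where p: "p = (\<Sum>k\<le>n. [:0, 1:] ^ k * S k [:f:])" "\<forall>k. \<exists>P. diff_ops_act A f P (S k)"
        using smult.IH unfolding eq by blast
      have "smult a p = (\<Sum>k\<le>n. [:0, 1:] ^ k * (smult a \<circ> S k) [:f:])"
        by (simp only: p(1) smult_sum_right mult_smult_right o_apply)
      moreover have "\<exists>P. diff_ops_act A f P (smult a \<circ> S k)" for k
        using p(2) diff_ops_act.mult[OF smult.hyps(1), of f] diff_ops_act.comp by blast
      ultimately show ?case
        unfolding eq by (intro exI[of _ n] exI[of _ "\<lambda>k. smult a \<circ> S k"]) blast
    next
      case (der \<delta> p)
      obtain n S where p: "p = (\<Sum>k\<le>n. [:0, 1:] ^ k * S k [:f:])" "\<forall>k. \<exists>P. diff_ops_act A f P (S k)"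
        using der.IH unfolding eq by blast
      have \<delta>: "diff_ops_act A f \<delta> (der_act A f \<delta>)"
        using der.hyps(1) by (rule diff_ops_act.der)
      have "S k [:f:] \<in> loc_polys A f" for k
        using p(2) bs_module_loc_polys diff_ops_act_bs_module bs_module.gen by blast
      then have "der_act A f \<delta> p = (\<Sum>k\<le>n. [:0, 1:] ^ k * (der_act A f \<delta> \<circ> S k) [:f:])"
        using diff_ops_act_sum[OF \<delta>, of n "\<lambda>k. S k [:f:]"] p(1) by simp
      moreover have "\<exists>P. diff_ops_act A f P (der_act A f \<delta> \<circ> S k)" for k
        using p(2) \<delta> diff_ops_act.comp by blast
      ultimately show ?case
        unfolding eq by (intro exI[of _ n] exI[of _ "\<lambda>k. der_act A f \<delta> \<circ> S k"]) blast
    qed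
  qed
qed

section \<open>The ideal of a function and its monic generator\<close>

lemma bs_ideal_iff: "b \<in> bs_ideal A f \<longleftrightarrow> bs_vec f b \<in> bs_module A f"
  by (simp add: bs_ideal_def map_poly_cst diff_ops_s_submodule_eq)

lemma bs_ideal_add: "b \<in> bs_ideal A f \<Longrightarrow> c \<in> bs_ideal A f \<Longrightarrow> b + c \<in> bs_ideal A f"
proof -
  have "bs_vec f (b + c) = bs_vec f b + bs_vec f c"
    by (rule poly_fun_eqI) (simp add: ev_bs_vec)
  then show "b \<in> bs_ideal A f \<Longrightarrow> c \<in> bs_ideal A f \<Longrightarrow> b + c \<in> bs_ideal A f"
    by (simp add: bs_ideal_iff bs_module.add)
qed

lemma bs_ideal_mult: "b \<in> bs_ideal A f \<Longrightarrow> c * b \<in> bs_ideal A f"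
proof -
  have "bs_vec f (c * b) = constant_poly c * bs_vec f b"
    by (rule poly_fun_eqI) (simp add: ev_bs_vec)
  then show "b \<in> bs_ideal A f \<Longrightarrow> c * b \<in> bs_ideal A f"
    by (simp add: bs_ideal_iff bs_module_constant_poly)
qed

lemma zero_in_bs_ideal: "0 \<in> bs_ideal A f"
proof -
  have "bs_vec f 0 = 0"
    by (rule poly_fun_eqI) (simp add: ev_bs_vec)
  then show ?thesis
    by (simp add: bs_ideal_iff bs_module_0)
qed

text \<open>The remainder of a division by \<open>b\<close> lies in the ideal and has smaller
  degree, so it is 0.\<close>

lemma is_bs_poly_dvd:
  assumes b: "is_bs_poly A f b" and c: "c \<in> bs_ideal A f"
  shows "b dvd c"
proof -
  have "c mod b = c + (- (c div b)) * b"
    by (simp add: minus_div_mult_eq_mod[symmetric])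
  also have "\<dots> \<in> bs_ideal A f"
    using assms by (intro bs_ideal_add bs_ideal_mult) (auto simp: is_bs_poly_def)
  finally have "c mod b \<in> bs_ideal A f" .
  moreover have "b \<noteq> 0"
    using b by (auto simp: is_bs_poly_def)
  ultimately have "c mod b = 0"
    using b degree_mod_less[of b c] by (force simp: is_bs_poly_def)
  then show ?thesis
    by (simp add: dvd_eq_mod_eq_0)
qed

text \<open>The form in which \<open>bs_poly\<close> is used from here on. The zero ideal fits in:
  there \<open>bs_poly\<close> is the dummy 0, which divides only 0.\<close>

lemma bs_poly_dvd_iff: "bs_poly A f dvd c \<longleftrightarrow> c \<in> bs_ideal A f"
proof (cases "\<exists>b\<in>bs_ideal A f. b \<noteq> 0")
  case True
  then obtain b where b: "b \<in> bs_ideal A f" "b \<noteq> 0"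
    and min: "\<And>c. c \<in> bs_ideal A f \<Longrightarrow> c \<noteq> 0 \<Longrightarrow> degree b \<le> degree c"
    using ex_has_least_nat[of "\<lambda>b. b \<in> bs_ideal A f \<and> b \<noteq> 0" _ degree] by blast
  have ex: "is_bs_poly A f ([:1 / lead_coeff b:] * b)"
    using b min unfolding is_bs_poly_def by (intro conjI bs_ideal_mult) auto
  have "\<exists>!b. is_bs_poly A f b"
  proof (rule ex_ex1I)
    fix c d assume c: "is_bs_poly A f c" and d: "is_bs_poly A f d"
    have "c dvd d" "d dvd c"
      using is_bs_poly_dvd[OF c, of d] is_bs_poly_dvd[OF d, of c] c d by (auto simp only: is_bs_poly_def)
    moreover have "normalize c = c" "normalize d = d"
      using c d normalize_monic_poly by (auto simp only: is_bs_poly_def)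
    ultimately show "c = d"
      by (rule associated_eqI)
  qed (use ex in blast)
  then have *: "is_bs_poly A f (bs_poly A f)"
    unfolding bs_poly_def using theI'[of "is_bs_poly A f"] ex by (simp only: if_P[OF exI[of _ "_ * b"]])
  then show ?thesis
    using is_bs_poly_dvd[OF *] bs_ideal_mult[of "bs_poly A f"]
    by (auto simp: is_bs_poly_def dvd_def mult.commute)
next
  case False
  then have "\<nexists>b. is_bs_poly A f b"
    unfolding is_bs_poly_def by force
  then have "bs_poly A f = 0"
    by (simp add: bs_poly_def)
  then show ?thesis
    using False zero_in_bs_ideal by auto
qed

end

end


section \<open>Pullbacks, units and localization\<close>

lemma res_comp_fraction: "res S (fraction f a n \<circ> \<pi>) = fraction (res S (f \<circ> \<pi>)) (res S (a \<circ> \<pi>)) n"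
  by (auto simp: fun_eq_iff res_apply fraction_apply)

lemma ev_map_poly_res: "ev x (map_poly (\<lambda>h. res S (h \<circ> \<pi>)) p) = (if x \<in> S then ev (\<pi> x) p else 0)"
proof -
  have "res S (0 \<circ> \<pi>) = 0"
    by (auto simp: res_apply)
  then show ?thesis
    by (intro poly_eqI) (simp add: coeff_map_poly res_apply)
qed

lemma ev_res: "ev x (map_poly (res S) p) = (if x \<in> S then ev x p else 0)"
  using ev_map_poly_res[of x S id p] by simp

lemma map_poly_res_simps:
  "map_poly (res S) [:a:] = [:res S a:]"
  "map_poly (res S) (p + q) = map_poly (res S) p + map_poly (res S) q"
  "map_poly (res S) ([:0, 1:] * p) = [:0, 1:] * map_poly (res S) p"
  "map_poly (res S) (smult a p) = smult a (map_poly (res S) p)"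
  "smult (res S a) (map_poly (res S) p) = smult a (map_poly (res S) p)"
  "map_poly (res S) (bs_vec f b) = bs_vec (res S f) b"
  by (rule poly_fun_eqI; simp add: ev_res ev_bs_vec res_apply)+

text \<open>The pullback \<open>\<sigma>\<close> respects sums and products, so it carries the
  quotient rule over. The map \<open>\<pi>\<close> and the set \<open>S\<close> serve both basic
  open sets (\<open>\<pi> = id\<close>) and slices of a product (\<open>S = UNIV\<close>); the
  factor \<open>c\<close> is for derivations that come from \<open>B\<close> only after
  multiplication by a function.\<close>

lemma der_act_pullback:
  assumes A: "function_algebra U A" and B: "function_algebra V B"
    and pull: "\<And>a. a \<in> B \<Longrightarrow> res S (a \<circ> \<pi>) \<in> A"
    and \<epsilon>: "\<epsilon> \<in> derivations B" and \<delta>: "\<delta> \<in> derivations A"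
    and compat: "\<And>a. a \<in> B \<Longrightarrow> res S (\<epsilon> a \<circ> \<pi>) = c * \<delta> (res S (a \<circ> \<pi>))"
    and f: "f \<in> B" and p: "p \<in> loc_polys B f"
  shows "map_poly (\<lambda>h. res S (h \<circ> \<pi>)) (der_act B f \<epsilon> p) =
    smult c (der_act A (res S (f \<circ> \<pi>)) \<delta> (map_poly (\<lambda>h. res S (h \<circ> \<pi>)) p))"
proof -
  interpret A: function_algebra U A by (rule A)
  interpret B: function_algebra V B by (rule B)
  define \<sigma> where "\<sigma> h = res S (h \<circ> \<pi>)" for h :: "_ \<Rightarrow> complex"
  have \<sigma>: "\<sigma> (h + k) = \<sigma> h + \<sigma> k" "\<sigma> (h - k) = \<sigma> h - \<sigma> k" "\<sigma> (h * k) = \<sigma> h * \<sigma> k" "\<sigma> 0 = 0"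
    "\<sigma> (of_nat n * h) = of_nat n * \<sigma> h" for h k n
    by (auto simp: \<sigma>_def res_apply)
  have frac: "\<sigma> (fraction g a n) = fraction (\<sigma> g) (\<sigma> a) n" for g a n
    unfolding \<sigma>_def by (rule res_comp_fraction)
  have \<sigma>f: "\<sigma> f \<in> A"
    using pull f by (simp add: \<sigma>_def)
  have cmul: "fraction g (c * a) n = c * fraction g a n" for g a n
    by (auto simp: fraction_apply)
  have loc: "\<sigma> (der_loc B f \<epsilon> k) = c * der_loc A (\<sigma> f) \<delta> (\<sigma> k)" if k: "k \<in> localization B f" for k
  proof -
    obtain a n where a: "a \<in> B" "k = fraction f a n"
      using k by (auto simp: localization_def)
    have "\<sigma> (\<epsilon> a * f - of_nat n * a * \<epsilon> f) = c * (\<delta> (\<sigma> a) * \<sigma> f - of_nat n * \<sigma> a * \<delta> (\<sigma> f))"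
      using compat[OF a(1)] compat[OF f] unfolding \<sigma>_def[symmetric] \<sigma>(2) mult.assoc \<sigma>(5)
      by (simp only: \<sigma>(3)) (simp only: algebra_simps)
    then have "\<sigma> (der_loc B f \<epsilon> k) = fraction (\<sigma> f) (c * (\<delta> (\<sigma> a) * \<sigma> f - of_nat n * \<sigma> a * \<delta> (\<sigma> f))) (Suc n)"
      by (simp only: a(2) B.der_loc_fraction[OF \<epsilon> f a(1)] frac)
    moreover have "der_loc A (\<sigma> f) \<delta> (\<sigma> k) = fraction (\<sigma> f) (\<delta> (\<sigma> a) * \<sigma> f - of_nat n * \<sigma> a * \<delta> (\<sigma> f)) (Suc n)"
      using pull[OF a(1)] by (simp only: a(2) frac A.der_loc_fraction[OF \<delta> \<sigma>f] \<sigma>_def[symmetric])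
    ultimately show ?thesis
      by (simp only: cmul)
  qed
  have "\<sigma> (fraction f (\<epsilon> f) 1) = c * fraction (\<sigma> f) (\<delta> (\<sigma> f)) 1"
    using compat[OF f] by (simp only: frac cmul \<sigma>_def[symmetric])
  then have "map_poly \<sigma> (der_act B f \<epsilon> p) = smult c (der_act A (\<sigma> f) \<delta> (map_poly \<sigma> p))"
    using p by (intro poly_eqI)
      (simp del: times_fun_apply plus_fun_apply zero_fun_apply
        add: coeff_map_poly \<sigma> B.coeff_der_act[OF f \<epsilon>] A.coeff_der_act[OF \<sigma>f \<delta>] loc loc_polys_def
          algebra_simps split: nat.split)
  then show ?thesis
    by (simp only: \<sigma>_def[abs_def])
qed

context function_algebra
begin

section \<open>Multiplication of \<open>f\<close> by a unit\<close>

lemma unit_apply: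
  assumes "u * v = cst U 1" "x \<in> U"
  shows "u x * v x = 1" "u x \<noteq> 0"
  using fun_cong[OF assms(1), of x] assms(2) by (auto simp: cst_apply)

text \<open>Logarithmic derivatives add up:
  \<open>\<delta>(u f) / (u f) = \<delta>(f) / f + \<delta>(u) / u\<close>, where \<open>v\<close>
  is the inverse of \<open>u\<close>.\<close>

lemma der_act_unit:
  assumes f: "f \<in> A" and u: "u \<in> A" and v: "v \<in> A" and uv: "u * v = cst U 1"
    and \<delta>: "\<delta> \<in> derivations A" and p: "p \<in> loc_polys A f"
  shows "der_act A (u * f) \<delta> p = der_act A f \<delta> p + [:0, 1:] * smult (v * \<delta> u) p"
proof -
  note unit = unit_apply[OF uv]
  have uf: "u * f \<in> A"
    using u f by (rule mult_closed)
  have nz: "(u * f) x \<noteq> 0 \<longleftrightarrow> f x \<noteq> 0" for x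
    using unit(2)[of x] vanishes[OF f, of x] by auto
  have mem: "k \<in> localization A (u * f)" if k: "k \<in> localization A f" for k
  proof -
    obtain a n where a: "a \<in> A" "k = fraction f a n"
      using k by (auto simp: localization_def)
    have "k x = fraction (u * f) (u ^ n * a) n x" for x
      using nz[of x] unit(2)[of x]
      by (cases "f x = 0") (auto simp: a(2) fraction_apply power_fun_apply power_mult_distrib)
    then show ?thesis
      using in_localization[OF power_mult_closed[OF u a(1)], of "u * f" n n] by (metis ext)
  qed
  \<comment> \<open>The derivative of \<open>k\<close> is determined by any relation
    \<open>d * k = a\<close>, and the same relation serves \<open>f\<close> and
    \<open>u * f\<close>.\<close>
  have loc: "der_loc A (u * f) \<delta> k = der_loc A f \<delta> k" if k: "k \<in> localization A f" for k
  proof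
    fix x
    show "der_loc A (u * f) \<delta> k x = der_loc A f \<delta> k x"
    proof (cases "f x = 0")
      case True
      then show ?thesis
        using der_loc_outside[OF \<delta> f k] der_loc_outside[OF \<delta> uf mem[OF k]] by simp
    next
      case False
      obtain d a where d: "d \<in> A" "a \<in> A" "\<And>x. f x \<noteq> 0 \<Longrightarrow> d x \<noteq> 0" "\<And>x. f x \<noteq> 0 \<Longrightarrow> d x * k x = a x"
        using localization_witness[OF k f] by metis
      have "d x * der_loc A f \<delta> k x = \<delta> a x - k x * \<delta> d x"
        using der_loc_quotient_rule[OF \<delta> f k d(1,2,4) False] .
      then show ?thesis
        using False d(1,2) d(3)[OF False] d(4) nz[of x]
        by (intro der_loc_eqI[OF \<delta> uf mem[OF k]]) (use nz in auto)
    qed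
  qed
  have "fraction (u * f) (\<delta> (u * f)) 1 x * k x = (fraction f (\<delta> f) 1 x + v x * \<delta> u x) * k x"
    if k: "k \<in> localization A f" for k x
  proof (cases "f x = 0")
    case True
    then show ?thesis
      by (simp add: localization_outside[OF k])
  next
    case False
    then have "x \<in> U"
      using vanishes[OF f] by blast
    from unit[OF this] have v: "v x = 1 / u x" and u0: "u x \<noteq> 0"
      by (simp_all add: eq_divide_eq mult.commute)
    have du: "\<delta> (u * f) x = u x * \<delta> f x + \<delta> u x * f x"
      by (simp add: der_mult[OF \<delta> u f])
    have "fraction (u * f) (\<delta> (u * f)) 1 x = \<delta> (u * f) x / (u x * f x)"
      "fraction f (\<delta> f) 1 x = \<delta> f x / f x"
      using False u0 by (simp_all add: fraction_apply)
    then have "fraction (u * f) (\<delta> (u * f)) 1 x = fraction f (\<delta> f) 1 x + v x * \<delta> u x"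
      unfolding du v using False u0 by (simp add: add_divide_distrib)
    then show ?thesis
      by simp
  qed
  then have fr: "fraction (u * f) (\<delta> (u * f)) 1 * k = fraction f (\<delta> f) 1 * k + v * \<delta> u * k"
    if "k \<in> localization A f" for k
    using that by (auto simp: algebra_simps)
  show ?thesis
    using p by (intro poly_eqI)
      (simp del: times_fun_apply plus_fun_apply zero_fun_apply One_nat_def
        add: coeff_der_act[OF f \<delta>] coeff_der_act[OF uf \<delta>] loc fr loc_polys_def coeff_pCons
        split: nat.split)
qed

text \<open>The error term of \<open>der_act_unit\<close> is \<open>s\<close> times an element of
  \<open>A\<close> times \<open>p\<close>, hence in the module by induction, and \<open>f\<close>
  itself is \<open>v\<close> times the new generator.\<close>

lemma bs_module_unit:
  assumes f: "f \<in> A" and u: "u \<in> A" and v: "v \<in> A" and uv: "u * v = cst U 1"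
  shows "p \<in> bs_module A f \<Longrightarrow> p \<in> bs_module A (u * f)"
proof (induction rule: bs_module.induct)
  case gen
  have "v * (u * f) = cst U 1 * f"
    by (simp only: mult_ac flip: uv)
  then have "[:f:] = smult v [:u * f:]"
    by (simp only: unit_mult[OF f] smult_pCons smult_0_right)
  then show ?case
    using bs_module.smult[OF v bs_module.gen] by metis
next
  case (der \<delta> p)
  have p: "p \<in> loc_polys A f"
    using bs_module_loc_polys[OF f der.hyps(2)] .
  have "der_act A f \<delta> p = der_act A (u * f) \<delta> p - [:0, 1:] * smult (v * \<delta> u) p"
    using der_act_unit[OF f u v uv der.hyps(1) p] by simp
  moreover have "v * \<delta> u \<in> A"
    using mult_closed v der_closed[OF der.hyps(1) u] by blast
  ultimately show ?case
    using der.IH der.hyps(1) mult_closed[OF u f]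
    by (simp only: bs_module_diff bs_module.der bs_module.shift bs_module.smult)
qed (auto intro: bs_module.intros simp del: mult_pCons_left)

lemma bs_ideal_unit:
  assumes f: "f \<in> A" and u: "u \<in> A" and v: "v \<in> A" and uv: "u * v = cst U 1"
    and b: "b \<in> bs_ideal A f"
  shows "b \<in> bs_ideal A (u * f)"
proof -
  have "f x = 0 \<longleftrightarrow> (u * f) x = 0" for x
    using unit_apply(2)[OF uv, of x] vanishes[OF f, of x] by auto
  then have "bs_vec (u * f) b = bs_vec f b"
    by (intro poly_fun_eqI) (simp add: ev_bs_vec)
  then show ?thesis
    using b bs_module_unit[OF f u v uv] mult_closed[OF u f] f by (simp only: bs_ideal_iff)
qed

section \<open>Restriction to a basic open set\<close>

lemma bs_module_restrict:
  assumes h: "h \<in> A" and f: "f \<in> A" and p: "p \<in> bs_module A f"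
  shows "map_poly (res (nonvan h)) p \<in> bs_module (localization A h) (res (nonvan h) f)"
  using p
proof (induction rule: bs_module.induct)
  case gen
  show ?case
    by (simp only: map_poly_res_simps bs_module.gen)
next
  case (add p q)
  show ?case
    unfolding map_poly_res_simps using add.IH by (rule bs_module.add)
next
  case (shift p)
  show ?case
    unfolding map_poly_res_simps using shift.IH by (rule bs_module.shift)
next
  case (smult a p)
  then show ?case
    using bs_module.smult[OF res_in_localization[OF smult.hyps(1)] smult.IH] by (simp only: map_poly_res_simps)
next
  case (der \<delta> p)
  let ?\<delta> = "restrict (der_loc A h \<delta>) (localization A h)"
  have "map_poly (res (nonvan h)) (der_act A f \<delta> p) =
    smult 1 (der_act (localization A h) (res (nonvan h) f) ?\<delta> (map_poly (res (nonvan h)) p))"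
    using der_act_pullback[OF function_algebra_localization[OF h] function_algebra_axioms, where \<pi> = id
        and S = "nonvan h" and \<epsilon> = \<delta> and \<delta> = ?\<delta> and c = 1 and f = f and p = p]
      derivation_localization[OF der.hyps(1) h] res_in_localization der_loc_res[OF der.hyps(1) h]
      bs_module_loc_polys[OF f der.hyps(2)] der.hyps(1) f
    by (simp add: del: one_fun_apply)
  then show ?case
    using bs_module.der[OF derivation_localization[OF der.hyps(1) h] der.IH] by simp
qed

lemma bs_ideal_restrict:
  assumes h: "h \<in> A" and f: "f \<in> A" and b: "b \<in> bs_ideal A f"
  shows "b \<in> bs_ideal (localization A h) (res (nonvan h) f)"
proof -
  have "map_poly (res (nonvan h)) (bs_vec f b) \<in> bs_module (localization A h) (res (nonvan h) f)"
    using b bs_ideal_iff[OF f] by (intro bs_module_restrict h f) simp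
  then show ?thesis
    by (simp only: map_poly_res_simps
        function_algebra.bs_ideal_iff[OF function_algebra_localization[OF h] res_in_localization[OF f]])
qed

section \<open>Clearing denominators\<close>

lemma clear_denominator:
  assumes "h \<in> A" "k \<in> localization A h"
  obtains m where "\<And>n. m \<le> n \<Longrightarrow> h ^ n * k \<in> A"
proof -
  obtain a m where a: "a \<in> A" "k = fraction h a m"
    using assms by (auto simp: localization_def)
  \<comment> \<open>One factor \<open>h\<close> more than in the denominator: it makes the numerator
    vanish where \<open>h\<close> does, as \<open>k\<close> does.\<close>
  have "h ^ n * k \<in> A" if n: "Suc m \<le> n" for n
  proof -
    obtain j where n: "n = Suc m + j"
      using le_Suc_ex[OF n] by blast
    have "(h ^ n * k) x = (h ^ j * (h * a)) x" for x
      by (cases "h x = 0") (auto simp: n a(2) fraction_apply power_fun_apply power_add)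
    then have "h ^ n * k = h ^ j * (h * a)"
      by (rule ext)
    then show ?thesis
      using power_mult_closed[OF assms(1) mult_closed[OF assms(1) a(1)]] by metis
  qed
  then show ?thesis
    using that by blast
qed

text \<open>The generators are finitely many, so one exponent serves them all, and the Leibniz rule
  extends it to the algebra that they generate.\<close>

lemma clear_derivation:
  assumes gen: "A = alg_gen U G" "finite G" and h: "h \<in> A" and \<delta>: "\<delta> \<in> derivations (localization A h)"
  obtains m where "\<And>a. a \<in> A \<Longrightarrow> h ^ m * \<delta> (res (nonvan h) a) \<in> A"
proof -
  interpret L: function_algebra "nonvan h" "localization A h"
    using h by (rule function_algebra_localization)
  have "\<exists>m. \<forall>n\<ge>m. h ^ n * \<delta> (res (nonvan h) g) \<in> A" if "g \<in> G" for g
  proof -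
    have "\<delta> (res (nonvan h) g) \<in> localization A h"
      using that gen(1) by (intro L.der_closed[OF \<delta>] res_in_localization) (simp add: alg_gen.gen)
    then show ?thesis
      using clear_denominator[OF h] by meson
  qed
  then obtain m where m: "\<And>g n. g \<in> G \<Longrightarrow> m g \<le> n \<Longrightarrow> h ^ n * \<delta> (res (nonvan h) g) \<in> A"
    by metis
  define M where "M = Max (m ` G)"
  have "h ^ M * \<delta> (res (nonvan h) a) \<in> A" if "a \<in> alg_gen U G" for a
    using that
  proof (induction rule: alg_gen.induct)
    case (cst c)
    have "res (nonvan h) (cst U c) = cst (nonvan h) c"
      using nonvan_subset[OF h] by (auto simp: fun_eq_iff res_apply cst_apply)
    then show ?case
      using zero_closed by (simp only: L.der_cst[OF \<delta>] mult_zero_right)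
  next
    case (gen g)
    then show ?case
      using m[of g M] \<open>finite G\<close> Max_ge[of "m ` G" "m g"] unfolding M_def by blast
  next
    case (add a b)
    have "res (nonvan h) (a + b) = res (nonvan h) a + res (nonvan h) b"
      by (auto simp: res_apply)
    moreover have "res (nonvan h) a \<in> localization A h" "res (nonvan h) b \<in> localization A h"
      using add.hyps gen(1) res_in_localization by blast+
    ultimately have "h ^ M * \<delta> (res (nonvan h) (a + b)) =
      h ^ M * \<delta> (res (nonvan h) a) + h ^ M * \<delta> (res (nonvan h) b)"
      by (simp only: L.der_add[OF \<delta>] ring_distribs)
    then show ?case
      using add_closed[OF add.IH] by metis
  next
    case (mult a b)
    have ab: "a \<in> A" "b \<in> A" "res (nonvan h) a \<in> localization A h" "res (nonvan h) b \<in> localization A h"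
      using mult.hyps gen(1) res_in_localization by blast+
    have "res (nonvan h) (a * b) = res (nonvan h) a * res (nonvan h) b"
      by (auto simp: res_apply)
    then have "\<delta> (res (nonvan h) (a * b)) =
      res (nonvan h) a * \<delta> (res (nonvan h) b) + \<delta> (res (nonvan h) a) * res (nonvan h) b"
      using ab(3,4) by (simp only: L.der_mult[OF \<delta>])
    also have "\<dots> = a * \<delta> (res (nonvan h) b) + b * \<delta> (res (nonvan h) a)"
      using L.vanishes[OF L.der_closed[OF \<delta> ab(3)]] L.vanishes[OF L.der_closed[OF \<delta> ab(4)]]
      by (auto simp: fun_eq_iff res_apply)
    finally have "h ^ M * \<delta> (res (nonvan h) (a * b)) =
      a * (h ^ M * \<delta> (res (nonvan h) b)) + b * (h ^ M * \<delta> (res (nonvan h) a))"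
      by (simp only: ring_distribs mult.left_commute)
    then show ?case
      using add_closed[OF mult_closed[OF ab(1) mult.IH(2)] mult_closed[OF ab(2) mult.IH(1)]] by metis
  qed
  then show ?thesis
    using that gen(1) by blast
qed

text \<open>The delicate case is a derivation \<open>\<delta>\<close> of the localization. By
  \<open>clear_derivation\<close> a multiple \<open>h^m \<delta>\<close> comes from
  \<open>A\<close>, but it is applied to a lift of \<open>h^N p\<close> instead of \<open>p\<close>;
  after one more multiplication by \<open>h\<close>, the Leibniz term with
  \<open>\<delta>(h)\<close> is a multiple of the lift and can be subtracted.\<close>

lemma bs_module_clear:
  assumes gen: "A = alg_gen U G" "finite G" and h: "h \<in> A" and f: "f \<in> A"
    and p: "p \<in> bs_module (localization A h) (res (nonvan h) f)"
  shows "\<exists>N. \<exists>q\<in>bs_module A f. map_poly (res (nonvan h)) q = smult (h ^ N) p"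
  using p
proof (induction rule: bs_module.induct)
  case gen
  show ?case
    by (intro exI[of _ 0] bexI[OF _ bs_module.gen]) (simp only: map_poly_res_simps power_0 smult_1_left)
next
  case (add p p')
  obtain N q M r where q: "q \<in> bs_module A f" "map_poly (res (nonvan h)) q = smult (h ^ N) p"
    and r: "r \<in> bs_module A f" "map_poly (res (nonvan h)) r = smult (h ^ M) p'"
    using add.IH by blast
  have "map_poly (res (nonvan h)) (smult (h ^ M) q + smult (h ^ N) r) = smult (h ^ (N + M)) (p + p')"
    by (simp only: map_poly_res_simps q r smult_smult smult_add_right power_add mult.commute)
  then show ?case
    using q r h f by (intro exI[of _ "N + M"] bexI[of _ "smult (h ^ M) q + smult (h ^ N) r"])
      (auto intro: bs_module.add bs_module_smult_power)
next
  case (shift p)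
  then obtain N q where q: "q \<in> bs_module A f" "map_poly (res (nonvan h)) q = smult (h ^ N) p"
    by blast
  have "map_poly (res (nonvan h)) ([:0, 1:] * q) = smult (h ^ N) ([:0, 1:] * p)"
    by (simp only: map_poly_res_simps q mult_smult_right)
  then show ?case
    using bs_module.shift[OF q(1)] by blast
next
  case (smult k p)
  then obtain N q where q: "q \<in> bs_module A f" "map_poly (res (nonvan h)) q = smult (h ^ N) p"
    by blast
  obtain m where "\<And>n. m \<le> n \<Longrightarrow> h ^ n * k \<in> A"
    using clear_denominator[OF h smult.hyps(1)] by blast
  then have m: "h ^ m * k \<in> A"
    by blast
  have "map_poly (res (nonvan h)) (smult (h ^ m * k) q) = smult (h ^ (m + N)) (smult k p)"
    by (simp only: map_poly_res_simps q smult_smult power_add mult_ac)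
  then show ?case
    using bs_module.smult[OF m q(1)] by blast
next
  case (der \<delta> p)
  interpret L: function_algebra "nonvan h" "localization A h"
    using h by (rule function_algebra_localization)
  let ?f = "res (nonvan h) f" and ?h = "res (nonvan h) h"
  have fL: "?f \<in> localization A h" and hL: "?h \<in> localization A h"
    using res_in_localization f h by auto
  obtain N q where q: "q \<in> bs_module A f" "map_poly (res (nonvan h)) q = smult (h ^ N) p"
    using der.IH by blast
  obtain m where m: "\<And>a. a \<in> A \<Longrightarrow> h ^ m * \<delta> (res (nonvan h) a) \<in> A"
    using clear_derivation[OF gen h der.hyps(1)] by blast
  define \<epsilon> where "\<epsilon> = restrict (\<lambda>a. h ^ m * \<delta> (res (nonvan h) a)) A"
  have resL: "res (nonvan h) k = k" if "k \<in> localization A h" for k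
    using L.vanishes[OF that] by (auto simp: res_apply)
  have \<delta>res: "\<delta> (res (nonvan h) a) x = 0" if "a \<in> A" "h x = 0" for a x
    using localization_outside[OF L.der_closed[OF der.hyps(1) res_in_localization]] that by blast
  have \<epsilon>: "\<epsilon> \<in> derivations A"
  proof -
    have "\<epsilon> (a + b) = \<epsilon> a + \<epsilon> b" if "a \<in> A" "b \<in> A" for a b
    proof -
      have "res (nonvan h) (a + b) = res (nonvan h) a + res (nonvan h) b"
        by (auto simp: res_apply)
      then show ?thesis
        using that add_closed[OF that] res_in_localization
        by (simp only: \<epsilon>_def restrict_apply if_True L.der_add[OF der.hyps(1)] ring_distribs)
    qed
    moreover have "\<epsilon> (\<lambda>x. c * a x) = (\<lambda>x. c * \<epsilon> a x)" if "a \<in> A" for c a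
    proof -
      have "res (nonvan h) (\<lambda>x. c * a x) = (\<lambda>x. c * res (nonvan h) a x)"
        by (auto simp: res_apply)
      then have "\<epsilon> (\<lambda>x. c * a x) = h ^ m * (\<lambda>x. c * \<delta> (res (nonvan h) a) x)"
        using that scale_closed[OF that] res_in_localization
        by (simp only: \<epsilon>_def restrict_apply if_True L.der_scale[OF der.hyps(1)])
      then show ?thesis
        using that by (auto simp: \<epsilon>_def)
    qed
    moreover have "\<epsilon> (a * b) = a * \<epsilon> b + \<epsilon> a * b" if "a \<in> A" "b \<in> A" for a b
    proof -
      have "res (nonvan h) (a * b) = res (nonvan h) a * res (nonvan h) b"
        by (auto simp: res_apply)
      then have *: "\<epsilon> (a * b) = h ^ m * (res (nonvan h) a * \<delta> (res (nonvan h) b) + \<delta> (res (nonvan h) a) * res (nonvan h) b)"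
        using that mult_closed[OF that] res_in_localization
        by (simp only: \<epsilon>_def restrict_apply if_True L.der_mult[OF der.hyps(1)])
      show ?thesis
      proof
        fix x show "\<epsilon> (a * b) x = (a * \<epsilon> b + \<epsilon> a * b) x"
          using that \<delta>res[OF that(1), of x] \<delta>res[OF that(2), of x] unfolding *
          by (cases "h x = 0") (auto simp: \<epsilon>_def res_apply mem_nonvan algebra_simps)
      qed
    qed
    ultimately show ?thesis
      using m by (auto simp: derivations_def \<epsilon>_def)
  qed
  have pL: "p \<in> loc_polys (localization A h) ?f"
    using L.bs_module_loc_polys[OF fL der.hyps(2)] .
  have qA: "q \<in> loc_polys A f"
    using bs_module_loc_polys[OF f q(1)] .
  have compat: "res (nonvan h) (\<epsilon> a) = h ^ m * \<delta> (res (nonvan h) a)" if "a \<in> A" for a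
    using that \<delta>res[OF that] by (auto simp: \<epsilon>_def res_apply mem_nonvan fun_eq_iff)
  have E: "map_poly (res (nonvan h)) (der_act A f \<epsilon> q) =
    smult (h ^ m) (der_act (localization A h) ?f \<delta> (map_poly (res (nonvan h)) q))"
    using der_act_pullback[OF function_algebra_localization[OF h] function_algebra_axioms, where \<pi> = id
        and S = "nonvan h" and \<epsilon> = \<epsilon> and \<delta> = \<delta> and c = "h ^ m" and f = f and p = q]
      res_in_localization compat qA \<epsilon> der.hyps(1) f by simp
  \<comment> \<open>The power of \<open>h\<close> as an element of the localization; for
    \<open>N = 0\<close> the plain power would be 1 everywhere.\<close>
  define k where "k = cst (nonvan h) 1 * ?h ^ N"
  have k: "k \<in> localization A h"
    unfolding k_def using hL by (rule L.power_closed)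
  have kp: "smult (h ^ N) r = smult k r" if "r \<in> loc_polys (localization A h) ?f" for r
  proof (rule poly_fun_eqI)
    fix x show "ev x (smult (h ^ N) r) = ev x (smult k r)"
      using L.loc_polys_outside[OF fL that, of x]
      by (cases "h x = 0") (auto simp: k_def cst_apply power_fun_apply res_apply mem_nonvan)
  qed
  have F: "der_act (localization A h) ?f \<delta> (smult (h ^ N) p) =
    smult k (der_act (localization A h) ?f \<delta> p) + smult (\<delta> k) p"
    unfolding kp[OF pL] by (rule L.der_act_smult[OF fL der.hyps(1) pL k])
  \<comment> \<open>On \<open>nonvan h\<close>, \<open>q = h^N p\<close> and
    \<open>\<epsilon> = h^m \<delta>\<close>. The term \<open>N h^(N-1) \<delta>(h) p\<close> of
    \<open>\<delta>(h^N p)\<close>, multiplied by \<open>h^(m+1)\<close>, is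
    \<open>N \<epsilon>(h) q\<close>; the extra factor \<open>h\<close> avoids the exponent
    \<open>N - 1\<close>.\<close>
  define r where "r = smult h (der_act A f \<epsilon> q) - smult (of_nat N * \<epsilon> h) q"
  have "map_poly (res (nonvan h)) r = smult (h ^ (Suc m + N)) (der_act (localization A h) ?f \<delta> p)"
  proof (rule poly_fun_eqI)
    fix x
    show "ev x (map_poly (res (nonvan h)) r) = ev x (smult (h ^ (Suc m + N)) (der_act (localization A h) ?f \<delta> p))"
    proof (cases "h x = 0")
      case True
      then show ?thesis
        by (simp add: ev_res mem_nonvan)
    next
      case False
      have 1: "ev x (map_poly (res (nonvan h)) s) = ev x s" for s
        using False by (simp add: ev_res mem_nonvan)
      have "ev x (der_act A f \<epsilon> q) = smult (h x ^ m) (ev x (der_act (localization A h) ?f \<delta> (smult (h ^ N) p)))"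
        using arg_cong[OF E, of "ev x"] unfolding 1 q(2) by (simp add: power_fun_apply)
      also have "\<dots> = smult (h x ^ m) (smult (h x ^ N) (ev x (der_act (localization A h) ?f \<delta> p)) + smult (\<delta> k x) (ev x p))"
        using False by (simp add: F k_def power_fun_apply cst_apply res_apply mem_nonvan)
      also have "\<delta> k x = of_nat N * h x ^ N * \<delta> ?h x / h x"
        using L.der_power[OF der.hyps(1) hL, of x N] False by (simp add: k_def res_apply mem_nonvan)
      finally have 2: "ev x (der_act A f \<epsilon> q) = smult (h x ^ m)
        (smult (h x ^ N) (ev x (der_act (localization A h) ?f \<delta> p)) +
         smult (of_nat N * h x ^ N * \<delta> ?h x / h x) (ev x p))" .
      have 3: "ev x q = smult (h x ^ N) (ev x p)"
        using arg_cong[OF q(2), of "ev x"] unfolding 1 by (simp add: power_fun_apply)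
      have 4: "\<epsilon> h x = h x ^ m * \<delta> ?h x"
        using h by (simp add: \<epsilon>_def power_fun_apply)
      show ?thesis
        unfolding 1 using False
        by (simp add: r_def 2 3 4 power_fun_apply smult_add_right power_add mult_ac)
    qed
  qed
  moreover have "r \<in> bs_module A f"
    unfolding r_def using q(1) \<epsilon> h f
    by (intro bs_module_diff bs_module.smult bs_module.der of_nat_closed der_closed[OF \<epsilon>])
  ultimately show ?case
    by blast
qed

text \<open>The relation of \<open>bs_module_clear\<close> determines the lift on
  \<open>nonvan h\<close> only. One more factor \<open>h\<close> makes both sides vanish elsewhere;
  moreover a positive power of \<open>h\<close> is an element of \<open>A\<close>.\<close>

lemma bs_ideal_clear:
  assumes gen: "A = alg_gen U G" "finite G" and h: "h \<in> A" and f: "f \<in> A"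
    and b: "b \<in> bs_ideal (localization A h) (res (nonvan h) f)"
  shows "\<exists>N. smult (h ^ Suc N) (bs_vec f b) \<in> bs_module A f"
proof -
  have "bs_vec (res (nonvan h) f) b \<in> bs_module (localization A h) (res (nonvan h) f)"
    using b function_algebra.bs_ideal_iff[OF function_algebra_localization[OF h] res_in_localization[OF f]]
    by blast
  then obtain N q where q: "q \<in> bs_module A f"
    "map_poly (res (nonvan h)) q = smult (h ^ N) (bs_vec (res (nonvan h) f) b)"
    using bs_module_clear[OF gen h f] by blast
  have "smult h q = smult (h ^ Suc N) (bs_vec f b)"
  proof (rule poly_fun_eqI)
    fix x show "ev x (smult h q) = ev x (smult (h ^ Suc N) (bs_vec f b))"
      using arg_cong[OF q(2), of "ev x"]
      by (cases "h x = 0") (auto simp: ev_res mem_nonvan ev_bs_vec power_fun_apply res_apply)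
  qed
  then show ?thesis
    using bs_module.smult[OF h q(1)] by metis
qed

end


section \<open>Tensor products of algebras of functions\<close>

lemma tensor_fun_apply [simp]: "tensor_fun a b (x, y) = a x * b y"
  by (simp add: tensor_fun_def)

lemma tensor_fun_mult: "tensor_fun a b * tensor_fun c d = tensor_fun (a * c) (b * d)"
  by (auto simp: fun_eq_iff)

lemma zero_in_tensor_alg: "0 \<in> tensor_alg A B"
  unfolding tensor_alg_def by (intro CollectI exI[of _ 0]) auto

lemma tensor_alg_add_tensor_fun:
  assumes "t \<in> tensor_alg A B" "a \<in> A" "b \<in> B"
  shows "t + tensor_fun a b \<in> tensor_alg A B"
proof -
  obtain n :: nat and c d where t: "t = (\<Sum>i<n. tensor_fun (c i) (d i))" "c \<in> {..<n} \<rightarrow> A" "d \<in> {..<n} \<rightarrow> B"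
    using assms(1) unfolding tensor_alg_def by blast
  have "t + tensor_fun a b = (\<Sum>i<Suc n. tensor_fun ((c(n := a)) i) ((d(n := b)) i))"
    by (simp add: t(1))
  then show ?thesis
    unfolding tensor_alg_def using t(2,3) assms(2,3)
    by (intro CollectI exI[of _ "Suc n"] exI[of _ "c(n := a)"] exI[of _ "d(n := b)"])
      (auto simp: less_Suc_eq Pi_iff)
qed

lemma tensor_fun_in_tensor_alg: "a \<in> A \<Longrightarrow> b \<in> B \<Longrightarrow> tensor_fun a b \<in> tensor_alg A B"
  using tensor_alg_add_tensor_fun[OF zero_in_tensor_alg] by fastforce

lemma tensor_alg_induct [consumes 1, case_names zero add]:
  assumes "t \<in> tensor_alg A B"
    and "P 0"
    and "\<And>s a b. s \<in> tensor_alg A B \<Longrightarrow> P s \<Longrightarrow> a \<in> A \<Longrightarrow> b \<in> B \<Longrightarrow> P (s + tensor_fun a b)"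
  shows "P t"
proof -
  obtain n :: nat and a b where t: "t = (\<Sum>i<n. tensor_fun (a i) (b i))" "a \<in> {..<n} \<rightarrow> A" "b \<in> {..<n} \<rightarrow> B"
    using assms(1) unfolding tensor_alg_def by blast
  have "(\<Sum>i<m. tensor_fun (a i) (b i)) \<in> tensor_alg A B \<and> P (\<Sum>i<m. tensor_fun (a i) (b i))"
    if "m \<le> n" for m
    using that
  proof (induction m)
    case 0
    have "(\<Sum>i<(0::nat). tensor_fun (a i) (b i)) = 0"
      by (simp only: lessThan_0 sum.empty)
    then show ?case
      using assms(2) zero_in_tensor_alg by metis
  next
    case (Suc m)
    then have "a m \<in> A" "b m \<in> B" "m \<le> n"
      using t by auto
    then show ?case
      using Suc.IH assms(3) tensor_alg_add_tensor_fun by (simp only: sum.lessThan_Suc) blast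
  qed
  then show ?thesis
    by (simp add: t(1))
qed

lemma tensor_alg_add:
  assumes s: "s \<in> tensor_alg A B" and t: "t \<in> tensor_alg A B"
  shows "s + t \<in> tensor_alg A B"
  using t
proof (induction t rule: tensor_alg_induct)
  case (add t a b)
  then show ?case
    using tensor_alg_add_tensor_fun[of "s + t" A B a b] by (simp only: add.assoc)
qed (simp only: add_0_right s)

text \<open>Exchange of the factors transfers what is proved for the left factor to the right
  one.\<close>

lemma tensor_alg_swap:
  fixes A :: "('a \<Rightarrow> complex) set" and B :: "('b \<Rightarrow> complex) set"
  shows "t \<in> tensor_alg A B \<Longrightarrow> t \<circ> prod.swap \<in> tensor_alg B A"
proof (induction t rule: tensor_alg_induct)
  case zero
  have "(0 :: 'a \<times> 'b \<Rightarrow> complex) \<circ> prod.swap = 0"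
    by auto
  then show ?case
    by (simp only: zero_in_tensor_alg)
next
  case (add t a b)
  have "(t + tensor_fun a b) \<circ> prod.swap = (t \<circ> prod.swap) + tensor_fun b a"
    by auto
  then show ?case
    using tensor_alg_add_tensor_fun[OF add.IH add.hyps(3,2)] by metis
qed

locale tensor_algebras = A: function_algebra U A + B: function_algebra V B
  for U :: "'a set" and A and V :: "'b set" and B
begin

lemma tensor_mult_closed:
  assumes s: "s \<in> tensor_alg A B" and t: "t \<in> tensor_alg A B"
  shows "s * t \<in> tensor_alg A B"
proof -
  have *: "r * tensor_fun a b \<in> tensor_alg A B" if "r \<in> tensor_alg A B" "a \<in> A" "b \<in> B" for r a b
    using that(1)
  proof (induction r rule: tensor_alg_induct)
    case zero
    then show ?case
      by (simp only: mult_zero_left zero_in_tensor_alg)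
  next
    case (add r c d)
    then show ?case
      using that A.mult_closed[of c a] B.mult_closed[of d b]
      by (simp only: ring_distribs tensor_fun_mult tensor_alg_add_tensor_fun)
  qed
  show ?thesis
    using t
  proof (induction t rule: tensor_alg_induct)
    case zero
    then show ?case
      by (simp only: mult_zero_right zero_in_tensor_alg)
  next
    case (add t a b)
    then show ?case
      using *[OF s add.hyps(2,3)] by (simp only: ring_distribs tensor_alg_add)
  qed
qed

lemma tensor_cst: "cst (U \<times> V) c = tensor_fun (cst U c) (cst V 1)"
  by (auto simp: fun_eq_iff cst_apply)

lemma tensor_vanishes: "t \<in> tensor_alg A B \<Longrightarrow> (x, y) \<notin> U \<times> V \<Longrightarrow> t (x, y) = 0"
  by (induction t rule: tensor_alg_induct) (use A.vanishes B.vanishes in auto)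

sublocale T: function_algebra "U \<times> V" "tensor_alg A B"
proof
  show "algebra_of_functions (U \<times> V) (tensor_alg A B)"
    unfolding algebra_of_functions_def
    using tensor_vanishes tensor_mult_closed
    by (auto simp del: plus_fun_apply times_fun_apply intro: tensor_alg_add)
      (simp only: tensor_cst tensor_fun_in_tensor_alg A.cst_closed B.cst_closed)
qed

text \<open>At a fixed \<open>y\<close> the right factors become scalars. Slices are the means by
  which derivations of one factor act on the product.\<close>

lemma slice_left: "t \<in> tensor_alg A B \<Longrightarrow> (\<lambda>x. t (x, y)) \<in> A"
proof (induction t rule: tensor_alg_induct)
  case zero
  then show ?case
    using A.zero_closed by (simp add: zero_fun_def)
next
  case (add t a b)
  have "(\<lambda>x. (t + tensor_fun a b) (x, y)) = (\<lambda>x. t (x, y)) + (\<lambda>x. b y * a x)"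
    by (auto simp: mult.commute)
  then show ?case
    using A.add_closed[OF add.IH A.scale_closed[OF add.hyps(2)]] by metis
qed

lemma tensor_algebras_swap: "tensor_algebras V B U A"
  by (simp add: tensor_algebras_def A.function_algebra_axioms B.function_algebra_axioms)

lemma slice_right: "t \<in> tensor_alg A B \<Longrightarrow> (\<lambda>y. t (x, y)) \<in> B"
  using tensor_algebras.slice_left[OF tensor_algebras_swap tensor_alg_swap, of t x] by simp

lemma derivation_swap:
  assumes \<Delta>: "\<Delta> \<in> derivations (tensor_alg A B)"
  shows "restrict (\<lambda>t. \<Delta> (t \<circ> prod.swap) \<circ> prod.swap) (tensor_alg B A) \<in> derivations (tensor_alg B A)"
proof -
  interpret S: tensor_algebras V B U A
    by (rule tensor_algebras_swap)
  define \<Delta>' where "\<Delta>' = restrict (\<lambda>t. \<Delta> (t \<circ> prod.swap) \<circ> prod.swap) (tensor_alg B A)"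
  have swap: "t \<circ> prod.swap \<in> tensor_alg A B" if "t \<in> tensor_alg B A" for t
    using that by (rule tensor_alg_swap)
  have sw: "(s + t) \<circ> prod.swap = (s \<circ> prod.swap) + (t \<circ> prod.swap)"
    "(s * t) \<circ> prod.swap = (s \<circ> prod.swap) * (t \<circ> prod.swap)"
    "(\<lambda>p. c * s p) \<circ> prod.swap = (\<lambda>p. c * (s \<circ> prod.swap) p)" for s t :: "'b \<times> 'a \<Rightarrow> complex" and c
    by auto
  have "\<Delta>' (s + t) = \<Delta>' s + \<Delta>' t" if "s \<in> tensor_alg B A" "t \<in> tensor_alg B A" for s t
    using S.T.add_closed[OF that] that
    by (simp add: \<Delta>'_def sw(1) T.der_add[OF \<Delta> swap swap] del: plus_fun_apply) auto
  moreover have "\<Delta>' (s * t) = s * \<Delta>' t + \<Delta>' s * t" if "s \<in> tensor_alg B A" "t \<in> tensor_alg B A" for s t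
    using S.T.mult_closed[OF that] that
    by (simp add: \<Delta>'_def sw(2) T.der_mult[OF \<Delta> swap swap] del: plus_fun_apply times_fun_apply) auto
  moreover have "\<Delta>' (\<lambda>p. c * s p) = (\<lambda>p. c * \<Delta>' s p)" if "s \<in> tensor_alg B A" for s c
    using S.T.scale_closed[OF that] that
    by (simp add: \<Delta>'_def sw(3) T.der_scale[OF \<Delta> swap] del: o_apply) auto
  ultimately have "\<Delta>' \<in> derivations (tensor_alg B A)"
    using tensor_alg_swap[OF T.der_closed[OF \<Delta> swap]] by (auto simp: derivations_def \<Delta>'_def)
  then show ?thesis
    by (simp only: \<Delta>'_def)
qed

lemma tensor_fun_localization:
  assumes f: "f \<in> A" and g: "g \<in> B" and h: "h \<in> localization A f" and k: "k \<in> localization B g"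
  shows "tensor_fun h k \<in> localization (tensor_alg A B) (tensor_fun f g)"
proof -
  obtain a n b m where h: "a \<in> A" "h = fraction f a n" and k: "b \<in> B" "k = fraction g b m"
    using h k by (auto simp: localization_def)
  \<comment> \<open>The two denominators are brought to the same exponent
    \<open>n + m\<close>.\<close>
  have "tensor_fun h k p = fraction (tensor_fun f g) (tensor_fun (f ^ m * a) (g ^ n * b)) (n + m) p" for p
    by (cases p; cases "f (fst p) = 0"; cases "g (snd p) = 0")
      (auto simp: h(2) k(2) fraction_apply power_fun_apply power_add power_mult_distrib)
  then have "tensor_fun h k = fraction (tensor_fun f g) (tensor_fun (f ^ m * a) (g ^ n * b)) (n + m)"
    by (rule ext)
  moreover have "tensor_fun (f ^ m * a) (g ^ n * b) \<in> tensor_alg A B"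
    using h k f g by (intro tensor_fun_in_tensor_alg A.power_mult_closed B.power_mult_closed)
  ultimately show ?thesis
    using in_localization by metis
qed

text \<open>This is \<open>\<delta> \<otimes> id\<close>. A definition by slices does not depend on
  a representation as a sum of simple tensors; that the values are again tensors is shown
  afterwards.\<close>

definition der_left :: "(('a \<Rightarrow> complex) \<Rightarrow> 'a \<Rightarrow> complex) \<Rightarrow> ('a \<times> 'b \<Rightarrow> complex) \<Rightarrow> 'a \<times> 'b \<Rightarrow> complex" where
  "der_left \<delta> = restrict (\<lambda>t (x, y). \<delta> (\<lambda>x'. t (x', y)) x) (tensor_alg A B)"

definition der_right :: "(('b \<Rightarrow> complex) \<Rightarrow> 'b \<Rightarrow> complex) \<Rightarrow> ('a \<times> 'b \<Rightarrow> complex) \<Rightarrow> 'a \<times> 'b \<Rightarrow> complex" where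
  "der_right \<delta> = restrict (\<lambda>t (x, y). \<delta> (\<lambda>y'. t (x, y')) y) (tensor_alg A B)"

lemma der_left_apply: "t \<in> tensor_alg A B \<Longrightarrow> der_left \<delta> t (x, y) = \<delta> (\<lambda>x'. t (x', y)) x"
  and der_right_apply: "t \<in> tensor_alg A B \<Longrightarrow> der_right \<epsilon> t (x, y) = \<epsilon> (\<lambda>y'. t (x, y')) y"
  by (simp_all add: der_left_def der_right_def)

lemma der_left_tensor_fun:
  assumes "\<delta> \<in> derivations A" "a \<in> A" "b \<in> B"
  shows "der_left \<delta> (tensor_fun a b) = tensor_fun (\<delta> a) b"
proof -
  have "\<delta> (\<lambda>x. a x * b y) = (\<lambda>x. b y * \<delta> a x)" for y
    using A.der_scale[OF assms(1,2), of "b y"] by (simp add: mult.commute)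
  then show ?thesis
    using assms by (auto simp: fun_eq_iff der_left_apply tensor_fun_in_tensor_alg mult.commute)
qed

lemma der_right_tensor_fun:
  assumes "\<epsilon> \<in> derivations B" "a \<in> A" "b \<in> B"
  shows "der_right \<epsilon> (tensor_fun a b) = tensor_fun a (\<epsilon> b)"
  using assms by (auto simp: fun_eq_iff der_right_apply tensor_fun_in_tensor_alg B.der_scale)

lemma der_left_derivation:
  assumes \<delta>: "\<delta> \<in> derivations A"
  shows "der_left \<delta> \<in> derivations (tensor_alg A B)"
proof -
  have add: "der_left \<delta> (s + t) = der_left \<delta> s + der_left \<delta> t"
    if "s \<in> tensor_alg A B" "t \<in> tensor_alg A B" for s t
  proof -
    have "\<delta> (\<lambda>x. s (x, y) + t (x, y)) = \<delta> (\<lambda>x. s (x, y)) + \<delta> (\<lambda>x. t (x, y))" for y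
      using A.der_add[OF \<delta> slice_left[OF that(1), of y] slice_left[OF that(2), of y]]
      by (simp add: plus_fun_def)
    then show ?thesis
      using that by (auto simp: fun_eq_iff der_left_apply tensor_alg_add)
  qed
  moreover have "der_left \<delta> (s * t) = s * der_left \<delta> t + der_left \<delta> s * t"
    if "s \<in> tensor_alg A B" "t \<in> tensor_alg A B" for s t
  proof -
    have "\<delta> (\<lambda>x. s (x, y) * t (x, y)) =
      (\<lambda>x. s (x, y)) * \<delta> (\<lambda>x. t (x, y)) + \<delta> (\<lambda>x. s (x, y)) * (\<lambda>x. t (x, y))" for y
      using A.der_mult[OF \<delta> slice_left[OF that(1), of y] slice_left[OF that(2), of y]]
      by (simp add: times_fun_def)
    then show ?thesis
      using that by (auto simp: fun_eq_iff der_left_apply tensor_mult_closed)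
  qed
  moreover have "der_left \<delta> (\<lambda>p. c * t p) = (\<lambda>p. c * der_left \<delta> t p)" if "t \<in> tensor_alg A B" for c t
    using that A.der_scale[OF \<delta> slice_left[OF that]] T.scale_closed[OF that]
    by (auto simp: fun_eq_iff der_left_apply)
  moreover have "der_left \<delta> t \<in> tensor_alg A B" if "t \<in> tensor_alg A B" for t
    using that
  proof (induction t rule: tensor_alg_induct)
    case zero
    have "der_left \<delta> 0 = 0"
      using add[OF zero_in_tensor_alg zero_in_tensor_alg] by simp
    then show ?case
      by (simp only: zero_in_tensor_alg)
  next
    case (add t a b)
    then show ?case
      using tensor_alg_add_tensor_fun[OF add.IH A.der_closed[OF \<delta> add.hyps(2)] add.hyps(3)]
        \<open>\<And>s t. s \<in> tensor_alg A B \<Longrightarrow> t \<in> tensor_alg A B \<Longrightarrow> der_left \<delta> (s + t) = der_left \<delta> s + der_left \<delta> t\<close>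
      by (simp only: tensor_fun_in_tensor_alg der_left_tensor_fun[OF \<delta>])
  qed
  ultimately show ?thesis
    by (auto simp: derivations_def der_left_def)
qed

lemma der_right_derivation:
  assumes \<epsilon>: "\<epsilon> \<in> derivations B"
  shows "der_right \<epsilon> \<in> derivations (tensor_alg A B)"
proof -
  interpret S: tensor_algebras V B U A
    by (rule tensor_algebras_swap)
  have "der_right \<epsilon> = restrict (\<lambda>t. S.der_left \<epsilon> (t \<circ> prod.swap) \<circ> prod.swap) (tensor_alg A B)"
    by (auto simp: fun_eq_iff der_right_def S.der_left_apply tensor_alg_swap)
  then show ?thesis
    using S.derivation_swap[OF S.der_left_derivation[OF \<epsilon>]] by simp
qed

end

section \<open>Derivations of a tensor product\<close>

text \<open>The \<open>b j\<close> are a basis of the span of \<open>F\<close> which is dual to the evaluations at the points \<open>y j\<close>.\<close>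

lemma (in function_algebra) interpolation:
  assumes "finite F" "F \<subseteq> A"
  shows "\<exists>(n::nat) y b. (\<forall>j. b j \<in> A) \<and> (\<forall>\<phi>\<in>F. \<forall>v. \<phi> v = (\<Sum>j<n. \<phi> (y j) * b j v))"
  using assms
proof (induction F)
  case empty
  then show ?case
    using zero_closed by (intro exI[of _ "0::nat"] exI[of _ "\<lambda>_. undefined :: 'a"] exI[of _ "\<lambda>_. 0"]) (auto simp: zero_fun_def)
next
  case (insert \<phi> F)
  then obtain n :: nat and y b where b: "\<And>j. b j \<in> A"
    and rep: "\<And>\<psi> v. \<psi> \<in> F \<Longrightarrow> \<psi> v = (\<Sum>j<n. \<psi> (y j) * b j v)"
    by auto metis
  define r where "r v = \<phi> v - (\<Sum>j<n. \<phi> (y j) * b j v)" for v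
  show ?case
  proof (cases "\<forall>v. r v = 0")
    case True
    have \<phi>: "\<phi> v = (\<Sum>j<n. \<phi> (y j) * b j v)" for v
      using spec[OF True, of v] unfolding r_def by (rule iffD1[OF right_minus_eq])
    have "\<psi> v = (\<Sum>j<n. \<psi> (y j) * b j v)" if "\<psi> \<in> insert \<phi> F" for \<psi> v
    proof (cases "\<psi> = \<phi>")
      case True
      show ?thesis
        unfolding True by (rule \<phi>)
    qed (use that rep in blast)
    then show ?thesis
      by (intro exI[of _ n] exI[of _ y] exI[of _ b] conjI allI ballI b)
  next
    case False
    then obtain w where w: "r w \<noteq> 0"
      by blast
    have "(\<Sum>j<n. (\<lambda>v. \<phi> (y j) * b j v)) v = (\<Sum>j<n. \<phi> (y j) * b j v)" for v
      by (rule sum_fun_apply)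
    then have "r = \<phi> - (\<Sum>j<n. (\<lambda>v. \<phi> (y j) * b j v))"
      by (auto simp: r_def)
    then have rA: "r \<in> A"
      using insert.prems b by (auto intro!: diff_closed sum_closed scale_closed)
    \<comment> \<open>\<open>r\<close> is what the old basis misses of \<open>\<phi>\<close>.
      Normalized to 1 at the new point \<open>w\<close> it joins the basis, and the old elements are
      corrected so that they vanish at \<open>w\<close>.\<close>
    define e where "e = (\<lambda>v. 1 / r w * r v)"
    define b' where "b' j = (if j = n then e else (b j - (\<lambda>v. b j w * e v)))" for j
    define y' where "y' j = (if j = n then w else y j)" for j
    have eA: "e \<in> A"
      unfolding e_def using rA by (rule scale_closed)
    then have "b' j \<in> A" for j
      unfolding b'_def using b by (auto intro: diff_closed scale_closed)
    moreover have "\<psi> v = (\<Sum>j<Suc n. \<psi> (y' j) * b' j v)" if "\<psi> \<in> insert \<phi> F" for \<psi> v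
    proof -
      have "(\<Sum>j<Suc n. \<psi> (y' j) * b' j v) = (\<Sum>j<n. \<psi> (y j) * b j v - \<psi> (y j) * b j w * e v) + \<psi> w * e v"
        by (simp add: b'_def y'_def algebra_simps)
      also have "\<dots> = (\<Sum>j<n. \<psi> (y j) * b j v) - (\<Sum>j<n. \<psi> (y j) * b j w) * e v + \<psi> w * e v"
        by (simp add: sum_subtractf sum_distrib_right)
      also have "\<dots> = \<psi> v"
      proof (cases "\<psi> \<in> F")
        case True
        then show ?thesis
          by (simp flip: rep)
      next
        case False
        then have "\<psi> = \<phi>"
          using that by auto
        then have "(\<Sum>j<n. \<psi> (y j) * b j u) = \<psi> u - r u" for u
          by (simp add: r_def)
        then show ?thesis
          unfolding e_def using w by (simp only:) (simp add: field_simps)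
      qed
      finally show ?thesis
        by simp
    qed
    ultimately show ?thesis
      by blast
  qed
qed

context tensor_algebras
begin

text \<open>The right factors of finitely many tensors are interpolated together, so the
  coefficients of a tensor with respect to the \<open>b j\<close> are its own slices at the
  \<open>y j\<close>.\<close>

lemma tensor_interpolation:
  assumes "finite S" "S \<subseteq> tensor_alg A B"
  shows "\<exists>(n::nat) y b. (\<forall>j. b j \<in> B) \<and> (\<forall>t\<in>S. \<forall>x v. t (x, v) = (\<Sum>j<n. t (x, y j) * b j v))"
proof -
  have "\<forall>t\<in>S. \<exists>(n::nat) a b. t = (\<Sum>i<n. tensor_fun (a i) (b i)) \<and> b \<in> {..<n} \<rightarrow> B"
    using assms(2) unfolding tensor_alg_def by blast
  then obtain n a b where t: "\<And>t. t \<in> S \<Longrightarrow> t = (\<Sum>i<n t. tensor_fun (a t i) (b t i))"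
    and b: "\<And>t. t \<in> S \<Longrightarrow> b t \<in> {..<(n t :: nat)} \<rightarrow> B"
    by metis
  define F where "F = (\<Union>t\<in>S. b t ` {..<n t})"
  have "finite F" "F \<subseteq> B"
    using assms(1) b by (auto simp: F_def)
  then obtain m :: nat and y e where e: "\<And>j. e j \<in> B"
    and rep: "\<And>\<phi> v. \<phi> \<in> F \<Longrightarrow> \<phi> v = (\<Sum>j<m. \<phi> (y j) * e j v)"
    using B.interpolation by metis
  have "s (x, v) = (\<Sum>j<m. s (x, y j) * e j v)" if s: "s \<in> S" for s x v
  proof -
    have *: "s (x, u) = (\<Sum>i<n s. a s i x * b s i u)" for u
      using t[OF s] by (metis (mono_tags, lifting) sum.cong sum_fun_apply tensor_fun_apply)
    have "s (x, v) = (\<Sum>i<n s. a s i x * (\<Sum>j<m. b s i (y j) * e j v))"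
      unfolding * using s by (intro sum.cong refl arg_cong2[of _ _ _ _ "(*)"] rep) (auto simp: F_def)
    also have "\<dots> = (\<Sum>i<n s. \<Sum>j<m. a s i x * b s i (y j) * e j v)"
      by (simp add: sum_distrib_left mult.assoc)
    also have "\<dots> = (\<Sum>j<m. \<Sum>i<n s. a s i x * b s i (y j) * e j v)"
      by (rule sum.swap)
    finally show ?thesis
      unfolding * by (simp add: sum_distrib_right)
  qed
  then show ?thesis
    using e by blast
qed

text \<open>The values of \<open>\<Delta>\<close> on the generators are expanded by
  \<open>tensor_interpolation\<close>. Sums and, by the Leibniz rule, products inherit the expansion
  with the same \<open>y j\<close> and \<open>b j\<close>; its coefficients, being slices of
  \<open>\<Delta>(a \<otimes> 1)\<close>, are derivations in \<open>a\<close>.\<close>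

lemma derivation_on_left_factor:
  assumes gen: "A = alg_gen U G" "finite G" and \<Delta>: "\<Delta> \<in> derivations (tensor_alg A B)"
  shows "\<exists>(n::nat) \<delta> b. (\<forall>j. \<delta> j \<in> derivations A \<and> b j \<in> B) \<and>
    (\<forall>a\<in>A. \<Delta> (tensor_fun a (cst V 1)) = (\<Sum>j<n. tensor_fun (\<delta> j a) (b j)))"
proof -
  define i where "i a = tensor_fun a (cst V 1)" for a :: "'a \<Rightarrow> complex"
  have iT: "i a \<in> tensor_alg A B" if "a \<in> A" for a
    unfolding i_def using that B.cst_closed by (rule tensor_fun_in_tensor_alg)
  have iD: "\<Delta> (i a) \<in> tensor_alg A B" if "a \<in> A" for a
    using T.der_closed[OF \<Delta> iT[OF that]] .
  have i_add: "i (a + b) = i a + i b" and i_mult: "i (a * b) = i a * i b"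
    and i_scale: "i (\<lambda>x. c * a x) = (\<lambda>p. c * i a p)" for a b c
    by (auto simp: i_def fun_eq_iff algebra_simps cst_apply)
  have iv: "i a (x, v) * t (x, v) = a x * t (x, v)" if "t \<in> tensor_alg A B" for a t x v
    using tensor_vanishes[OF that, of x v] by (auto simp: i_def cst_apply)
  have D_mult: "\<Delta> (i (a * b)) (x, v) = a x * \<Delta> (i b) (x, v) + \<Delta> (i a) (x, v) * b x"
    if "a \<in> A" "b \<in> A" for a b x v
  proof -
    have "\<Delta> (i (a * b)) (x, v) = i a (x, v) * \<Delta> (i b) (x, v) + i b (x, v) * \<Delta> (i a) (x, v)"
      by (simp only: i_mult T.der_mult[OF \<Delta> iT iT, OF that] plus_fun_apply times_fun_apply mult.commute)
    then show ?thesis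
      by (simp only: iv iD that mult.commute)
  qed
  have D_add: "\<Delta> (i (a + b)) = \<Delta> (i a) + \<Delta> (i b)" if "a \<in> A" "b \<in> A" for a b
    by (simp only: i_add T.der_add[OF \<Delta> iT iT, OF that])
  have D_scale: "\<Delta> (i (\<lambda>x. c * a x)) = (\<lambda>p. c * \<Delta> (i a) p)" if "a \<in> A" for c a
    by (simp only: i_scale T.der_scale[OF \<Delta> iT, OF that])
  have "(\<lambda>g. \<Delta> (i g)) ` G \<subseteq> tensor_alg A B"
    using iD gen(1) by (auto simp: alg_gen.gen)
  then obtain n :: nat and y b where b: "\<And>j. b j \<in> B"
    and rep: "\<And>g x v. g \<in> G \<Longrightarrow> \<Delta> (i g) (x, v) = (\<Sum>j<n. \<Delta> (i g) (x, y j) * b j v)"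
    using tensor_interpolation[of "(\<lambda>g. \<Delta> (i g)) ` G"] gen(2) by (auto simp: ball_simps) metis
  have repA: "\<Delta> (i a) (x, v) = (\<Sum>j<n. \<Delta> (i a) (x, y j) * b j v)" if "a \<in> alg_gen U G" for a x v
    using that
  proof (induction arbitrary: x v rule: alg_gen.induct)
    case (cst c)
    have "\<Delta> (i (cst U c)) = 0"
      using T.der_cst[OF \<Delta>, of c] by (simp only: tensor_cst i_def)
    then show ?case
      by simp
  next
    case (add a a')
    have *: "\<Delta> (i (a + a')) = \<Delta> (i a) + \<Delta> (i a')"
      using add.hyps gen(1) D_add by blast
    show ?case
      unfolding * by (simp add: ring_distribs sum.distrib flip: add.IH)
  next
    case (mult a a')
    have *: "\<Delta> (i (a * a')) (x, v) = a x * \<Delta> (i a') (x, v) + \<Delta> (i a) (x, v) * a' x" for v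
      using mult.hyps gen(1) D_mult by blast
    have "(\<Sum>j<n. \<Delta> (i (a * a')) (x, y j) * b j v) =
      a x * (\<Sum>j<n. \<Delta> (i a') (x, y j) * b j v) + a' x * (\<Sum>j<n. \<Delta> (i a) (x, y j) * b j v)"
      unfolding * by (simp add: sum.distrib sum_distrib_left algebra_simps)
    also have "\<dots> = \<Delta> (i (a * a')) (x, v)"
      unfolding * by (simp only: mult.IH[symmetric]) (simp only: mult.commute)
    finally show ?case
      by (rule sym)
  qed (rule rep)
  define \<delta> where "\<delta> j = restrict (\<lambda>a x. \<Delta> (i a) (x, y j)) A" for j
  have "\<delta> j \<in> derivations A" for j
    using slice_left[OF iD] A.add_closed A.mult_closed A.scale_closed
    by (auto simp: derivations_def \<delta>_def fun_eq_iff D_mult D_add D_scale simp del: plus_fun_apply)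
      (auto simp: algebra_simps)
  moreover have "\<Delta> (i a) = (\<Sum>j<n. tensor_fun (\<delta> j a) (b j))" if "a \<in> A" for a
  proof
    fix p :: "'a \<times> 'b"
    show "\<Delta> (i a) p = (\<Sum>j<n. tensor_fun (\<delta> j a) (b j)) p"
      using repA[of a "fst p" "snd p"] that gen(1) by (cases p) (simp add: sum_fun_apply \<delta>_def)
  qed
  ultimately show ?thesis
    using b unfolding i_def by blast
qed

lemma derivation_on_right_factor:
  assumes gen: "B = alg_gen V H" "finite H" and \<Delta>: "\<Delta> \<in> derivations (tensor_alg A B)"
  shows "\<exists>(n::nat) \<epsilon> a. (\<forall>j. \<epsilon> j \<in> derivations B \<and> a j \<in> A) \<and>
    (\<forall>b\<in>B. \<Delta> (tensor_fun (cst U 1) b) = (\<Sum>j<n. tensor_fun (a j) (\<epsilon> j b)))"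
proof -
  interpret S: tensor_algebras V B U A
    by (rule tensor_algebras_swap)
  define \<Delta>' where "\<Delta>' = restrict (\<lambda>t. \<Delta> (t \<circ> prod.swap) \<circ> prod.swap) (tensor_alg B A)"
  have "\<Delta>' \<in> derivations (tensor_alg B A)"
    unfolding \<Delta>'_def using \<Delta> by (rule derivation_swap)
  from S.derivation_on_left_factor[OF gen this]
  obtain n :: nat and \<epsilon> a where \<epsilon>: "\<And>j. \<epsilon> j \<in> derivations B" "\<And>j. a j \<in> A"
    and rep: "\<And>b. b \<in> B \<Longrightarrow> \<Delta>' (tensor_fun b (cst U 1)) = (\<Sum>j<n. tensor_fun (\<epsilon> j b) (a j))"
    by metis
  have "\<Delta> (tensor_fun (cst U 1) b) = (\<Sum>j<n. tensor_fun (a j) (\<epsilon> j b))" if b: "b \<in> B" for b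
  proof
    fix p :: "'a \<times> 'b"
    have eq: "tensor_fun b (cst U 1) \<circ> prod.swap = tensor_fun (cst U 1) b"
      by (auto simp: fun_eq_iff)
    have "\<Delta>' (tensor_fun b (cst U 1)) (prod.swap p) = \<Delta> (tensor_fun (cst U 1) b) p"
      using b A.cst_closed by (simp add: \<Delta>'_def tensor_fun_in_tensor_alg eq)
    then show "\<Delta> (tensor_fun (cst U 1) b) p = (\<Sum>j<n. tensor_fun (a j) (\<epsilon> j b)) p"
      unfolding rep[OF b] by (cases p) (simp add: sum_fun_apply mult.commute)
  qed
  then show ?thesis
    using \<epsilon> by blast
qed

end


section \<open>The module of a tensor product\<close>

text \<open>Both factors are polynomials in the same \<open>s\<close>, hence the tensor product over
  \<complex>[s] and not over \<complex>.\<close>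

definition tens :: "('a \<Rightarrow> complex) poly \<Rightarrow> ('b \<Rightarrow> complex) poly \<Rightarrow> ('a \<times> 'b \<Rightarrow> complex) poly" where
  "tens p q = map_poly (\<lambda>h. h \<circ> fst) p * map_poly (\<lambda>h. h \<circ> snd) q"

lemma ev_tens [simp]: "ev (x, y) (tens p q) = ev x p * ev y q"
proof -
  have "0 \<circ> fst = (0 :: 'a \<times> 'b \<Rightarrow> complex)" "0 \<circ> snd = (0 :: 'a \<times> 'b \<Rightarrow> complex)"
    by auto
  then have "ev (x, y) (map_poly (\<lambda>h. h \<circ> fst) p) = ev x p" "ev (x, y) (map_poly (\<lambda>h. h \<circ> snd) q) = ev y q"
    by (intro poly_eqI; simp add: coeff_map_poly)+
  then show ?thesis
    by (simp add: tens_def)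
qed

lemma tens_eqI: "(\<And>x y. ev (x, y) r = ev (x, y) r') \<Longrightarrow> r = r'"
  by (rule poly_fun_eqI) auto

lemma tens_simps:
  "tens (p + p') q = tens p q + tens p' q" "tens p (q + q') = tens p q + tens p q'"
  "tens ([:0, 1:] * p) q = [:0, 1:] * tens p q" "tens p ([:0, 1:] * q) = [:0, 1:] * tens p q"
  "tens (constant_poly c * p) q = constant_poly c * tens p q"
  "tens p (constant_poly c * q) = constant_poly c * tens p q"
  "smult (tensor_fun a b) (tens p q) = tens (smult a p) (smult b q)"
  by (rule tens_eqI; simp add: algebra_simps)+

text \<open>\<open>tens_span M N\<close> is the image of \<open>M \<otimes>\<^bsub>\<complex>[s]\<^esub> N\<close>.\<close>

definition tens_span ::
  "('a \<Rightarrow> complex) poly set \<Rightarrow> ('b \<Rightarrow> complex) poly set \<Rightarrow> ('a \<times> 'b \<Rightarrow> complex) poly set" where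
  "tens_span M N = {\<Sum>i<n. tens (p i) (q i) | (n :: nat) p q. \<forall>i. p i \<in> M \<and> q i \<in> N}"

lemma tens_in_tens_span: "p \<in> M \<Longrightarrow> q \<in> N \<Longrightarrow> tens p q \<in> tens_span M N"
  unfolding tens_span_def
  by (intro CollectI exI[of _ "Suc 0"] exI[of _ "\<lambda>_. p"] exI[of _ "\<lambda>_. q"]) simp

lemma tens_span_add_tens:
  assumes "r \<in> tens_span M N" "p \<in> M" "q \<in> N"
  shows "r + tens p q \<in> tens_span M N"
proof -
  obtain n :: nat and c d where r: "r = (\<Sum>i<n. tens (c i) (d i))" "\<And>i. c i \<in> M" "\<And>i. d i \<in> N"
    using assms(1) unfolding tens_span_def by blast
  have "r + tens p q = (\<Sum>i<Suc n. tens ((c(n := p)) i) ((d(n := q)) i))"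
    by (simp add: r(1))
  then show ?thesis
    unfolding tens_span_def using r(2,3) assms(2,3)
    by (intro CollectI exI[of _ "Suc n"] exI[of _ "c(n := p)"] exI[of _ "d(n := q)"]) auto
qed

lemma tens_span_induct [consumes 1, case_names zero add]:
  assumes "r \<in> tens_span M N"
    and "P 0"
    and "\<And>r p q. r \<in> tens_span M N \<Longrightarrow> P r \<Longrightarrow> p \<in> M \<Longrightarrow> q \<in> N \<Longrightarrow> P (r + tens p q)"
  shows "P r"
proof -
  obtain n :: nat and p q where r: "r = (\<Sum>i<n. tens (p i) (q i))" "\<And>i. p i \<in> M" "\<And>i. q i \<in> N"
    using assms(1) unfolding tens_span_def by blast
  have "(\<Sum>i<m. tens (p i) (q i)) \<in> tens_span M N" for m
    unfolding tens_span_def using r(2,3) by blast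
  then have "P (\<Sum>i<m. tens (p i) (q i))" for m
    using assms(2,3) r(2,3) by (induction m) simp_all
  then show ?thesis
    by (simp add: r(1))
qed

text \<open>The families in \<open>tens_span\<close> are indexed by all natural numbers, so that
  even the empty sum requires elements of \<open>M\<close> and \<open>N\<close>.\<close>

lemma tens_span_zero: "0 \<in> tens_span M N" if "p \<in> M" "q \<in> N"
  unfolding tens_span_def using that
  by (intro CollectI exI[of _ 0] exI[of _ "\<lambda>_. p"] exI[of _ "\<lambda>_. q"]) simp

lemma tens_span_add:
  assumes r: "r \<in> tens_span M N" and s: "s \<in> tens_span M N"
  shows "r + s \<in> tens_span M N"
  using s
proof (induction s rule: tens_span_induct)
  case (add s p q)
  then show ?case
    using tens_span_add_tens[of "r + s" M N p q] by (simp only: add.assoc)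
qed (simp only: add_0_right r)

context function_algebra
begin

text \<open>Both \<open>\<delta>(h)\<close> and \<open>s h \<delta>(f) / f\<close> are linear in
  \<open>\<delta>\<close> over functions.\<close>

lemma der_act_combination:
  assumes f: "f \<in> A" and \<Delta>: "\<Delta> \<in> derivations A" and \<delta>: "\<And>j. j \<in> J \<Longrightarrow> \<delta> j \<in> derivations A"
    and comb: "\<And>a. a \<in> A \<Longrightarrow> \<Delta> a = (\<Sum>j\<in>J. c j * \<delta> j a)" and p: "p \<in> loc_polys A f"
  shows "der_act A f \<Delta> p = (\<Sum>j\<in>J. smult (c j) (der_act A f (\<delta> j) p))"
proof -
  have comb': "\<Delta> a x = (\<Sum>j\<in>J. c j x * \<delta> j a x)" if "a \<in> A" for a x
    by (simp add: comb[OF that] sum_fun_apply)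
  have frac: "fraction f (\<Delta> a * f - of_nat n * a * \<Delta> f) m x =
      (\<Sum>j\<in>J. c j x * fraction f (\<delta> j a * f - of_nat n * a * \<delta> j f) m x)" if "a \<in> A" for a n m x
    by (cases "f x = 0")
      (simp_all add: fraction_apply comb'[OF that] comb'[OF f] sum_distrib_left sum_distrib_right
        algebra_simps flip: sum_subtractf sum_divide_distrib)
  have loc: "der_loc A f \<Delta> k x = (\<Sum>j\<in>J. c j x * der_loc A f (\<delta> j) k x)" if k: "k \<in> localization A f" for k x
  proof -
    obtain a n where a: "a \<in> A" "k = fraction f a n"
      using k by (auto simp: localization_def)
    show ?thesis
      unfolding a(2) der_loc_fraction[OF \<Delta> f a(1)] frac[OF a(1)]
      by (intro sum.cong refl) (simp only: der_loc_fraction[OF \<delta> f a(1)])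
  qed
  have frac1: "fraction f (\<Delta> f) 1 x = (\<Sum>j\<in>J. c j x * fraction f (\<delta> j f) 1 x)" for x
    by (simp add: fraction_apply comb'[OF f] sum_divide_distrib)
  have "coeff (der_act A f \<Delta> p) n x = coeff (\<Sum>j\<in>J. smult (c j) (der_act A f (\<delta> j) p)) n x" for n x
  proof -
    have "coeff (\<Sum>j\<in>J. smult (c j) (der_act A f (\<delta> j) p)) n x =
      (\<Sum>j\<in>J. c j x * coeff (der_act A f (\<delta> j) p) n x)"
      by (simp add: coeff_sum sum_fun_apply)
    also have "\<dots> = (\<Sum>j\<in>J. c j x * (der_loc A f (\<delta> j) (coeff p n) x +
      (case n of 0 \<Rightarrow> 0 | Suc m \<Rightarrow> fraction f (\<delta> j f) 1 x * coeff p m x)))"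
      by (intro sum.cong refl) (simp add: coeff_der_act[OF f \<delta>] split: nat.split)
    also have "\<dots> = coeff (der_act A f \<Delta> p) n x"
      using p by (simp add: coeff_der_act[OF f \<Delta>] loc_polys_def loc frac1 sum.distrib ring_distribs
          sum_distrib_right mult.assoc del: One_nat_def split: nat.split)
    finally show ?thesis
      by simp
  qed
  then show ?thesis
    by (intro poly_eqI ext)
qed

text \<open>
  On a slice \<open>\<iota>\<close> the function \<open>F\<close> is only a multiple \<open>c f\<close> of \<open>f\<close>. The constant does not matter for the
  action because it is annihilated by \<open>\<delta>\<close>.
\<close>

lemma der_act_slice:
  fixes \<iota> :: "'a \<Rightarrow> 'b"
  assumes T: "function_algebra W T" and \<iota>: "\<And>t. t \<in> T \<Longrightarrow> t \<circ> \<iota> \<in> A"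
    and \<epsilon>: "\<epsilon> \<in> derivations T" and \<delta>: "\<delta> \<in> derivations A"
    and compat: "\<And>t. t \<in> T \<Longrightarrow> \<epsilon> t \<circ> \<iota> = \<delta> (t \<circ> \<iota>)"
    and F: "F \<in> T" and f: "f \<in> A" and Ff: "F \<circ> \<iota> = (\<lambda>x. c * f x)"
    and r: "r \<in> loc_polys T F" and p: "p \<in> loc_polys A f"
    and rp: "\<And>x. ev (\<iota> x) r = d * ev x p" and d0: "c = 0 \<Longrightarrow> d = 0"
  shows "ev (\<iota> x) (der_act T F \<epsilon> r) = d * ev x (der_act A f \<delta> p)"
proof -
  have UN: "res UNIV h = h" for h :: "'a \<Rightarrow> complex"
    by (auto simp: res_apply)
  have "map_poly (\<lambda>h. res UNIV (h \<circ> \<iota>)) (der_act T F \<epsilon> r) =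
    smult 1 (der_act A (res UNIV (F \<circ> \<iota>)) \<delta> (map_poly (\<lambda>h. res UNIV (h \<circ> \<iota>)) r))"
    by (rule der_act_pullback[OF function_algebra_axioms T]; (rule \<epsilon> \<delta> F r)?;
        simp add: UN \<iota> compat del: one_fun_apply o_apply)
  then have "ev x (map_poly (\<lambda>h. res UNIV (h \<circ> \<iota>)) (der_act T F \<epsilon> r)) =
    ev x (der_act A (res UNIV (F \<circ> \<iota>)) \<delta> (map_poly (\<lambda>h. res UNIV (h \<circ> \<iota>)) r))"
    by simp
  moreover have "map_poly (\<lambda>h. res UNIV (h \<circ> \<iota>)) r = constant_poly d * p"
    by (rule poly_fun_eqI) (simp add: ev_map_poly_res rp)
  moreover have Fc: "res UNIV (F \<circ> \<iota>) = cst U c * f"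
    using vanishes[OF f] by (auto simp: UN Ff fun_eq_iff cst_apply)
  ultimately have *: "ev (\<iota> x) (der_act T F \<epsilon> r) = ev x (der_act A (cst U c * f) \<delta> (constant_poly d * p))"
    by (simp add: ev_map_poly_res)
  \<comment> \<open>A nonzero \<open>c\<close> is a unit with \<open>\<delta>(c) = 0\<close>, so
    \<open>der_act_unit\<close> has no error term. For \<open>c = 0\<close> the assumption
    \<open>d0\<close> makes both sides vanish.\<close>
  show ?thesis
  proof (cases "c = 0")
    case True
    then have "d = 0"
      by (rule d0)
    moreover have "der_act A (cst U c * f) \<delta> 0 = 0"
      using mult_closed[OF cst_closed f] \<delta> by (rule der_act_0)
    ultimately show ?thesis
      unfolding * by (simp add: constant_poly_simps)
  next
    case False
    have "cst U c * cst U (1 / c) = cst U 1"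
      using False by (auto simp: cst_apply)
    then have "der_act A (cst U c * f) \<delta> (constant_poly d * p) = der_act A f \<delta> (constant_poly d * p)
        + [:0, 1:] * smult (cst U (1 / c) * \<delta> (cst U c)) (constant_poly d * p)"
      using der_act_unit[OF f cst_closed cst_closed _ \<delta> loc_polys_constant_poly[OF f p]] by blast
    moreover have "\<delta> (cst U c) = 0"
      using der_cst[OF \<delta>] .
    ultimately have "der_act A (cst U c * f) \<delta> (constant_poly d * p) = der_act A f \<delta> (constant_poly d * p)"
      by (simp only: mult_zero_right smult_0_left add_0_right)
    also have "\<dots> = constant_poly d * der_act A f \<delta> p"
      by (rule der_act_constant_poly[OF f \<delta> p])
    finally show ?thesis
      unfolding * by simp
  qed
qed

end

context tensor_algebras
begin

lemma loc_polys_tens: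
  assumes f: "f \<in> A" and g: "g \<in> B" and p: "p \<in> loc_polys A f" and q: "q \<in> loc_polys B g"
  shows "tens p q \<in> loc_polys (tensor_alg A B) (tensor_fun f g)"
proof -
  interpret L: function_algebra "nonvan (tensor_fun f g)" "localization (tensor_alg A B) (tensor_fun f g)"
    using f g by (intro T.function_algebra_localization tensor_fun_in_tensor_alg)
  have 0: "0 \<circ> fst = (0 :: 'a \<times> 'b \<Rightarrow> complex)" "0 \<circ> snd = (0 :: 'a \<times> 'b \<Rightarrow> complex)"
    by auto
  have "coeff (tens p q) n = (\<Sum>i\<le>n. tensor_fun (coeff p i) (coeff q (n - i)))" for n
    by (rule ext) (auto simp: tens_def coeff_mult coeff_map_poly 0 sum_fun_apply)
  then show ?thesis
    using p q f g by (simp add: loc_polys_def L.sum_closed tensor_fun_localization)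
qed

text \<open>Both sides are compared on the slices at \<open>y\<close>, where
  \<open>f \<otimes> g\<close> becomes \<open>g y\<close> times \<open>f\<close> and
  \<open>tens p q\<close> becomes \<open>ev y q\<close> times \<open>p\<close>. If
  \<open>g y = 0\<close>, then \<open>ev y q = 0\<close> as well.\<close>

lemma der_act_left_tens:
  assumes f: "f \<in> A" and g: "g \<in> B" and p: "p \<in> loc_polys A f" and q: "q \<in> loc_polys B g"
    and \<delta>: "\<delta> \<in> derivations A"
  shows "der_act (tensor_alg A B) (tensor_fun f g) (der_left \<delta>) (tens p q) = tens (der_act A f \<delta> p) q"
proof (rule tens_eqI)
  fix x y
  have "ev ((\<lambda>x. (x, y)) x) (der_act (tensor_alg A B) (tensor_fun f g) (der_left \<delta>) (tens p q)) =
    ev y q * ev x (der_act A f \<delta> p)"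
    by (rule A.der_act_slice[where c = "g y", OF T.function_algebra_axioms _ der_left_derivation[OF \<delta>] \<delta> _
        tensor_fun_in_tensor_alg[OF f g] f _ loc_polys_tens[OF f g p q] p])
      (auto simp: comp_def slice_left der_left_apply B.loc_polys_outside[OF g q] mult.commute)
  then show "ev (x, y) (der_act (tensor_alg A B) (tensor_fun f g) (der_left \<delta>) (tens p q)) =
    ev (x, y) (tens (der_act A f \<delta> p) q)"
    by (simp add: mult.commute)
qed

lemma der_act_right_tens:
  assumes f: "f \<in> A" and g: "g \<in> B" and p: "p \<in> loc_polys A f" and q: "q \<in> loc_polys B g"
    and \<epsilon>: "\<epsilon> \<in> derivations B"
  shows "der_act (tensor_alg A B) (tensor_fun f g) (der_right \<epsilon>) (tens p q) = tens p (der_act B g \<epsilon> q)"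
proof (rule tens_eqI)
  fix x y
  have "ev ((\<lambda>y. (x, y)) y) (der_act (tensor_alg A B) (tensor_fun f g) (der_right \<epsilon>) (tens p q)) =
    ev x p * ev y (der_act B g \<epsilon> q)"
    by (rule B.der_act_slice[where c = "f x", OF T.function_algebra_axioms _ der_right_derivation[OF \<epsilon>] \<epsilon> _
        tensor_fun_in_tensor_alg[OF f g] g _ loc_polys_tens[OF f g p q] q])
      (auto simp: comp_def slice_right der_right_apply A.loc_polys_outside[OF f p])
  then show "ev (x, y) (der_act (tensor_alg A B) (tensor_fun f g) (der_right \<epsilon>) (tens p q)) =
    ev (x, y) (tens p (der_act B g \<epsilon> q))"
    by simp
qed

text \<open>Operators of either factor act on the product without touching the other one. Induction
  over \<open>p\<close>, with the generator on the right, provides the start of the induction over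
  \<open>q\<close>.\<close>

lemma tens_in_bs_module:
  assumes f: "f \<in> A" and g: "g \<in> B" and p: "p \<in> bs_module A f" and q: "q \<in> bs_module B g"
  shows "tens p q \<in> bs_module (tensor_alg A B) (tensor_fun f g)"
proof -
  have left: "tens p [:g:] \<in> bs_module (tensor_alg A B) (tensor_fun f g)"
    using p
  proof (induction rule: bs_module.induct)
    case gen
    have "tens [:f:] [:g:] = [:tensor_fun f g:]"
      by (rule tens_eqI) simp
    then show ?case
      using bs_module.gen by metis
  next
    case (smult a p)
    have "tens (smult a p) [:g:] = smult (tensor_fun a (cst V 1)) (tens p [:g:])"
      using B.unit_mult[OF g] by (simp add: tens_simps del: times_fun_apply)
    then show ?case
      using bs_module.smult[OF tensor_fun_in_tensor_alg[OF smult.hyps(1) B.cst_closed] smult.IH] by metis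
  next
    case (der \<delta> p)
    have "tens (der_act A f \<delta> p) [:g:] =
      der_act (tensor_alg A B) (tensor_fun f g) (der_left \<delta>) (tens p [:g:])"
      using der_act_left_tens[OF f g A.bs_module_loc_polys[OF f der.hyps(2)] B.loc_polys_gen[OF g] der.hyps(1)]
      by simp
    then show ?case
      using bs_module.der[OF der_left_derivation[OF der.hyps(1)] der.IH] by metis
  qed (simp_all only: tens_simps bs_module.add bs_module.shift)
  show ?thesis
    using q
  proof (induction rule: bs_module.induct)
    case gen
    then show ?case
      by (rule left)
  next
    case (smult b q)
    have "smult (cst U 1) p = p"
      by (rule poly_fun_eqI)
        (use A.loc_polys_outside[OF f A.bs_module_loc_polys[OF f p]] A.vanishes[OF f] in \<open>auto simp: cst_apply\<close>)
    then have "tens p (smult b q) = smult (tensor_fun (cst U 1) b) (tens p q)"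
      by (simp only: tens_simps)
    then show ?case
      using bs_module.smult[OF tensor_fun_in_tensor_alg[OF A.cst_closed smult.hyps(1)] smult.IH] by metis
  next
    case (der \<epsilon> q)
    have "tens p (der_act B g \<epsilon> q) =
      der_act (tensor_alg A B) (tensor_fun f g) (der_right \<epsilon>) (tens p q)"
      using der_act_right_tens[OF f g A.bs_module_loc_polys[OF f p] B.bs_module_loc_polys[OF g der.hyps(2)] der.hyps(1)]
      by simp
    then show ?case
      using bs_module.der[OF der_right_derivation[OF der.hyps(1)] der.IH] by metis
  qed (simp_all only: tens_simps bs_module.add bs_module.shift)
qed

text \<open>Since \<open>c \<otimes> d = (c \<otimes> 1) (1 \<otimes> d)\<close>, a derivation is
  determined by its values on the two factors.\<close>

lemma derivation_decomposition:
  assumes genA: "A = alg_gen U G" "finite G" and genB: "B = alg_gen V H" "finite H"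
    and \<Delta>: "\<Delta> \<in> derivations (tensor_alg A B)"
  obtains n m :: nat and \<delta> b \<epsilon> a where
    "\<And>j. \<delta> j \<in> derivations A" "\<And>j. b j \<in> B" "\<And>j. \<epsilon> j \<in> derivations B" "\<And>j. a j \<in> A"
    "\<And>t. t \<in> tensor_alg A B \<Longrightarrow> \<Delta> t = (\<Sum>j<n. tensor_fun (cst U 1) (b j) * der_left (\<delta> j) t)
      + (\<Sum>j<m. tensor_fun (a j) (cst V 1) * der_right (\<epsilon> j) t)"
proof -
  obtain n :: nat and \<delta> b where \<delta>: "\<And>j. \<delta> j \<in> derivations A" and b: "\<And>j. b j \<in> B"
    and left: "\<And>a. a \<in> A \<Longrightarrow> \<Delta> (tensor_fun a (cst V 1)) = (\<Sum>j<n. tensor_fun (\<delta> j a) (b j))"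
    using derivation_on_left_factor[OF genA \<Delta>] by metis
  obtain m :: nat and \<epsilon> a where \<epsilon>: "\<And>j. \<epsilon> j \<in> derivations B" and a: "\<And>j. a j \<in> A"
    and right: "\<And>b. b \<in> B \<Longrightarrow> \<Delta> (tensor_fun (cst U 1) b) = (\<Sum>j<m. tensor_fun (a j) (\<epsilon> j b))"
    using derivation_on_right_factor[OF genB \<Delta>] by metis
  have base: "\<Delta> (tensor_fun c d) = (\<Sum>j<n. tensor_fun (cst U 1) (b j) * der_left (\<delta> j) (tensor_fun c d))
    + (\<Sum>j<m. tensor_fun (a j) (cst V 1) * der_right (\<epsilon> j) (tensor_fun c d))" if c: "c \<in> A" and d: "d \<in> B" for c d
  proof -
    have "tensor_fun c d = tensor_fun c (cst V 1) * tensor_fun (cst U 1) d"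
      using A.unit_mult[OF c] B.unit_mult[OF d] by (simp only: tensor_fun_mult mult.commute)
    then have "\<Delta> (tensor_fun c d) = tensor_fun c (cst V 1) * \<Delta> (tensor_fun (cst U 1) d)
      + \<Delta> (tensor_fun c (cst V 1)) * tensor_fun (cst U 1) d"
      using T.der_mult[OF \<Delta>] c d by (simp only: tensor_fun_in_tensor_alg A.cst_closed B.cst_closed)
    also have "\<dots> = (\<Sum>j<m. tensor_fun (c * a j) (cst V 1 * \<epsilon> j d)) + (\<Sum>j<n. tensor_fun (\<delta> j c * cst U 1) (b j * d))"
      by (simp only: left[OF c] right[OF d] sum_distrib_left sum_distrib_right tensor_fun_mult)
    also have "\<dots> = (\<Sum>j<n. tensor_fun (cst U 1 * \<delta> j c) (b j * d)) + (\<Sum>j<m. tensor_fun (a j * c) (cst V 1 * \<epsilon> j d))"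
      by (simp only: mult.commute add.commute)
    finally show ?thesis
      by (simp only: der_left_tensor_fun[OF \<delta> c d] der_right_tensor_fun[OF \<epsilon> c d] tensor_fun_mult)
  qed
  have "\<Delta> t = (\<Sum>j<n. tensor_fun (cst U 1) (b j) * der_left (\<delta> j) t)
    + (\<Sum>j<m. tensor_fun (a j) (cst V 1) * der_right (\<epsilon> j) t)" if "t \<in> tensor_alg A B" for t
    using that
  proof (induction t rule: tensor_alg_induct)
    case zero
    have "der_left (\<delta> j) 0 = 0" "der_right (\<epsilon> j) 0 = 0" for j
      using T.der_zero der_left_derivation[OF \<delta>] der_right_derivation[OF \<epsilon>] by blast+
    then show ?case
      by (simp only: T.der_zero[OF \<Delta>] mult_zero_right sum.neutral_const add_0_right)
  next
    case (add t c d)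
    note in_T = add.hyps(1) tensor_fun_in_tensor_alg[OF add.hyps(2,3)]
    show ?case
      unfolding T.der_add[OF \<Delta> in_T] T.der_add[OF der_left_derivation[OF \<delta>] in_T]
        T.der_add[OF der_right_derivation[OF \<epsilon>] in_T] ring_distribs sum.distrib
      by (subst add.IH, subst base[OF add.hyps(2,3)]) (simp only: add_ac)
  qed
  then show ?thesis
    using that \<delta> b \<epsilon> a by blast
qed

text \<open>It suffices that the span contains the generator and is stable under \<open>s\<close>,
  under functions and under derivations of the product; for the latter,
  \<open>derivation_decomposition\<close> leads back to derivations of the factors.\<close>

lemma bs_module_tensor_subset:
  assumes genA: "A = alg_gen U G" "finite G" and genB: "B = alg_gen V H" "finite H"
    and f: "f \<in> A" and g: "g \<in> B"
    and r: "r \<in> bs_module (tensor_alg A B) (tensor_fun f g)"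
  shows "r \<in> tens_span (bs_module A f) (bs_module B g)"
proof -
  let ?S = "tens_span (bs_module A f) (bs_module B g)"
  have fg: "tensor_fun f g \<in> tensor_alg A B"
    using f g by (rule tensor_fun_in_tensor_alg)
  have zero: "0 \<in> ?S"
    using tens_span_zero bs_module.gen by metis
  have smult_S: "smult (tensor_fun a b) s \<in> ?S" if "s \<in> ?S" "a \<in> A" "b \<in> B" for s a b
    using that(1)
  proof (induction s rule: tens_span_induct)
    case (add s p q)
    then show ?case
      unfolding smult_add_right tens_simps(7) using that(2,3)
      by (intro tens_span_add_tens bs_module.smult)
  qed (simp only: smult_0_right zero)
  have loc: "s \<in> loc_polys (tensor_alg A B) (tensor_fun f g)" if "s \<in> ?S" for s
    using that
  proof (induction s rule: tens_span_induct)
    case (add s p q)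
    then show ?case
      by (intro T.loc_polys_add[OF fg] loc_polys_tens[OF f g] A.bs_module_loc_polys[OF f] B.bs_module_loc_polys[OF g])
  qed (rule T.loc_polys_0[OF fg])
  have left: "der_act (tensor_alg A B) (tensor_fun f g) (der_left \<delta>) s \<in> ?S"
    if "s \<in> ?S" and \<delta>: "\<delta> \<in> derivations A" for s \<delta>
    using that(1)
  proof (induction s rule: tens_span_induct)
    case zero
    then show ?case
      by (simp only: T.der_act_0[OF fg der_left_derivation[OF \<delta>]] \<open>0 \<in> ?S\<close>)
  next
    case (add s p q)
    have p: "p \<in> loc_polys A f" and q: "q \<in> loc_polys B g"
      using add.hyps A.bs_module_loc_polys[OF f] B.bs_module_loc_polys[OF g] by auto
    show ?case
      unfolding T.der_act_add[OF fg der_left_derivation[OF \<delta>] loc[OF add.hyps(1)] loc_polys_tens[OF f g p q]]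
        der_act_left_tens[OF f g p q \<delta>]
      using add \<delta> by (intro tens_span_add_tens bs_module.der)
  qed
  have right: "der_act (tensor_alg A B) (tensor_fun f g) (der_right \<epsilon>) s \<in> ?S"
    if "s \<in> ?S" and \<epsilon>: "\<epsilon> \<in> derivations B" for s \<epsilon>
    using that(1)
  proof (induction s rule: tens_span_induct)
    case zero
    then show ?case
      by (simp only: T.der_act_0[OF fg der_right_derivation[OF \<epsilon>]] \<open>0 \<in> ?S\<close>)
  next
    case (add s p q)
    have p: "p \<in> loc_polys A f" and q: "q \<in> loc_polys B g"
      using add.hyps A.bs_module_loc_polys[OF f] B.bs_module_loc_polys[OF g] by auto
    show ?case
      unfolding T.der_act_add[OF fg der_right_derivation[OF \<epsilon>] loc[OF add.hyps(1)] loc_polys_tens[OF f g p q]]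
        der_act_right_tens[OF f g p q \<epsilon>]
      using add \<epsilon> by (intro tens_span_add_tens bs_module.der)
  qed
  have sum_S: "(\<Sum>j\<in>J. s j) \<in> ?S" if "\<And>j. j \<in> J \<Longrightarrow> s j \<in> ?S" for s and J :: "nat set"
    using that by (induction J rule: infinite_finite_induct) (auto intro: zero tens_span_add)
  show ?thesis
    using r
  proof (induction rule: bs_module.induct)
    case gen
    have "tens [:f:] [:g:] = [:tensor_fun f g:]"
      by (rule tens_eqI) simp
    then show ?case
      using tens_in_tens_span[OF bs_module.gen bs_module.gen] by metis
  next
    case (add p q)
    then show ?case
      by (intro tens_span_add)
  next
    case (shift s)
    from shift.IH show ?case
    proof (induction s rule: tens_span_induct)
      case (add s p q)
      then show ?case
        unfolding ring_distribs tens_simps(3)[symmetric]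
        by (intro tens_span_add_tens bs_module.shift)
    qed (simp only: mult_zero_right zero)
  next
    case (smult t s)
    from smult.hyps(1) show ?case
    proof (induction t rule: tensor_alg_induct)
      case (add t a b)
      then show ?case
        unfolding smult_add_left by (intro tens_span_add smult_S smult.IH)
    qed (simp only: smult_0_left zero)
  next
    case (der \<Delta> s)
    obtain n m :: nat and \<delta> b \<epsilon> a where
      \<delta>: "\<And>j. \<delta> j \<in> derivations A" "\<And>j. b j \<in> B" and \<epsilon>: "\<And>j. \<epsilon> j \<in> derivations B" "\<And>j. a j \<in> A"
      and \<Delta>: "\<And>t. t \<in> tensor_alg A B \<Longrightarrow> \<Delta> t = (\<Sum>j<n. tensor_fun (cst U 1) (b j) * der_left (\<delta> j) t)
        + (\<Sum>j<m. tensor_fun (a j) (cst V 1) * der_right (\<epsilon> j) t)"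
      by (rule derivation_decomposition[OF genA genB der.hyps(1)]) (rule that; assumption)
    \<comment> \<open>One index set for the derivations from both factors, as
      \<open>der_act_combination\<close> expects.\<close>
    define J :: "(nat + nat) set" where "J = {..<n} <+> {..<m}"
    define c where "c = case_sum (\<lambda>j. tensor_fun (cst U 1) (b j)) (\<lambda>j. tensor_fun (a j) (cst V 1))"
    define d where "d = case_sum (\<lambda>j. der_left (\<delta> j)) (\<lambda>j. der_right (\<epsilon> j))"
    have "der_act (tensor_alg A B) (tensor_fun f g) \<Delta> s =
      (\<Sum>j\<in>J. smult (c j) (der_act (tensor_alg A B) (tensor_fun f g) (d j) s))"
    proof (rule T.der_act_combination[OF fg der.hyps(1) _ _ loc[OF der.IH]])
      show "d j \<in> derivations (tensor_alg A B)" for j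
        using der_left_derivation[OF \<delta>(1)] der_right_derivation[OF \<epsilon>(1)] by (cases j) (simp_all add: d_def)
      show "\<Delta> t = (\<Sum>j\<in>J. c j * d j t)" if "t \<in> tensor_alg A B" for t
        unfolding \<Delta>[OF that] by (simp add: J_def sum.Plus c_def d_def del: times_fun_apply plus_fun_apply)
    qed
    also have "\<dots> = (\<Sum>j<n. smult (tensor_fun (cst U 1) (b j)) (der_act (tensor_alg A B) (tensor_fun f g) (der_left (\<delta> j)) s))
      + (\<Sum>j<m. smult (tensor_fun (a j) (cst V 1)) (der_act (tensor_alg A B) (tensor_fun f g) (der_right (\<epsilon> j)) s))"
      by (simp add: J_def sum.Plus c_def d_def)
    also have "\<dots> \<in> ?S"
      using der.IH \<delta> \<epsilon> A.cst_closed B.cst_closed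
      by (intro tens_span_add sum_S smult_S left right)
    finally show ?case .
  qed
qed

end


section \<open>Multiplicativity for functions\<close>

text \<open>Submodules over \<complex>[s]. They are torsion-free, as
  \<open>constant_poly_cancel\<close> shows.\<close>

definition cs_module :: "('a \<Rightarrow> complex) poly set \<Rightarrow> bool" where
  "cs_module M \<longleftrightarrow> 0 \<in> M \<and> (\<forall>p\<in>M. \<forall>q\<in>M. p + q \<in> M) \<and> (\<forall>c. \<forall>p\<in>M. constant_poly c * p \<in> M)"

lemma cs_module_diff:
  assumes "cs_module M" "p \<in> M" "q \<in> M"
  shows "p - q \<in> M"
proof -
  have "p - q = p + constant_poly (- 1) * q"
    by (rule poly_fun_eqI) simp
  then show ?thesis
    using assms unfolding cs_module_def by metis
qed

lemma cs_module_sum: "cs_module M \<Longrightarrow> (\<And>i. i \<in> I \<Longrightarrow> p i \<in> M) \<Longrightarrow> (\<Sum>i\<in>I. p i) \<in> M"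
  by (induction I rule: infinite_finite_induct) (auto simp: cs_module_def)

lemma constant_poly_cancel:
  assumes "c \<noteq> 0" "constant_poly c * p = constant_poly c * q"
  shows "p = q"
proof (rule poly_fun_eqI)
  fix x
  show "ev x p = ev x q"
    using arg_cong[OF assms(2), of "ev x"] assms(1) by simp
qed

text \<open>Modulo \<open>s - \<alpha>\<close> the polynomial \<open>c\<close> is the nonzero
  constant \<open>c(\<alpha>)\<close>: with \<open>c = c(\<alpha>) + (s - \<alpha>) e\<close> one
  gets \<open>c(\<alpha>) x = (s - \<alpha>) (z - e x)\<close>.\<close>

lemma cs_module_divide:
  assumes M: "cs_module M" "x \<in> M" "z \<in> M" and c: "poly c \<alpha> \<noteq> 0"
    and eq: "constant_poly c * x = constant_poly [:- \<alpha>, 1:] * z"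
  shows "\<exists>m\<in>M. x = constant_poly [:- \<alpha>, 1:] * m"
proof -
  have "[:- \<alpha>, 1:] dvd c - [:poly c \<alpha>:]"
    by (simp add: dvd_iff_poly_eq_0)
  then obtain e where e: "c - [:poly c \<alpha>:] = [:- \<alpha>, 1:] * e"
    by (rule dvdE)
  define m where "m = constant_poly [:1 / poly c \<alpha>:] * (z - constant_poly e * x)"
  have "m \<in> M"
    using M by (simp add: m_def cs_module_diff cs_module_def)
  moreover have "x = constant_poly [:- \<alpha>, 1:] * m"
  proof (rule poly_fun_eqI)
    fix v
    have "[:- \<alpha>, 1:] * ev v z = c * ev v x"
      using arg_cong[OF eq, of "ev v"] by (simp del: mult_pCons_left)
    then have "[:- \<alpha>, 1:] * (ev v z - e * ev v x) = (c - [:- \<alpha>, 1:] * e) * ev v x"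
      by (simp only: ring_distribs mult.assoc)
    also have "\<dots> = smult (poly c \<alpha>) (ev v x)"
      unfolding e[symmetric] by simp
    finally have *: "[:- \<alpha>, 1:] * (ev v z - e * ev v x) = smult (poly c \<alpha>) (ev v x)" .
    have "ev v (constant_poly [:- \<alpha>, 1:] * m) =
      smult (1 / poly c \<alpha>) ([:- \<alpha>, 1:] * (ev v z - e * ev v x))"
      by (simp add: m_def del: mult_pCons_left add: mult_pCons_left[of "1 / poly c \<alpha>" 0]) 
    then show "ev v x = ev v (constant_poly [:- \<alpha>, 1:] * m)"
      unfolding * using c by simp
  qed
  ultimately show ?thesis
    by blast
qed

text \<open>
  Since \<open>M\<close> and \<open>N\<close> are torsion-free over \<open>\<complex>[s]\<close>, a simple tensor is divisible by \<open>s - \<alpha>\<close> in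
  \<open>M \<otimes> N\<close> only if one of its factors is, as \<open>M/(s - \<alpha>)M \<otimes>\<^bsub>\<complex>\<^esub> N/(s - \<alpha>)N\<close> has no zero divisors of this
  form. The induction eliminates the \<open>m i\<close> one after another, with relations between \<open>x\<close> and the
  \<open>m i\<close> obtained by evaluation of the second factor at a point.
\<close>

lemma tens_divide:
  assumes M: "cs_module M" and N: "cs_module N" and "finite I"
    and x: "x \<in> M" and "y \<in> N" and "\<And>i. i \<in> I \<Longrightarrow> m i \<in> M" and "\<And>i. i \<in> I \<Longrightarrow> n i \<in> N"
    and "tens x y = constant_poly [:- \<alpha>, 1:] * (\<Sum>i\<in>I. tens (m i) (n i))"
  shows "(\<exists>z\<in>M. x = constant_poly [:- \<alpha>, 1:] * z) \<or> (\<exists>z\<in>N. y = constant_poly [:- \<alpha>, 1:] * z)"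
  using assms(3,5-8)
proof (induction I arbitrary: y n rule: finite_psubset_induct)
  case (psubset I)
  define t where "t = [:- \<alpha>, 1:]"
  have t0: "t \<noteq> 0"
    by (simp add: t_def)
  note mI = psubset.prems(2) and nI = psubset.prems(3)
  have eq: "tens x y = constant_poly t * (\<Sum>i\<in>I. tens (m i) (n i))"
    using psubset.prems(4) by (simp only: t_def)
  have eq': "ev u x * ev v y = t * (\<Sum>i\<in>I. ev u (m i) * ev v (n i))" for u v
    using arg_cong[OF eq, of "ev (u, v)"] by simp
  show ?case
  proof (cases "y = 0")
    case True
    then show ?thesis
      using N by (intro disjI2 bexI[of _ 0]) (simp_all add: cs_module_def)
  next
    case False
    then obtain w where w: "ev w y \<noteq> 0"
      by (metis ev_0 poly_fun_eqI)
    \<comment> \<open>Relations that express a nonzero multiple \<open>c x\<close> by the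
      \<open>m i\<close>. Evaluation of the second factor at \<open>w\<close> gives one, and one
      with \<open>c\<close> of least degree is chosen.\<close>
    define rel where "rel = (\<lambda>(c, d). c \<noteq> 0 \<and> constant_poly c * x = (\<Sum>i\<in>I. constant_poly (d i) * m i))"
    have "rel (ev w y, \<lambda>i. t * ev w (n i))"
      unfolding rel_def using w
      by (auto intro!: poly_fun_eqI simp: eq' sum_distrib_left mult_ac simp del: mult_pCons_left)
    then obtain c d where cd: "rel (c, d)" and min: "\<And>c' d'. rel (c', d') \<Longrightarrow> degree c \<le> degree c'"
      using ex_has_least_nat[of rel "(ev w y, \<lambda>i. t * ev w (n i))" "\<lambda>(c, d). degree c"]
      by (auto simp: split_paired_all)
    then have c0: "c \<noteq> 0" and rel: "constant_poly c * x = (\<Sum>i\<in>I. constant_poly (d i) * m i)"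
      by (simp_all add: rel_def)
    have rel': "c * ev u x = (\<Sum>i\<in>I. d i * ev u (m i))" for u
      using arg_cong[OF rel, of "ev u"] by simp
    have root: "t dvd p \<longleftrightarrow> poly p \<alpha> = 0" for p
      by (simp add: t_def dvd_iff_poly_eq_0)
    \<comment> \<open>Either some \<open>d k\<close> is invertible modulo
      \<open>s - \<alpha>\<close> and \<open>m k\<close> can be eliminated, or
      \<open>s - \<alpha>\<close> divides all \<open>d i\<close> and, by minimality, not
      \<open>c\<close>.\<close>
    show ?thesis
    proof (cases "\<exists>k\<in>I. poly (d k) \<alpha> \<noteq> 0")
      case True
      then obtain k where k: "k \<in> I" "poly (d k) \<alpha> \<noteq> 0"
        by blast
      \<comment> \<open>The given equation is multiplied by \<open>d k\<close>, and
        \<open>d k m k\<close> is replaced by means of the relation. The term with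
        \<open>c x\<close> moves to the left side, the others join the remaining
        \<open>m i\<close>.\<close>
      define y' where "y' = constant_poly (d k) * y - constant_poly (t * c) * n k"
      define n' where "n' i = constant_poly (d k) * n i - constant_poly (d i) * n k" for i
      have y'N: "y' \<in> N" and n'N: "\<And>i. i \<in> I \<Longrightarrow> n' i \<in> N"
        using N psubset.prems(1) nI k(1) by (auto simp: y'_def n'_def cs_module_def intro!: cs_module_diff[OF N])
      have "tens x y' = constant_poly [:- \<alpha>, 1:] * (\<Sum>i\<in>I - {k}. tens (m i) (n' i))"
      proof (rule tens_eqI)
        fix u v
        let ?S = "\<lambda>F. \<Sum>i\<in>I - {k}. F i :: complex poly"
        have split: "(\<Sum>i\<in>I. F i) = F k + ?S F" for F
          using psubset.hyps k(1) by (rule sum.remove)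
        have "ev (u, v) (tens x y') = d k * (ev u x * ev v y) - t * (c * ev u x) * ev v (n k)"
          by (simp add: y'_def algebra_simps)
        also have "\<dots> = t * (d k * (ev u (m k) * ev v (n k) + ?S (\<lambda>i. ev u (m i) * ev v (n i)))
          - (d k * ev u (m k) + ?S (\<lambda>i. d i * ev u (m i))) * ev v (n k))"
          unfolding eq' rel' split by (simp only: algebra_simps)
        also have "\<dots> = t * ?S (\<lambda>i. ev u (m i) * ev v (n' i))"
          by (simp add: n'_def algebra_simps sum_distrib_left sum_distrib_right sum_subtractf)
        finally show "ev (u, v) (tens x y') =
          ev (u, v) (constant_poly [:- \<alpha>, 1:] * (\<Sum>i\<in>I - {k}. tens (m i) (n' i)))"
          by (simp add: t_def del: mult_pCons_left)
      qed
      moreover have "I - {k} \<subset> I"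
        using k(1) by blast
      ultimately consider z where "z \<in> M" "x = constant_poly [:- \<alpha>, 1:] * z"
        | z where "z \<in> N" "y' = constant_poly [:- \<alpha>, 1:] * z"
        using psubset.IH[of "I - {k}" y' n'] y'N n'N mI by blast
      then show ?thesis
      proof cases
        case 2
        have "constant_poly (d k) * y = constant_poly [:- \<alpha>, 1:] * (z + constant_poly c * n k)"
        proof (rule poly_fun_eqI)
          fix v
          have "d k * ev v y - t * c * ev v (n k) = t * ev v z"
            using arg_cong[OF 2(2), of "ev v"] by (simp add: y'_def t_def del: mult_pCons_left)
          then show "ev v (constant_poly (d k) * y) = ev v (constant_poly [:- \<alpha>, 1:] * (z + constant_poly c * n k))"
            by (simp add: t_def[symmetric] algebra_simps del: mult_pCons_left)
        qed
        moreover have "z + constant_poly c * n k \<in> N"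
          using N 2(1) nI[OF k(1)] by (simp add: cs_module_def)
        ultimately show ?thesis
          using cs_module_divide[OF N psubset.prems(1) _ k(2)] by blast
      qed blast
    next
      case False
      then have "\<forall>i\<in>I. \<exists>e. d i = t * e"
        using root unfolding dvd_def by blast
      then obtain e where e: "\<And>i. i \<in> I \<Longrightarrow> d i = t * e i"
        by metis
      have rel_e: "constant_poly c * x = constant_poly t * (\<Sum>i\<in>I. constant_poly (e i) * m i)"
        unfolding rel sum_distrib_left
        by (intro sum.cong refl) (simp only: e constant_poly_simps mult.assoc)
      \<comment> \<open>A common factor \<open>s - \<alpha>\<close> could be cancelled from the
        relation, and \<open>c\<close> would not have least degree.\<close>
      have "poly c \<alpha> \<noteq> 0"
      proof
        assume "poly c \<alpha> = 0"
        then obtain c' where c': "c = t * c'"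
          using root unfolding dvd_def by blast
        then have "constant_poly t * (constant_poly c' * x) = constant_poly t * (\<Sum>i\<in>I. constant_poly (e i) * m i)"
          using rel_e by (simp only: constant_poly_simps mult.assoc)
        then have "constant_poly c' * x = (\<Sum>i\<in>I. constant_poly (e i) * m i)"
          by (rule constant_poly_cancel[OF t0])
        moreover have "c' \<noteq> 0"
          using c' c0 by auto
        ultimately have "degree c \<le> degree c'"
          by (intro min[of c' e]) (simp add: rel_def)
        moreover have "degree c = Suc (degree c')"
          using \<open>c' \<noteq> 0\<close> t0 unfolding c' by (subst degree_mult_eq) (auto simp: t_def)
        ultimately show False
          by simp
      qed
      moreover have "(\<Sum>i\<in>I. constant_poly (e i) * m i) \<in> M"
        using M mI by (intro cs_module_sum) (auto simp: cs_module_def)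
      ultimately show ?thesis
        using cs_module_divide[OF M x _ _ rel_e[unfolded t_def]] by blast
    qed
  qed
qed

lemma (in function_algebra) cs_module_bs_module: "f \<in> A \<Longrightarrow> cs_module (bs_module A f)"
  by (simp add: cs_module_def bs_module_0 bs_module.add bs_module_constant_poly)

text \<open>At every point where \<open>f\<close> is nonzero, \<open>t\<close> can be cancelled in
  \<complex>[s]. So the values of \<open>m\<close> at these points coincide, and \<open>m\<close> is
  itself of the form \<open>c(s) f\<^sup>s\<close>.\<close>

lemma (in function_algebra) bs_vec_divide:
  assumes f: "f \<in> A" "f \<noteq> 0" and m: "m \<in> bs_module A f"
    and t: "t \<noteq> 0" "bs_vec f b = constant_poly t * m"
  shows "\<exists>c\<in>bs_ideal A f. b = t * c"
proof -
  obtain x where x: "f x \<noteq> 0"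
    using f(2) by (auto simp: fun_eq_iff)
  have b: "b = t * ev u m" if "f u \<noteq> 0" for u
    using arg_cong[OF t(2), of "ev u"] that by (simp add: ev_bs_vec)
  have "bs_vec f (ev x m) = m"
  proof (rule poly_fun_eqI)
    fix u
    show "ev u (bs_vec f (ev x m)) = ev u m"
    proof (cases "f u = 0")
      case True
      then show ?thesis
        using loc_polys_outside[OF f(1) bs_module_loc_polys[OF f(1) m]] by (simp add: ev_bs_vec)
    next
      case False
      then have "t * ev x m = t * ev u m"
        using b[OF x] b[OF False] by metis
      then have "ev x m = ev u m"
        using t(1) by (simp only: mult_cancel_left simp_thms)
      then show ?thesis
        using False by (simp add: ev_bs_vec)
    qed
  qed
  then show ?thesis
    using b[OF x] m bs_ideal_iff[OF f(1)] by metis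
qed

context tensor_algebras
begin

text \<open>Evaluation of the second factor at a point with \<open>g \<noteq> 0\<close> turns a sum
  of tensors into a \<complex>[s]-linear combination of elements of the first module. This settles
  the case of a zero ideal in \<open>bs_poly_tensor_dvd_iff\<close>.\<close>

lemma bs_ideal_tensor_imp:
  assumes genA: "A = alg_gen U G" "finite G" and genB: "B = alg_gen V H" "finite H"
    and f: "f \<in> A" "f \<noteq> 0" and g: "g \<in> B" "g \<noteq> 0"
    and c: "c \<in> bs_ideal (tensor_alg A B) (tensor_fun f g)"
  shows "c \<in> bs_ideal A f" "c \<in> bs_ideal B g"
proof -
  have fg: "tensor_fun f g \<in> tensor_alg A B"
    using f g by (intro tensor_fun_in_tensor_alg)
  obtain n :: nat and p q where eq: "bs_vec (tensor_fun f g) c = (\<Sum>i<n. tens (p i) (q i))"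
    and p: "\<And>i. p i \<in> bs_module A f" and q: "\<And>i. q i \<in> bs_module B g"
    using c bs_module_tensor_subset[OF genA genB f(1) g(1)] unfolding T.bs_ideal_iff[OF fg] tens_span_def by blast
  have eq': "(if f x * g y = 0 then 0 else c) = (\<Sum>i<n. ev x (p i) * ev y (q i))" for x y
    using arg_cong[OF eq, of "ev (x, y)"] by (simp add: ev_bs_vec)
  obtain x0 y0 where 0: "f x0 \<noteq> 0" "g y0 \<noteq> 0"
    using f g by (auto simp: fun_eq_iff)
  have "bs_vec f c = (\<Sum>i<n. constant_poly (ev y0 (q i)) * p i)"
    using eq'[of _ y0] 0 by (intro poly_fun_eqI) (simp add: ev_bs_vec mult.commute)
  then show "c \<in> bs_ideal A f"
    using p f by (simp add: A.bs_ideal_iff A.bs_module_sum A.bs_module_constant_poly)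
  have "bs_vec g c = (\<Sum>i<n. constant_poly (ev x0 (p i)) * q i)"
    using eq'[of x0] 0 by (intro poly_fun_eqI) (simp add: ev_bs_vec)
  then show "c \<in> bs_ideal B g"
    using q g by (simp add: B.bs_ideal_iff B.bs_module_sum B.bs_module_constant_poly)
qed

lemma bs_ideal_tensor_mult:
  assumes f: "f \<in> A" and g: "g \<in> B" and b: "b \<in> bs_ideal A f" and c: "c \<in> bs_ideal B g"
  shows "b * c \<in> bs_ideal (tensor_alg A B) (tensor_fun f g)"
proof -
  have "tens (bs_vec f b) (bs_vec g c) = bs_vec (tensor_fun f g) (b * c)"
    by (rule tens_eqI) (simp add: ev_bs_vec)
  then show ?thesis
    using tens_in_bs_module[OF f g, of "bs_vec f b" "bs_vec g c"] b c f g
    by (simp add: A.bs_ideal_iff B.bs_ideal_iff T.bs_ideal_iff tensor_fun_in_tensor_alg)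
qed

theorem bs_poly_tensor_dvd_iff:
  assumes genA: "A = alg_gen U G" "finite G" and genB: "B = alg_gen V H" "finite H"
    and f: "f \<in> A" "f \<noteq> 0" and g: "g \<in> B" "g \<noteq> 0"
  shows "bs_poly A f * bs_poly B g dvd c \<longleftrightarrow> c \<in> bs_ideal (tensor_alg A B) (tensor_fun f g)"
proof
  have fg: "tensor_fun f g \<in> tensor_alg A B"
    using f g by (intro tensor_fun_in_tensor_alg)
  define b1 b2 where "b1 = bs_poly A f" and "b2 = bs_poly B g"
  have b1: "b1 \<in> bs_ideal A f" and b2: "b2 \<in> bs_ideal B g"
    by (simp_all add: b1_def b2_def f g flip: A.bs_poly_dvd_iff B.bs_poly_dvd_iff)
  have b12: "b1 * b2 \<in> bs_ideal (tensor_alg A B) (tensor_fun f g)"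
    using bs_ideal_tensor_mult[OF f(1) g(1) b1 b2] .
  show "c \<in> bs_ideal (tensor_alg A B) (tensor_fun f g)" if "bs_poly A f * bs_poly B g dvd c"
    using that T.bs_ideal_mult[OF fg b12] unfolding b1_def b2_def by (auto simp: dvd_def mult.commute)
  assume c: "c \<in> bs_ideal (tensor_alg A B) (tensor_fun f g)"
  then have dvd: "b1 dvd c" "b2 dvd c"
    using bs_ideal_tensor_imp[OF genA genB f g] f g
    by (simp_all add: b1_def b2_def A.bs_poly_dvd_iff B.bs_poly_dvd_iff)
  define d where "d = bs_poly (tensor_alg A B) (tensor_fun f g)"
  have "d dvd c" "d dvd b1 * b2"
    using c b12 by (simp_all add: d_def T.bs_poly_dvd_iff[OF fg])
  have d: "d \<in> bs_ideal (tensor_alg A B) (tensor_fun f g)"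
    unfolding d_def T.bs_poly_dvd_iff[OF fg, symmetric] by simp
  show "bs_poly A f * bs_poly B g dvd c"
  proof (cases "b1 * b2 = 0")
    case True
    then have "c = 0"
      using dvd by auto
    then show ?thesis
      by simp
  next
    case False
    obtain e where e: "b1 * b2 = d * e"
      using \<open>d dvd b1 * b2\<close> by (rule dvdE)
    have "degree e = 0"
    proof (rule ccontr)
      assume "degree e \<noteq> 0"
      then have "\<not> constant (poly e)"
        by (simp add: constant_degree)
      then obtain \<alpha> where "poly e \<alpha> = 0"
        using fundamental_theorem_of_algebra by blast
      then obtain e' where e': "e = [:- \<alpha>, 1:] * e'"
        by (auto simp: poly_eq_0_iff_dvd elim: dvdE)
      \<comment> \<open>\<open>b1 * b2\<close> without the factor \<open>s - \<alpha>\<close> is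
        still a multiple of \<open>d\<close>. Hence the tensor of \<open>b1\<close> and
        \<open>b2\<close> is divisible in the span, and \<open>tens_divide\<close> applies.\<close>
      have "d * e' \<in> bs_ideal (tensor_alg A B) (tensor_fun f g)"
        using T.bs_ideal_mult[OF fg d, of e'] by (simp add: mult.commute)
      then obtain n :: nat and p q where eq: "bs_vec (tensor_fun f g) (d * e') = (\<Sum>i<n. tens (p i) (q i))"
        and p: "\<And>i. p i \<in> bs_module A f" and q: "\<And>i. q i \<in> bs_module B g"
        using bs_module_tensor_subset[OF genA genB f(1) g(1)] unfolding T.bs_ideal_iff[OF fg] tens_span_def by blast
      have "tens (bs_vec f b1) (bs_vec g b2) = constant_poly [:- \<alpha>, 1:] * bs_vec (tensor_fun f g) (d * e')"
        using e unfolding e' by (intro tens_eqI) (simp add: ev_bs_vec mult_ac del: mult_pCons_left mult_pCons_right)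
      then have "(\<exists>z\<in>bs_module A f. bs_vec f b1 = constant_poly [:- \<alpha>, 1:] * z) \<or>
        (\<exists>z\<in>bs_module B g. bs_vec g b2 = constant_poly [:- \<alpha>, 1:] * z)"
        unfolding eq using b1 b2 f g p q
        by (intro tens_divide[OF A.cs_module_bs_module B.cs_module_bs_module, where m = p and n = q and I = "{..<n}"])
          (auto simp: A.bs_ideal_iff B.bs_ideal_iff)
      then consider z where "z \<in> bs_ideal A f" "b1 = [:- \<alpha>, 1:] * z" | z where "z \<in> bs_ideal B g" "b2 = [:- \<alpha>, 1:] * z"
        using A.bs_vec_divide[OF f, of _ "[:- \<alpha>, 1:]" b1] B.bs_vec_divide[OF g, of _ "[:- \<alpha>, 1:]" b2]
        by (metis one_neq_zero pCons_eq_0_iff)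
      then show False
      proof cases
        case 1
        have "b1 dvd z"
          unfolding b1_def A.bs_poly_dvd_iff[OF f(1)] by (rule 1(1))
        moreover have "z \<noteq> 0"
          using 1(2) False by auto
        ultimately have "degree ([:- \<alpha>, 1:] * z) \<le> degree z"
          using 1(2) dvd_imp_degree_le by metis
        moreover have "degree ([:- \<alpha>, 1:] * z) = Suc (degree z)"
          using \<open>z \<noteq> 0\<close> by (subst degree_mult_eq) auto
        ultimately show False
          by simp
      next
        case 2
        have "b2 dvd z"
          unfolding b2_def B.bs_poly_dvd_iff[OF g(1)] by (rule 2(1))
        moreover have "z \<noteq> 0"
          using 2(2) False by auto
        ultimately have "degree ([:- \<alpha>, 1:] * z) \<le> degree z"
          using 2(2) dvd_imp_degree_le by metis
        moreover have "degree ([:- \<alpha>, 1:] * z) = Suc (degree z)"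
          using \<open>z \<noteq> 0\<close> by (subst degree_mult_eq) auto
        ultimately show False
          by simp
      qed
    qed
    then have "is_unit e"
      using False e by (auto simp: is_unit_iff_degree)
    then have "b1 * b2 dvd d"
      unfolding e by simp
    then show ?thesis
      using \<open>d dvd c\<close> unfolding b1_def b2_def by (rule dvd_trans)
  qed
qed

end


section \<open>Weak Nullstellensatz\<close>

definition function_ideal :: "('a \<Rightarrow> complex) set \<Rightarrow> ('a \<Rightarrow> complex) set \<Rightarrow> bool" where
  "function_ideal A J \<longleftrightarrow> J \<subseteq> A \<and> 0 \<in> J \<and> (\<forall>h\<in>J. \<forall>k\<in>J. h + k \<in> J) \<and> (\<forall>a\<in>A. \<forall>h\<in>J. a * h \<in> J)"

lemma function_idealD:
  assumes "function_ideal A J"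
  shows "h \<in> J \<Longrightarrow> h \<in> A" "0 \<in> J" "h \<in> J \<Longrightarrow> k \<in> J \<Longrightarrow> h + k \<in> J" "a \<in> A \<Longrightarrow> h \<in> J \<Longrightarrow> a * h \<in> J"
  using assms by (auto simp: function_ideal_def simp del: plus_fun_apply times_fun_apply zero_fun_apply)

lemma (in function_algebra) function_ideal_scale:
  assumes "function_ideal A J" "h \<in> J"
  shows "(\<lambda>x. c * h x) \<in> J"
proof -
  have "(\<lambda>x. c * h x) = cst U c * h"
    using vanishes[OF function_idealD(1)[OF assms]] by (auto simp: cst_apply)
  then show ?thesis
    using function_idealD(4)[OF assms(1) cst_closed assms(2)] by metis
qed

lemma (in function_algebra) function_ideal_diff:
  assumes "function_ideal A J" "h \<in> J" "k \<in> J"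
  shows "h - k \<in> J"
proof -
  have "h - k = h + (\<lambda>x. - 1 * k x)"
    by auto
  then show ?thesis
    using function_idealD(3)[OF assms(1,2) function_ideal_scale[OF assms(1,3)]] by metis
qed

lemma (in function_algebra) function_ideal_sum:
  "function_ideal A J \<Longrightarrow> (\<And>i. i \<in> I \<Longrightarrow> h i \<in> J) \<Longrightarrow> (\<Sum>i\<in>I. h i) \<in> J"
  by (induction I rule: infinite_finite_induct) (auto intro: function_idealD(2,3) simp del: plus_fun_apply zero_fun_apply)

section \<open>Residue fields of maximal ideals\<close>

locale maximal_function_ideal = function_algebra U A for U :: "'a set" and A +
  fixes M
  assumes ideal: "function_ideal A M" and proper: "cst U 1 \<notin> M"
    and maximal: "\<And>J. function_ideal A J \<Longrightarrow> M \<subseteq> J \<Longrightarrow> cst U 1 \<notin> J \<Longrightarrow> J = M"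
begin

lemma inverse_mod:
  assumes a: "a \<in> A" "a \<notin> M"
  obtains u where "u \<in> A" "a * u - cst U 1 \<in> M"
proof -
  define J where "J = {m + a * u | m u. m \<in> M \<and> u \<in> A}"
  have J: "function_ideal A J"
    unfolding function_ideal_def
  proof (intro conjI ballI subsetI)
    show "h \<in> A" if "h \<in> J" for h
      using that a(1) function_idealD(1)[OF ideal] unfolding J_def
      by (auto simp del: plus_fun_apply times_fun_apply intro: add_closed mult_closed)
    have "0 = 0 + a * 0"
      by simp
    then show "0 \<in> J"
      unfolding J_def using function_idealD(2)[OF ideal] zero_closed by blast
  next
    fix h k assume "h \<in> J" "k \<in> J"
    then obtain m u n v where h: "h = m + a * u" "m \<in> M" "u \<in> A" and k: "k = n + a * v" "n \<in> M" "v \<in> A"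
      unfolding J_def by blast
    have "h + k = (m + n) + a * (u + v)"
      unfolding h k by (simp only: algebra_simps)
    then show "h + k \<in> J"
      unfolding J_def using function_idealD(3)[OF ideal h(2) k(2)] add_closed[OF h(3) k(3)] by blast
  next
    fix b h assume b: "b \<in> A" and "h \<in> J"
    then obtain m u where h: "h = m + a * u" "m \<in> M" "u \<in> A"
      unfolding J_def by blast
    have "b * h = b * m + a * (b * u)"
      unfolding h by (simp only: algebra_simps)
    then show "b * h \<in> J"
      unfolding J_def using function_idealD(4)[OF ideal b h(2)] mult_closed[OF b h(3)] by blast
  qed
  have "M \<subseteq> J"
  proof
    fix m assume "m \<in> M"
    moreover have "m = m + a * 0"
      by simp
    ultimately show "m \<in> J"
      unfolding J_def using zero_closed by blast
  qed
  moreover have "a = 0 + a * cst U 1"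
    using unit_mult[OF a(1)] by (simp add: mult.commute del: times_fun_apply)
  then have "a \<in> J"
    unfolding J_def using function_idealD(2)[OF ideal] cst_closed by blast
  ultimately have "cst U 1 \<in> J"
    using maximal[OF J] a(2) by blast
  then obtain m u where u: "cst U 1 = m + a * u" "m \<in> M" "u \<in> A"
    unfolding J_def by blast
  have "a * u - cst U 1 = 0 - m"
    unfolding u(1) by simp
  then show ?thesis
    using that[OF u(3)] function_ideal_diff[OF ideal function_idealD(2)[OF ideal] u(2)] by metis
qed

lemma prime_mod:
  assumes a: "a \<in> A" "a \<notin> M" and b: "b \<in> A" and ab: "a * b \<in> M"
  shows "b \<in> M"
proof -
  obtain u where u: "u \<in> A" "a * u - cst U 1 \<in> M"
    using inverse_mod[OF a] .
  have "b = u * (a * b) - b * (a * u - cst U 1)"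
    using unit_mult[OF b] by (simp add: algebra_simps del: times_fun_apply plus_fun_apply)
  then show ?thesis
    using function_ideal_diff[OF ideal function_idealD(4)[OF ideal u(1) ab] function_idealD(4)[OF ideal b u(2)]]
    by metis
qed

text \<open>Substitution of \<open>a\<close> into a polynomial, cut off outside \<open>U\<close> so
  that constants become \<open>cst U c\<close> and the result lies in \<open>A\<close>.\<close>

definition peval :: "('a \<Rightarrow> complex) \<Rightarrow> complex poly \<Rightarrow> 'a \<Rightarrow> complex" where
  "peval a r = res U (\<lambda>x. poly r (a x))"

lemma peval_simps:
  "peval a (p + q) = peval a p + peval a q" "peval a (p * q) = peval a p * peval a q"
  "peval a [:c:] = cst U c"
  by (auto simp: peval_def res_apply cst_apply)

lemma peval_linear: "a \<in> A \<Longrightarrow> peval a [:- c, 1:] = a - cst U c"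
  using vanishes by (auto simp: fun_eq_iff peval_def res_apply cst_apply)

lemma peval_closed: "a \<in> A \<Longrightarrow> peval a p \<in> A"
proof (induction p)
  case (pCons c p)
  have "peval a (pCons c p) = cst U c + a * peval a p"
    by (auto simp: fun_eq_iff peval_def res_apply cst_apply)
  then show ?case
    using pCons add_closed[OF cst_closed mult_closed] by metis
qed (use zero_closed in \<open>simp add: peval_def res_def zero_fun_def\<close>)

text \<open>Since \<complex> is algebraically closed and \<open>M\<close> is prime, an element that
  is algebraic modulo \<open>M\<close> is congruent to a constant.\<close>

lemma peval_nonzero:
  assumes a: "a \<in> A" "\<And>c. a - cst U c \<notin> M"
  shows "peval a p \<in> M \<Longrightarrow> p = 0"
proof (induction "degree p" arbitrary: p)
  case 0
  then obtain c where p: "p = [:c:]"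
    by (metis degree_eq_zeroE)
  show ?case
  proof (rule ccontr)
    assume "p \<noteq> 0"
    then have "c \<noteq> 0"
      by (simp add: p)
    then have "cst U 1 = (\<lambda>x. 1 / c * cst U c x)"
      by (auto simp: fun_eq_iff cst_apply)
    then show False
      using function_ideal_scale[OF ideal, of "cst U c" "1 / c"] "0.prems" proper by (metis p peval_simps(3))
  qed
next
  case (Suc n)
  then have "\<not> constant (poly p)"
    by (simp add: constant_degree)
  then obtain z where "poly p z = 0"
    using fundamental_theorem_of_algebra by blast
  then obtain q where q: "p = [:- z, 1:] * q"
    by (auto simp: poly_eq_0_iff_dvd elim: dvdE)
  have "q \<noteq> 0"
    using Suc.hyps(2) q by auto
  have "degree p = Suc (degree q)"
    unfolding q using \<open>q \<noteq> 0\<close> by (subst degree_mult_eq) auto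
  moreover have "(a - cst U z) * peval a q \<in> M"
    using Suc.prems unfolding q peval_simps peval_linear[OF a(1)] .
  then have "peval a q \<in> M"
    using prime_mod[OF diff_closed[OF a(1) cst_closed] a(2) peval_closed[OF a(1)]] by blast
  ultimately show ?case
    using Suc.hyps \<open>q \<noteq> 0\<close> by auto
qed

text \<open>
  If \<open>a\<close> is transcendental modulo \<open>M\<close>, the inverses \<open>u c\<close> of \<open>a - c\<close> are linearly independent modulo
  \<open>M\<close>. The extra term \<open>peval a p\<close> makes the induction by multiplication with \<open>a - c\<close> possible.
\<close>

lemma inverses_independent:
  assumes a: "a \<in> A" "\<And>c. a - cst U c \<notin> M"
    and u: "\<And>c. u c \<in> A" "\<And>c. (a - cst U c) * u c - cst U 1 \<in> M"
    and "finite F"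
    and "(\<Sum>c\<in>F. (\<lambda>x. l c * u c x)) + peval a p \<in> M"
  shows "\<forall>c\<in>F. l c = 0"
  using assms(5,6)
proof (induction F arbitrary: l p)
  case (insert e F)
  \<comment> \<open>Modulo \<open>M\<close>, multiplication by \<open>a - e\<close> takes
    \<open>u c\<close> to \<open>1 + (c - e) u c\<close>. The term for \<open>e\<close> reduces to
    its constant, and all the constants are collected in \<open>s\<close>.\<close>
  define s where "s = (\<Sum>c\<in>insert e F. l c)"
  define q where "q = [:s:] + p * [:- e, 1:]"
  define rest where "rest = (\<Sum>c\<in>insert e F. (\<lambda>x. l c * ((a - cst U c) * u c - cst U 1) x))"
  have eq: "(\<Sum>c\<in>F. (\<lambda>x. (l c * (c - e)) * u c x)) + peval a q =
    (a - cst U e) * ((\<Sum>c\<in>insert e F. (\<lambda>x. l c * u c x)) + peval a p) - rest"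
  proof
    fix x
    show "((\<Sum>c\<in>F. (\<lambda>x. (l c * (c - e)) * u c x)) + peval a q) x =
      ((a - cst U e) * ((\<Sum>c\<in>insert e F. (\<lambda>x. l c * u c x)) + peval a p) - rest) x"
    proof (cases "x \<in> U")
      case True
      have ring: "X + (t + p * b) = b * (Z + p) - W" if "X = Y" "Y + t = b * Z - W" for X Y Z W t p b :: complex
        using that by (simp add: algebra_simps)
      have "(\<Sum>c\<in>F. l c * (c - e) * u c x) = (\<Sum>c\<in>insert e F. l c * (c - e) * u c x)"
        using insert.hyps by simp
      moreover have "(\<Sum>c\<in>insert e F. l c * (c - e) * u c x) + s =
        (\<Sum>c\<in>insert e F. (a x - e) * (l c * u c x) - l c * ((a x - c) * u c x - 1))"
        unfolding s_def sum.distrib[symmetric] by (intro sum.cong refl) (simp only: algebra_simps mult_1_right mult_1_left)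
      ultimately have "(\<Sum>c\<in>F. l c * (c - e) * u c x) + (s + poly p (a x) * (a x - e)) =
        (a x - e) * ((\<Sum>c\<in>insert e F. l c * u c x) + poly p (a x)) -
        (\<Sum>c\<in>insert e F. l c * ((a x - c) * u c x - 1))"
        using ring by (simp only: sum_subtractf sum_distrib_left[symmetric])
      moreover have "poly q (a x) = s + poly p (a x) * (a x - e)"
        by (simp add: q_def algebra_simps)
      ultimately show ?thesis
        using True by (simp add: sum_fun_apply rest_def peval_def res_apply cst_apply del: sum.insert)
    next
      case False
      then show ?thesis
        using vanishes[OF u(1) False] vanishes[OF a(1) False]
        by (simp add: sum_fun_apply rest_def peval_def res_apply cst_apply)
    qed
  qed
  have "rest \<in> M"
    unfolding rest_def by (intro function_ideal_sum[OF ideal] function_ideal_scale[OF ideal] u)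
  moreover have "(a - cst U e) * ((\<Sum>c\<in>insert e F. (\<lambda>x. l c * u c x)) + peval a p) \<in> M"
    using insert.prems by (intro function_idealD(4)[OF ideal] diff_closed a cst_closed)
  ultimately have "(\<Sum>c\<in>F. (\<lambda>x. (l c * (c - e)) * u c x)) + peval a q \<in> M"
    unfolding eq by (intro function_ideal_diff[OF ideal])
  then have "\<forall>c\<in>F. l c * (c - e) = 0"
    by (rule insert.IH)
  then have F: "\<forall>c\<in>F. l c = 0"
    using insert.hyps by auto
  then have eq': "(\<Sum>c\<in>insert e F. (\<lambda>x. l c * u c x)) = (\<lambda>x. l e * u e x)"
    using insert.hyps by (auto simp: fun_eq_iff sum_fun_apply)
  have M1: "(\<lambda>x. l e * u e x) + peval a p \<in> M"
    using insert.prems unfolding eq' .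
  \<comment> \<open>The same multiplication, with only the term for \<open>e\<close> left. The
    polynomial must be 0 by \<open>peval_nonzero\<close>, and its value at \<open>e\<close> is
    \<open>l e\<close>.\<close>
  have "peval a ([:l e:] + p * [:- e, 1:]) = (a - cst U e) * ((\<lambda>x. l e * u e x) + peval a p)
      - (\<lambda>x. l e * ((a - cst U e) * u e - cst U 1) x)"
    using vanishes[OF u(1)] vanishes[OF a(1)]
    by (auto simp: fun_eq_iff peval_def res_apply cst_apply algebra_simps)
  also have "\<dots> \<in> M"
    by (intro function_ideal_diff[OF ideal] function_idealD(4)[OF ideal] function_ideal_scale[OF ideal]
        M1 u diff_closed a cst_closed)
  finally have "[:l e:] + p * [:- e, 1:] = 0"
    by (rule peval_nonzero[OF a])
  then have "poly ([:l e:] + p * [:- e, 1:]) e = 0"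
    by (simp only: poly_0)
  then show ?case
    using F by simp
qed simp

text \<open>
  The algebra \<open>A\<close> has a countable basis and the complex numbers are uncountable, so that the inverses
  \<open>u c\<close> above cannot be linearly independent.
\<close>

lemma residue_field:
  assumes gen: "A = alg_gen U G" "finite G" and a: "a \<in> A"
  shows "\<exists>c. a - cst U c \<in> M"
proof (rule ccontr)
  assume "\<nexists>c. a - cst U c \<in> M"
  then have nM: "a - cst U c \<notin> M" for c
    by blast
  have "\<exists>u. u \<in> A \<and> (a - cst U c) * u - cst U 1 \<in> M" for c
    using inverse_mod[OF diff_closed[OF a cst_closed] nM] by metis
  then obtain u where u: "\<And>c. u c \<in> A" "\<And>c. (a - cst U c) * u c - cst U 1 \<in> M"
    by metis
  note indep = inverses_independent[OF a nM u, where p = 0]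
  interpret V: vector_space "\<lambda>c (h :: 'a \<Rightarrow> complex) x. c * h x"
    by unfold_locales (auto simp: fun_eq_iff algebra_simps)
  define mon where "mon xs = foldr (*) xs (cst U 1)" for xs :: "('a \<Rightarrow> complex) list"
  \<comment> \<open>Products of at most \<open>n\<close> generators. Their spans are
    finite-dimensional and exhaust \<open>A\<close>, in place of a countable basis.\<close>
  define S where "S n = mon ` {xs. set xs \<subseteq> G \<and> length xs \<le> n}" for n
  have finS: "finite (S n)" for n
    unfolding S_def using finite_lists_length_le[OF gen(2)] by blast
  have monA: "mon xs \<in> A" if "set xs \<subseteq> G" for xs
    using that by (induction xs) (auto simp: mon_def cst_closed gen(1) alg_gen.gen alg_gen.cst
        simp del: times_fun_apply intro: alg_gen.mult)
  have mon_append: "mon (xs @ ys) = mon xs * mon ys" if "set ys \<subseteq> G" for xs ys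
  proof (induction xs)
    case Nil
    show ?case
      using unit_mult[OF monA[OF that]] by (simp add: mon_def del: times_fun_apply)
  qed (simp add: mon_def mult.assoc del: times_fun_apply)
  have S_mono: "V.span (S m) \<subseteq> V.span (S n)" if "m \<le> n" for m n
    unfolding S_def using that by (intro V.span_mono) force
  have S_mult: "h * k \<in> V.span (S (m + n))" if h: "h \<in> V.span (S m)" and k: "k \<in> V.span (S n)" for h k m n
  proof -
    have *: "s * k \<in> V.span (S (m + n))" if s: "s \<in> S m" for s
      using k
    proof (induction k rule: V.span_induct_alt)
      case base
      show ?case
        using V.span_zero by (simp only: mult_zero_right)
    next
      case (step c t k)
      obtain xs ys where xs: "s = mon xs" "set xs \<subseteq> G" "length xs \<le> m" and ys: "t = mon ys" "set ys \<subseteq> G" "length ys \<le> n"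
        using s step.hyps unfolding S_def by blast
      have "s * t = mon (xs @ ys)"
        by (simp only: xs ys mon_append)
      then have "s * t \<in> S (m + n)"
        unfolding S_def using xs ys by (intro image_eqI[of _ _ "xs @ ys"]) auto
      moreover have "s * ((\<lambda>x. c * t x) + k) = (\<lambda>x. c * (s * t) x) + s * k"
        by (auto simp: algebra_simps)
      ultimately show ?case
        using V.span_add[OF V.span_scale[OF V.span_base] step.IH] by metis
    qed
    show ?thesis
      using h
    proof (induction h rule: V.span_induct_alt)
      case base
      show ?case
        using V.span_zero by (simp only: mult_zero_left)
    next
      case (step c t h)
      moreover have "((\<lambda>x. c * t x) + h) * k = (\<lambda>x. c * (t * k) x) + h * k"
        by (auto simp: algebra_simps)
      ultimately show ?case
        using V.span_add[OF V.span_scale[OF *] step.IH] by metis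
    qed
  qed
  have "\<exists>n. h \<in> V.span (S n)" if "h \<in> alg_gen U G" for h
    using that
  proof (induction rule: alg_gen.induct)
    case (cst c)
    have "cst U 1 \<in> S 0"
      unfolding S_def by (intro image_eqI[of _ _ "[]"]) (auto simp: mon_def)
    then have "(\<lambda>x. c * cst U 1 x) \<in> V.span (S 0)"
      by (intro V.span_scale V.span_base)
    moreover have "(\<lambda>x. c * cst U 1 x) = cst U c"
      by (auto simp: cst_apply)
    ultimately show ?case
      by metis
  next
    case (gen g)
    then have "g = mon [g]"
      using unit_mult[of g] alg_gen.gen[of g G U] \<open>A = alg_gen U G\<close>
      by (simp add: mon_def mult.commute del: times_fun_apply)
    then have "g \<in> S 1"
      unfolding S_def using gen by (intro image_eqI[of _ _ "[g]"]) auto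
    then show ?case
      using V.span_base by blast
  next
    case (add h k)
    then obtain m n where "h \<in> V.span (S m)" "k \<in> V.span (S n)"
      by blast
    then have "h \<in> V.span (S (max m n))" "k \<in> V.span (S (max m n))"
      using S_mono by (meson max.cobounded1 max.cobounded2 subsetD)+
    then show ?case
      using V.span_add by blast
  next
    case (mult h k)
    then show ?case
      using S_mult by blast
  qed
  then have "(\<Union>n. {c. u c \<in> V.span (S n)}) = UNIV"
    using u(1) gen(1) by blast
  then have "\<exists>n. infinite {c. u c \<in> V.span (S n)}"
    using uncountable_UNIV_complex countable_UN[of UNIV "\<lambda>n. {c. u c \<in> V.span (S n)}"]
    by (metis countable_finite countableI_type)
  then obtain n where "infinite {c. u c \<in> V.span (S n)}"
    by blast
  then obtain F where F: "finite F" "card F = Suc (card (S n))" "F \<subseteq> {c. u c \<in> V.span (S n)}"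
    using infinite_arbitrarily_large by blast
  \<comment> \<open>Otherwise the image of \<open>F\<close> could be too small to exceed the
    dimension. Equal inverses would be linearly dependent.\<close>
  have inj: "inj u"
  proof (rule injI, rule ccontr)
    fix c d assume "u c = u d" "c \<noteq> d"
    then have "(\<Sum>e\<in>{c, d}. (\<lambda>x. (if e = c then 1 else - 1) * u e x)) + peval a 0 = 0"
      by (auto simp: fun_eq_iff peval_def res_apply)
    then show False
      using indep[of "{c, d}" "\<lambda>e. if e = c then 1 else - 1"] function_idealD(2)[OF ideal]
      by (metis finite.emptyI finite.insertI insertCI one_neq_zero)
  qed
  have "card (u ` F) = Suc (card (S n))"
    using card_image[OF inj_on_subset[OF inj subset_UNIV]] F(2) by metis
  then have "V.dependent (u ` F)"
    using V.independent_span_bound[OF finS, of "u ` F" n] F(3) by auto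
  then obtain r where r: "\<exists>v\<in>u ` F. r v \<noteq> 0" "(\<Sum>v\<in>u ` F. (\<lambda>x. r v * v x)) = 0"
    using V.dependent_finite F(1) by blast
  have "(\<Sum>c\<in>F. (\<lambda>x. r (u c) * u c x)) = 0"
    using r(2) by (subst (asm) sum.reindex[OF inj_on_subset[OF inj subset_UNIV]]) (simp only: o_def)
  moreover have "peval a 0 = 0"
    by (auto simp: peval_def res_apply)
  ultimately have "(\<Sum>c\<in>F. (\<lambda>x. r (u c) * u c x)) + peval a 0 \<in> M"
    using function_idealD(2)[OF ideal] by (simp only: add_0_right)
  then have "\<forall>c\<in>F. r (u c) = 0"
    using indep[OF F(1), where l = "\<lambda>c. r (u c)"] by blast
  then show False
    using r(1) by blast
qed

end

locale affine_algebra = function_algebra U A for U :: "'a set" and A +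
  fixes G
  assumes generated: "A = alg_gen U G" and finite_generators: "finite G"
    and points: "\<And>\<phi>. alg_hom_to_complex U A \<phi> \<Longrightarrow> \<exists>x\<in>U. \<forall>h\<in>A. \<phi> h = h x"
begin

text \<open>A maximal ideal that contains \<open>J\<close> has the residue field \<complex>.
  Reduction modulo it is a homomorphism to \<complex>, hence the evaluation at some point of
  \<open>U\<close>, and there all of \<open>J\<close> vanishes.\<close>

theorem weak_nullstellensatz:
  assumes J: "function_ideal A J" and nonvanishing: "\<And>x. x \<in> U \<Longrightarrow> \<exists>h\<in>J. h x \<noteq> 0"
  shows "cst U 1 \<in> J"
proof (rule ccontr)
  assume "cst U 1 \<notin> J"
  define \<A> where "\<A> = {I. function_ideal A I \<and> J \<subseteq> I \<and> cst U 1 \<notin> I}"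
  have "\<Union>\<C> \<in> \<A>" if "\<C> \<noteq> {}" "subset.chain \<A> \<C>" for \<C>
  proof -
    have C: "\<C> \<subseteq> \<A>" and chain: "\<And>X Y. X \<in> \<C> \<Longrightarrow> Y \<in> \<C> \<Longrightarrow> X \<subseteq> Y \<or> Y \<subseteq> X"
      using that(2) by (auto simp: subset_chain_def)
    have "h + k \<in> \<Union>\<C>" if hk: "h \<in> \<Union>\<C>" "k \<in> \<Union>\<C>" for h k
    proof -
      obtain X Y where "X \<in> \<C>" "h \<in> X" "Y \<in> \<C>" "k \<in> Y"
        using hk by blast
      then obtain Z where "Z \<in> \<C>" "h \<in> Z" "k \<in> Z"
        using chain by blast
      then show ?thesis
        using C function_idealD(3) unfolding \<A>_def by blast
    qed
    moreover have "a * h \<in> \<Union>\<C>" if "a \<in> A" "h \<in> \<Union>\<C>" for a h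
      using that C function_idealD(4) unfolding \<A>_def by blast
    moreover have "\<Union>\<C> \<subseteq> A" "0 \<in> \<Union>\<C>" "J \<subseteq> \<Union>\<C>" "cst U 1 \<notin> \<Union>\<C>"
      using C that(1) function_idealD(1,2) unfolding \<A>_def by blast+
    ultimately show ?thesis
      unfolding \<A>_def function_ideal_def by blast
  qed
  moreover have "J \<in> \<A>"
    using J \<open>cst U 1 \<notin> J\<close> by (simp add: \<A>_def)
  ultimately obtain M where M: "M \<in> \<A>" "\<And>X. X \<in> \<A> \<Longrightarrow> M \<subseteq> X \<Longrightarrow> X = M"
    using subset_Zorn_nonempty[of \<A>] by blast
  interpret maximal_function_ideal U A M
    by unfold_locales (use M in \<open>auto simp: \<A>_def\<close>)
  have ex: "\<exists>c. a - cst U c \<in> M" if "a \<in> A" for a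
    by (rule residue_field[OF generated finite_generators that])
  have uniq: "c = d" if "a - cst U c \<in> M" "a - cst U d \<in> M" for a c d
  proof (rule ccontr)
    assume "c \<noteq> d"
    then have "cst U 1 = (\<lambda>x. 1 / (d - c) * ((a - cst U c) - (a - cst U d)) x)"
      by (auto simp: fun_eq_iff cst_apply)
    then show False
      using function_ideal_scale[OF ideal function_ideal_diff[OF ideal that]] proper by metis
  qed
  define \<phi> where "\<phi> a = (SOME c. a - cst U c \<in> M)" for a
  have \<phi>: "a - cst U (\<phi> a) \<in> M" if "a \<in> A" for a
    unfolding \<phi>_def using someI_ex[OF ex[OF that]] .
  have \<phi>I: "\<phi> a = c" if "a \<in> A" "a - cst U c \<in> M" for a c
    using uniq \<phi> that by blast
  have "alg_hom_to_complex U A \<phi>"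
    unfolding alg_hom_to_complex_def
  proof (intro conjI allI ballI)
    fix c
    show "\<phi> (cst U c) = c"
      using function_idealD(2)[OF ideal] by (intro \<phi>I cst_closed) (simp only: diff_self)
  next
    fix h k assume hk: "h \<in> A" "k \<in> A"
    have "h + k - cst U (\<phi> h + \<phi> k) = (h - cst U (\<phi> h)) + (k - cst U (\<phi> k))"
      by (auto simp: fun_eq_iff cst_apply)
    then show "\<phi> (h + k) = \<phi> h + \<phi> k"
      using \<phi>I[OF add_closed[OF hk]] function_idealD(3)[OF ideal \<phi>[OF hk(1)] \<phi>[OF hk(2)]] by metis
    have "h * k - cst U (\<phi> h * \<phi> k) = k * (h - cst U (\<phi> h)) + cst U (\<phi> h) * (k - cst U (\<phi> k))"
      using vanishes[OF hk(1)] vanishes[OF hk(2)] by (auto simp: fun_eq_iff cst_apply algebra_simps)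
    then show "\<phi> (h * k) = \<phi> h * \<phi> k"
      using \<phi>I[OF mult_closed[OF hk]] function_idealD(3)[OF ideal function_idealD(4)[OF ideal hk(2) \<phi>[OF hk(1)]]
          function_idealD(4)[OF ideal cst_closed \<phi>[OF hk(2)]]] by metis
  qed
  then obtain x where x: "x \<in> U" "\<And>h. h \<in> A \<Longrightarrow> \<phi> h = h x"
    using points by blast
  obtain h where h: "h \<in> J" "h x \<noteq> 0"
    using nonvanishing[OF x(1)] by blast
  have "h \<in> M" "h \<in> A"
    using h(1) M(1) function_idealD(1)[OF J] by (auto simp: \<A>_def)
  moreover have "h - cst U 0 = h"
    by (auto simp: cst_apply)
  ultimately have "\<phi> h = 0"
    using \<phi>I by metis
  then show False
    using x(2) \<open>h \<in> A\<close> h(2) by simp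
qed

end


section \<open>Localizations and tensor products of affine algebras\<close>

lemma alg_gen_map:
  assumes "\<And>c. i (cst U c) \<in> alg_gen W K" "\<And>g. g \<in> G \<Longrightarrow> i g \<in> alg_gen W K"
    and "\<And>h k. i (h + k) = i h + i k" "\<And>h k. i (h * k) = i h * i k" and "a \<in> alg_gen U G"
  shows "i a \<in> alg_gen W K"
  using assms(5) by (induction rule: alg_gen.induct) (simp_all only: assms(1-4) alg_gen.add alg_gen.mult)

lemma (in function_algebra) alg_gen_subset:
  assumes "G \<subseteq> A"
  shows "alg_gen U G \<subseteq> A"
proof
  fix a assume "a \<in> alg_gen U G"
  then show "a \<in> A"
    using assms by (induction rule: alg_gen.induct) (blast intro: cst_closed add_closed mult_closed)+
qed

context affine_algebra
begin

lemma generators_subset: "G \<subseteq> A"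
  by (auto simp: generated alg_gen.gen)

text \<open>\<open>1 / h\<close> is the only new generator. A homomorphism of the localization to
  \<complex> cannot map the unit \<open>h\<close> to 0, so the point that it defines lies in
  \<open>nonvan h\<close>.\<close>

lemma affine_algebra_localization:
  assumes h: "h \<in> A"
  shows "\<exists>G'. affine_algebra (nonvan h) (localization A h) G'"
proof -
  interpret L: function_algebra "nonvan h" "localization A h"
    using h by (rule function_algebra_localization)
  define i where "i = fraction h (cst U 1) 1"
  define G' where "G' = insert i (res (nonvan h) ` G)"
  have iL: "i \<in> localization A h"
    unfolding i_def using cst_closed by (rule in_localization)
  have "alg_gen (nonvan h) G' \<subseteq> localization A h"
    using iL res_in_localization generators_subset by (intro L.alg_gen_subset) (auto simp: G'_def)
  moreover have "k \<in> alg_gen (nonvan h) G'" if k: "k \<in> localization A h" for k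
  proof -
    obtain a n where a: "a \<in> A" "k = fraction h a n"
      using k by (auto simp: localization_def)
    have res: "res (nonvan h) b \<in> alg_gen (nonvan h) G'" if "b \<in> alg_gen U G" for b
    proof (rule alg_gen_map[OF _ _ _ _ that])
      have "res (nonvan h) (cst U c) = cst (nonvan h) c" for c
        using nonvan_subset[OF h] by (auto simp: fun_eq_iff res_apply cst_apply)
      then show "res (nonvan h) (cst U c) \<in> alg_gen (nonvan h) G'" for c
        by (simp only: alg_gen.cst)
      show "res (nonvan h) g \<in> alg_gen (nonvan h) G'" if "g \<in> G" for g
        using that by (intro alg_gen.gen) (simp add: G'_def)
    qed (auto simp: res_apply)
    have "i ^ n * res (nonvan h) a \<in> alg_gen (nonvan h) G'"
    proof (induction n)
      case 0
      show ?case
        using res a(1) generated by simp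
    next
      case (Suc n)
      have "i \<in> alg_gen (nonvan h) G'"
        by (intro alg_gen.gen) (simp add: G'_def)
      then show ?case
        using alg_gen.mult[OF _ Suc.IH] by (simp only: power_Suc mult.assoc)
    qed
    moreover have "k x = (i ^ n * res (nonvan h) a) x" for x
      using vanishes[OF h, of x]
      by (cases "h x = 0")
        (auto simp: a(2) i_def fraction_apply power_fun_apply cst_apply res_apply mem_nonvan power_divide)
    then have "k = i ^ n * res (nonvan h) a"
      by (rule ext)
    ultimately show ?thesis
      by metis
  qed
  ultimately have gen: "localization A h = alg_gen (nonvan h) G'"
    by blast
  have pts: "\<exists>x\<in>nonvan h. \<forall>k\<in>localization A h. \<phi> k = k x"
    if \<phi>: "alg_hom_to_complex (nonvan h) (localization A h) \<phi>" for \<phi>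
  proof -
    have res: "res (nonvan h) (cst U c) = cst (nonvan h) c" "res (nonvan h) (a + b) = res (nonvan h) a + res (nonvan h) b"
      "res (nonvan h) (a * b) = res (nonvan h) a * res (nonvan h) b" for a b c
      using nonvan_subset[OF h] by (auto simp: fun_eq_iff res_apply cst_apply)
    have "alg_hom_to_complex U A (\<lambda>a. \<phi> (res (nonvan h) a))"
      using \<phi> res_in_localization unfolding alg_hom_to_complex_def by (simp only: res) blast
    then obtain x where x: "x \<in> U" "\<And>a. a \<in> A \<Longrightarrow> \<phi> (res (nonvan h) a) = a x"
      using points by blast
    have \<phi>_mult: "\<phi> (k * l) = \<phi> k * \<phi> l" if "k \<in> localization A h" "l \<in> localization A h" for k l
      using that \<phi> unfolding alg_hom_to_complex_def by blast
    have "res (nonvan h) h * i = cst (nonvan h) 1"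
      using vanishes[OF h] by (auto simp: fun_eq_iff res_apply i_def fraction_apply cst_apply mem_nonvan)
    then have "\<phi> (res (nonvan h) h) * \<phi> i = 1"
      using \<phi>_mult[OF res_in_localization[OF h] iL] \<phi> by (simp add: alg_hom_to_complex_def)
    then have hx: "h x \<noteq> 0"
      using x(2)[OF h] by auto
    have "\<phi> k = k x" if k: "k \<in> localization A h" for k
    proof -
      obtain d a where d: "d \<in> A" "a \<in> A" "\<And>x. h x \<noteq> 0 \<Longrightarrow> d x \<noteq> 0" "\<And>x. h x \<noteq> 0 \<Longrightarrow> d x * k x = a x"
        using localization_witness[OF k h] by metis
      have "res (nonvan h) d * k = res (nonvan h) a"
        using d(4) L.vanishes[OF k] by (auto simp: fun_eq_iff res_apply mem_nonvan)
      then have "d x * \<phi> k = a x"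
        using \<phi>_mult[OF res_in_localization[OF d(1)] k] x(2) d(1,2) by metis
      then show ?thesis
        using d(3,4)[OF hx] by (metis mult_left_cancel)
    qed
    then show ?thesis
      using hx by (auto simp: mem_nonvan)
  qed
  show ?thesis
    by (intro exI[of _ G'] affine_algebra.intro L.function_algebra_axioms affine_algebra_axioms.intro gen pts)
      (auto simp: G'_def finite_generators)
qed

end

text \<open>A homomorphism is determined on \<open>A \<otimes> 1\<close> and
  \<open>1 \<otimes> B\<close>, where it is evaluation at a point of \<open>U\<close> and at a point
  of \<open>V\<close>.\<close>

lemma affine_algebra_tensor:
  assumes "affine_algebra U A G" "affine_algebra V B H"
  shows "\<exists>K. affine_algebra (U \<times> V) (tensor_alg A B) K"
proof -
  interpret A: affine_algebra U A G by fact
  interpret B: affine_algebra V B H by fact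
  interpret tensor_algebras U A V B ..
  define K where "K = (\<lambda>a. tensor_fun a (cst V 1)) ` G \<union> (\<lambda>b. tensor_fun (cst U 1) b) ` H"
  have "alg_gen (U \<times> V) K \<subseteq> tensor_alg A B"
    using A.generators_subset B.generators_subset
    by (intro T.alg_gen_subset) (auto simp: K_def intro!: tensor_fun_in_tensor_alg A.cst_closed B.cst_closed)
  moreover have "t \<in> alg_gen (U \<times> V) K" if "t \<in> tensor_alg A B" for t
  proof -
    have left: "tensor_fun a (cst V 1) \<in> alg_gen (U \<times> V) K" if "a \<in> alg_gen U G" for a
    proof (rule alg_gen_map[OF _ _ _ _ that])
      show "tensor_fun (cst U c) (cst V 1) \<in> alg_gen (U \<times> V) K" for c
        by (simp only: alg_gen.cst flip: tensor_cst)
      show "tensor_fun g (cst V 1) \<in> alg_gen (U \<times> V) K" if "g \<in> G" for g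
        using that by (intro alg_gen.gen) (simp add: K_def)
    qed (auto simp: fun_eq_iff algebra_simps cst_apply)
    have right: "tensor_fun (cst U 1) b \<in> alg_gen (U \<times> V) K" if "b \<in> alg_gen V H" for b
    proof (rule alg_gen_map[OF _ _ _ _ that])
      have "tensor_fun (cst U 1) (cst V c) = cst (U \<times> V) c" for c
        by (auto simp: fun_eq_iff cst_apply)
      then show "tensor_fun (cst U 1) (cst V c) \<in> alg_gen (U \<times> V) K" for c
        by (simp only: alg_gen.cst)
      show "tensor_fun (cst U 1) g \<in> alg_gen (U \<times> V) K" if "g \<in> H" for g
        using that by (intro alg_gen.gen) (simp add: K_def)
    qed (auto simp: fun_eq_iff algebra_simps cst_apply)
    have "cst (U \<times> V) 0 = 0"
      by (auto simp: cst_apply)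
    then have zero: "0 \<in> alg_gen (U \<times> V) K"
      using alg_gen.cst by metis
    show ?thesis
      using that
    proof (induction t rule: tensor_alg_induct)
      case zero
      show ?case
        by (rule \<open>0 \<in> alg_gen (U \<times> V) K\<close>)
    next
      case (add t a b)
      have "tensor_fun a b = tensor_fun a (cst V 1) * tensor_fun (cst U 1) b"
        using A.unit_mult[OF add.hyps(2)] B.unit_mult[OF add.hyps(3)]
        by (simp only: tensor_fun_mult mult.commute)
      then show ?case
        using alg_gen.add[OF add.IH alg_gen.mult[OF left right]] add.hyps A.generated B.generated by metis
    qed
  qed
  ultimately have gen: "tensor_alg A B = alg_gen (U \<times> V) K"
    by blast
  have pts: "\<exists>p\<in>U \<times> V. \<forall>t\<in>tensor_alg A B. \<phi> t = t p"
    if \<phi>: "alg_hom_to_complex (U \<times> V) (tensor_alg A B) \<phi>" for \<phi>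
  proof -
    have \<phi>_cst: "\<phi> (cst (U \<times> V) c) = c" for c
      using \<phi> unfolding alg_hom_to_complex_def by blast
    have \<phi>_add: "\<phi> (s + t) = \<phi> s + \<phi> t" and \<phi>_mult: "\<phi> (s * t) = \<phi> s * \<phi> t"
      if "s \<in> tensor_alg A B" "t \<in> tensor_alg A B" for s t
      using that \<phi> unfolding alg_hom_to_complex_def by blast+
    have "tensor_fun (a + b) (cst V 1) = tensor_fun a (cst V 1) + tensor_fun b (cst V 1)"
      "tensor_fun (a * b) (cst V 1) = tensor_fun a (cst V 1) * tensor_fun b (cst V 1)"
      "tensor_fun (cst U 1) (c + d) = tensor_fun (cst U 1) c + tensor_fun (cst U 1) d"
      "tensor_fun (cst U 1) (c * d) = tensor_fun (cst U 1) c * tensor_fun (cst U 1) d"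
      "tensor_fun (cst U 1) (cst V e) = cst (U \<times> V) e" for a b c d e
      by (auto simp: fun_eq_iff cst_apply algebra_simps)
    note tensor_simps = this
    have "alg_hom_to_complex U A (\<lambda>a. \<phi> (tensor_fun a (cst V 1)))"
      unfolding alg_hom_to_complex_def
      by (simp only: tensor_cst[symmetric] \<phi>_cst tensor_simps)
        (blast intro: \<phi>_add \<phi>_mult tensor_fun_in_tensor_alg B.cst_closed)
    then obtain x where x: "x \<in> U" "\<And>a. a \<in> A \<Longrightarrow> \<phi> (tensor_fun a (cst V 1)) = a x"
      using A.points by blast
    have "alg_hom_to_complex V B (\<lambda>b. \<phi> (tensor_fun (cst U 1) b))"
      unfolding alg_hom_to_complex_def
      by (simp only: \<phi>_cst tensor_simps)
        (blast intro: \<phi>_add \<phi>_mult tensor_fun_in_tensor_alg A.cst_closed)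
    then obtain y where y: "y \<in> V" "\<And>b. b \<in> B \<Longrightarrow> \<phi> (tensor_fun (cst U 1) b) = b y"
      using B.points by blast
    have "\<phi> t = t (x, y)" if "t \<in> tensor_alg A B" for t
      using that
    proof (induction t rule: tensor_alg_induct)
      case zero
      have "cst (U \<times> V) 0 = 0"
        by (auto simp: cst_apply)
      then show ?case
        using \<phi>_cst[of 0] by (simp only: zero_fun_apply[of "(x, y)"])
    next
      case (add t a b)
      have "tensor_fun a b = tensor_fun a (cst V 1) * tensor_fun (cst U 1) b"
        using A.unit_mult[OF add.hyps(2)] B.unit_mult[OF add.hyps(3)]
        by (simp only: tensor_fun_mult mult.commute)
      then have "\<phi> (tensor_fun a b) = a x * b y"
        using \<phi>_mult tensor_fun_in_tensor_alg x(2)[OF add.hyps(2)] y(2)[OF add.hyps(3)]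
          add.hyps(2,3) A.cst_closed B.cst_closed by metis
      then show ?case
        using \<phi>_add[OF add.hyps(1) tensor_fun_in_tensor_alg[OF add.hyps(2,3)]] add.IH
        by (simp only: plus_fun_apply[of t "tensor_fun a b" "(x, y)"] tensor_fun_apply)
    qed
    then show ?thesis
      using x(1) y(1) by blast
  qed
  have "finite K"
    using A.finite_generators B.finite_generators by (simp add: K_def)
  then show ?thesis
    by (intro exI[of _ K] affine_algebra.intro T.function_algebra_axioms affine_algebra_axioms.intro gen pts)
qed

section \<open>Independence of the local equations\<close>

text \<open>The common ground of a variety and of the product of two: what is asked for is enough to
  compare local equations and to pass between affine coverings.\<close>

locale function_space =
  fixes X :: "'a funsp"
  assumes reg_vanishes: "opn X U \<Longrightarrow> h \<in> reg X U \<Longrightarrow> x \<notin> U \<Longrightarrow> h x = 0"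
    and reg_restrict: "opn X U \<Longrightarrow> opn X V \<Longrightarrow> V \<subseteq> U \<Longrightarrow> h \<in> reg X U \<Longrightarrow> res V h \<in> reg X V"
    and irreducible: "irreducible_space (spc X)"
begin

lemma affine_openD:
  assumes "affine_open X U"
  shows "opn X U" "W \<subseteq> U \<Longrightarrow> opn X W \<longleftrightarrow> (\<exists>H\<subseteq>reg X U. W = (\<Union>h\<in>H. nonvan h))"
    "h \<in> reg X U \<Longrightarrow> reg X (nonvan h) = localization (reg X U) h"
  using assms by (auto simp: affine_open_def)

lemma affine_open_point:
  "affine_open X U \<Longrightarrow> alg_hom_to_complex U (reg X U) \<phi> \<Longrightarrow> \<exists>!x. x \<in> U \<and> (\<forall>h\<in>reg X U. \<phi> h = h x)"
  by (simp only: affine_open_def simp_thms)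

lemma affine_open_algebra:
  assumes U: "affine_open X U"
  obtains G where "affine_algebra U (reg X U) G"
proof -
  obtain G where G: "finite G" "reg X U = alg_gen U G"
    using U by (auto simp: affine_open_def)
  have "algebra_of_functions U (reg X U)"
    using reg_vanishes[OF affine_openD(1)[OF U]] unfolding algebra_of_functions_def G(2)
    by (auto intro: alg_gen.intros simp del: plus_fun_apply times_fun_apply)
  moreover have "\<exists>x\<in>U. \<forall>h\<in>reg X U. \<phi> h = h x" if \<phi>: "alg_hom_to_complex U (reg X U) \<phi>" for \<phi>
  proof -
    show ?thesis
      using affine_open_point[OF U \<phi>]
      by (elim ex1E) blast
  qed
  ultimately have "affine_algebra U (reg X U) G"
    using G by (intro affine_algebra.intro function_algebra.intro affine_algebra_axioms.intro)
  then show ?thesis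
    by (rule that)
qed

lemma affine_open_function_algebra: "affine_open X U \<Longrightarrow> function_algebra U (reg X U)"
  using affine_open_algebra affine_algebra_def by metis

lemma nonvan_open:
  assumes "affine_open X U" "h \<in> reg X U"
  shows "opn X (nonvan h)" "nonvan h \<subseteq> U"
proof -
  interpret function_algebra U "reg X U"
    using assms(1) by (rule affine_open_function_algebra)
  show *: "nonvan h \<subseteq> U"
    using assms(2) by (rule nonvan_subset)
  show "opn X (nonvan h)"
    unfolding affine_openD(2)[OF assms(1) *] using assms(2) by (intro exI[of _ "{h}"]) auto
qed

lemma basic_open:
  assumes U: "affine_open X U" and W: "opn X W" and x: "x \<in> U" "x \<in> W"
  obtains h where "h \<in> reg X U" "x \<in> nonvan h" "nonvan h \<subseteq> W"
proof -
  have "opn X (W \<inter> U)"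
    using W affine_openD(1)[OF U] by (rule openin_Int)
  then obtain H where H: "H \<subseteq> reg X U" "W \<inter> U = (\<Union>h\<in>H. nonvan h)"
    using affine_openD(2)[OF U, of "W \<inter> U"] by blast
  then obtain h where "h \<in> H" "x \<in> nonvan h"
    using x by blast
  then show ?thesis
    using that[of h] H by blast
qed

text \<open>A basic open set \<open>nonvan k\<close> of \<open>V\<close> inside a basic open set
  \<open>nonvan h\<close> of \<open>U\<close> is basic in \<open>U\<close> too: on
  \<open>nonvan h\<close> one has \<open>k = a / h^n\<close>, and \<open>k\<close> is nonzero
  exactly where \<open>h * a\<close> is.\<close>

lemma common_basic_open:
  assumes U: "affine_open X U" and V: "affine_open X V" and x: "x \<in> U" "x \<in> V"
  obtains h k where "h \<in> reg X U" "k \<in> reg X V" "x \<in> nonvan h" "nonvan h = nonvan k"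
proof -
  interpret A: function_algebra U "reg X U"
    using U by (rule affine_open_function_algebra)
  obtain h where h: "h \<in> reg X U" "x \<in> nonvan h" "nonvan h \<subseteq> V"
    using basic_open[OF U affine_openD(1)[OF V] x] .
  obtain k where k: "k \<in> reg X V" "x \<in> nonvan k" "nonvan k \<subseteq> nonvan h"
    using basic_open[OF V nonvan_open(1)[OF U h(1)] x(2) h(2)] .
  have "res (nonvan h) k \<in> reg X (nonvan h)"
    using reg_restrict[OF affine_openD(1)[OF V] nonvan_open(1)[OF U h(1)] h(3) k(1)] .
  then obtain a n where a: "a \<in> reg X U" "res (nonvan h) k = fraction h a n"
    unfolding affine_openD(3)[OF U h(1)] by (auto simp: localization_def)
  have "nonvan k = nonvan (h * a)"
  proof (rule Set.set_eqI)
    fix z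
    show "z \<in> nonvan k \<longleftrightarrow> z \<in> nonvan (h * a)"
      using fun_cong[OF a(2), of z] k(3) by (cases "h z = 0") (auto simp: mem_nonvan res_apply fraction_apply)
  qed
  then show ?thesis
    using that[of "h * a" k] A.mult_closed[OF h(1) a(1)] k(1,2) by metis
qed

lemma open_Int_nonempty: "opn X U \<Longrightarrow> opn X V \<Longrightarrow> U \<noteq> {} \<Longrightarrow> V \<noteq> {} \<Longrightarrow> U \<inter> V \<noteq> {}"
  using irreducible by (auto simp: irreducible_space_def)

lemma local_equation_sections:
  "local_equation X D U f \<Longrightarrow> opn X V \<Longrightarrow> V \<subseteq> U \<Longrightarrow> D V = {res V f * k | k. k \<in> reg X V}"
  by (simp add: local_equation_def)

lemma local_equation_compare:
  assumes U: "affine_open X U" and f: "local_equation X D U f" and f': "local_equation X D U' f'"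
    and h: "h \<in> reg X U" "nonvan h \<subseteq> U'"
  shows "\<exists>e\<in>reg X (nonvan h). res (nonvan h) f' = e * res (nonvan h) f"
proof -
  interpret A: function_algebra U "reg X U"
    using U by (rule affine_open_function_algebra)
  interpret L: function_algebra "nonvan h" "reg X (nonvan h)"
    unfolding affine_openD(3)[OF U h(1)] using h(1) by (rule A.function_algebra_localization)
  have "res (nonvan h) f' = res (nonvan h) f' * cst (nonvan h) 1"
    by (auto simp: res_apply cst_apply)
  then have "res (nonvan h) f' \<in> {res (nonvan h) f' * k | k. k \<in> reg X (nonvan h)}"
    using L.cst_closed by blast
  also have "\<dots> = D (nonvan h)"
    by (rule local_equation_sections[OF f' nonvan_open(1)[OF U h(1)] h(2), symmetric])
  also have "\<dots> = {res (nonvan h) f * k | k. k \<in> reg X (nonvan h)}"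
    by (rule local_equation_sections[OF f nonvan_open[OF U h(1)]])
  finally show ?thesis
    by (auto simp: mult.commute simp del: times_fun_apply)
qed

text \<open>\<open>f = u g\<close> and \<open>g = v f\<close> imply \<open>(1 - u v) f = 0\<close>.
  If \<open>1 - u v\<close> were nonzero, the open sets where it and where \<open>f\<close> do not
  vanish would meet by irreducibility.\<close>

lemma local_equations_unit:
  assumes U: "affine_open X U" and f: "local_equation X D U f"
    and V: "affine_open X V" and g: "local_equation X D V g"
    and h: "h \<in> reg X U" and k: "k \<in> reg X V" and hk: "nonvan h = nonvan k"
  obtains u v where "u \<in> reg X (nonvan h)" "v \<in> reg X (nonvan h)" "u * v = cst (nonvan h) 1"
    "res (nonvan h) f = u * res (nonvan h) g"
proof -
  interpret A: function_algebra U "reg X U"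
    using U by (rule affine_open_function_algebra)
  interpret L: function_algebra "nonvan h" "reg X (nonvan h)"
    unfolding affine_openD(3)[OF U h(1)] using h(1) by (rule A.function_algebra_localization)
  obtain v where v: "v \<in> reg X (nonvan h)" "res (nonvan h) g = v * res (nonvan h) f"
    using local_equation_compare[OF U f g h] nonvan_open(2)[OF V k] hk by auto
  obtain u where u: "u \<in> reg X (nonvan h)" "res (nonvan h) f = u * res (nonvan h) g"
    using local_equation_compare[OF V g f k] nonvan_open(2)[OF U h] hk by auto
  have "u * v = cst (nonvan h) 1"
  proof (rule ccontr)
    assume "u * v \<noteq> cst (nonvan h) 1"
    define e where "e = cst (nonvan h) 1 - u * v"
    have eL: "e \<in> localization (reg X U) h"
      unfolding e_def affine_openD(3)[OF U h(1), symmetric]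
      by (intro L.diff_closed L.cst_closed L.mult_closed u v)
    then obtain a n where a: "a \<in> reg X U" "e = fraction h a n"
      by (auto simp: localization_def)
    have "nonvan e = nonvan (h * a)"
      by (auto simp: a(2) mem_nonvan fraction_apply)
    then have "opn X (nonvan e)"
      using nonvan_open(1)[OF U A.mult_closed[OF h a(1)]] by simp
    moreover have "nonvan e \<noteq> {}"
      using \<open>u * v \<noteq> cst (nonvan h) 1\<close> unfolding nonvan_eq_empty e_def by (metis eq_iff_diff_eq_0)
    moreover have "f \<in> reg X U" "f \<noteq> 0"
      using f by (auto simp: local_equation_def)
    then have "opn X (nonvan f)" "nonvan f \<noteq> {}"
      using nonvan_open(1)[OF U] by (auto simp: nonvan_def fun_eq_iff)
    ultimately obtain x where x: "e x \<noteq> 0" "f x \<noteq> 0"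
      using open_Int_nonempty[of "nonvan e" "nonvan f"] by (auto simp: mem_nonvan)
    then have hx: "x \<in> nonvan h"
      using localization_outside[OF eL, of x] by (auto simp: mem_nonvan)
    then have "f x = u x * g x" "g x = v x * f x"
      using fun_cong[OF u(2), of x] fun_cong[OF v(2), of x] by (auto simp: res_apply)
    then have "u x * v x = 1"
      using x(2) by (metis mult.assoc mult_cancel_right1)
    then show False
      using x(1) hx by (simp add: e_def cst_apply)
  qed
  then show ?thesis
    using that u v by blast
qed

text \<open>The \<open>a\<close> with \<open>a c(s) f\<^sup>s\<close> in the module form an ideal of
  \<open>reg X U\<close>. Near each point \<open>f\<close> is a unit times some \<open>g\<close> of
  the covering, so a power of some \<open>h\<close> that is nonzero at the point belongs to the
  ideal, which therefore contains 1.\<close>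

lemma bs_ideal_local:
  assumes U: "affine_open X U" and f: "local_equation X D U f" and E: "affine_equations X D E"
    and c: "\<And>V g. (V, g) \<in> E \<Longrightarrow> c \<in> bs_ideal (reg X V) g"
  shows "c \<in> bs_ideal (reg X U) f"
proof -
  obtain G where "affine_algebra U (reg X U) G"
    using affine_open_algebra[OF U] .
  then interpret A: affine_algebra U "reg X U" G .
  have fA: "f \<in> reg X U"
    using f by (simp add: local_equation_def)
  define J where "J = {a \<in> reg X U. smult a (bs_vec f c) \<in> bs_module (reg X U) f}"
  have "function_ideal (reg X U) J"
    unfolding function_ideal_def
  proof (intro conjI ballI)
    show "0 \<in> J"
      using A.zero_closed A.bs_module_0[OF fA] by (simp add: J_def del: zero_fun_apply)
    show "h + k \<in> J" if "h \<in> J" "k \<in> J" for h k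
      using that unfolding J_def
      by (simp add: A.add_closed smult_add_left bs_module.add del: plus_fun_apply)
    show "a * h \<in> J" if "a \<in> reg X U" "h \<in> J" for a h
      using that bs_module.smult[of a "reg X U" "smult h (bs_vec f c)" f] unfolding J_def
      by (simp add: A.mult_closed del: times_fun_apply)
  qed (auto simp: J_def)
  moreover have "\<exists>a\<in>J. a x \<noteq> 0" if x: "x \<in> U" for x
  proof -
    have "x \<in> pts X"
      using openin_subset[OF affine_openD(1)[OF U]] x by blast
    then obtain V g where Vg: "(V, g) \<in> E" "x \<in> V"
      using E unfolding affine_equations_def by blast
    then have V: "affine_open X V" and g: "local_equation X D V g"
      using E unfolding affine_equations_def by auto
    then have gB: "g \<in> reg X V"
      by (simp add: local_equation_def)
    interpret B: function_algebra V "reg X V"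
      using V by (rule affine_open_function_algebra)
    obtain h k where h: "h \<in> reg X U" and k: "k \<in> reg X V" and "x \<in> nonvan h" and hk: "nonvan h = nonvan k"
      using common_basic_open[OF U V x Vg(2)] .
    interpret L: function_algebra "nonvan h" "reg X (nonvan h)"
      unfolding affine_openD(3)[OF U h(1)] using h(1) by (rule A.function_algebra_localization)
    obtain u v where uv: "u \<in> reg X (nonvan h)" "v \<in> reg X (nonvan h)" "u * v = cst (nonvan h) 1"
      and fg: "res (nonvan h) f = u * res (nonvan h) g"
      using local_equations_unit[OF U f V g h k hk] .
    have "c \<in> bs_ideal (reg X (nonvan h)) (res (nonvan h) g)"
      using B.bs_ideal_restrict[OF k gB c[OF Vg(1)]] affine_openD(3)[OF V k] hk by simp
    moreover have "res (nonvan h) g \<in> reg X (nonvan h)"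
      using B.res_in_localization[OF gB, of k] affine_openD(3)[OF V k] hk by simp
    ultimately have "c \<in> bs_ideal (reg X (nonvan h)) (res (nonvan h) f)"
      unfolding fg using L.bs_ideal_unit uv by blast
    then obtain N where "smult (h ^ Suc N) (bs_vec f c) \<in> bs_module (reg X U) f"
      using A.bs_ideal_clear[OF A.generated A.finite_generators h fA] affine_openD(3)[OF U h] by auto
    moreover have "h ^ Suc N \<in> reg X U"
      using A.power_mult_closed[OF h h, of N] by (simp only: power_Suc2)
    ultimately have "h ^ Suc N \<in> J"
      by (simp only: J_def mem_Collect_eq)
    moreover have "(h ^ Suc N) x \<noteq> 0"
      using \<open>x \<in> nonvan h\<close> by (simp only: power_fun_apply mem_nonvan power_eq_0_iff simp_thms)
    ultimately show ?thesis
      by blast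
  qed
  ultimately have "cst U 1 \<in> J"
    by (rule A.weak_nullstellensatz)
  moreover have "smult (cst U 1) (bs_vec f c) = bs_vec f c"
    using A.vanishes[OF fA] by (intro poly_fun_eqI) (auto simp: ev_bs_vec cst_apply)
  ultimately show ?thesis
    by (simp add: J_def A.bs_ideal_iff[OF fA])
qed

text \<open>\<open>bs_ideal_local\<close> compares any two coverings in both directions, so the one
  selected by \<open>SOME\<close> may be replaced by \<open>E\<close>.\<close>

lemma bs_poly_div_dvd_iff:
  assumes E: "affine_equations X D E"
  shows "bs_poly_div X D dvd c \<longleftrightarrow> (\<forall>(U, f)\<in>E. c \<in> bs_ideal (reg X U) f)"
proof -
  define E0 where "E0 = (SOME E. affine_equations X D E)"
  have E0: "affine_equations X D E0"
    unfolding E0_def using E by (rule someI)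
  have "bs_poly_div X D dvd c \<longleftrightarrow> (\<forall>(U, f)\<in>E0. bs_poly (reg X U) f dvd c)"
    by (auto simp: bs_poly_div_def E0_def[symmetric] Lcm_dvd_iff)
  also have "\<dots> \<longleftrightarrow> (\<forall>(U, f)\<in>E0. c \<in> bs_ideal (reg X U) f)"
  proof (intro ball_cong refl, clarify)
    fix U f assume "(U, f) \<in> E0"
    then have "affine_open X U" "f \<in> reg X U"
      using E0 by (auto simp: affine_equations_def local_equation_def)
    then show "bs_poly (reg X U) f dvd c \<longleftrightarrow> c \<in> bs_ideal (reg X U) f"
      using function_algebra.bs_poly_dvd_iff[OF affine_open_function_algebra] by blast
  qed
  also have "\<dots> \<longleftrightarrow> (\<forall>(U, f)\<in>E. c \<in> bs_ideal (reg X U) f)"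
  proof -
    have "c \<in> bs_ideal (reg X U) f"
      if "affine_equations X D F" "affine_equations X D F'" "\<forall>(U, f)\<in>F. c \<in> bs_ideal (reg X U) f" "(U, f) \<in> F'"
      for F F' U f
    proof -
      have "affine_open X U" "local_equation X D U f"
        using that(2,4) by (auto simp: affine_equations_def)
      then show ?thesis
        by (rule bs_ideal_local[OF _ _ that(1)]) (use that(3) in blast)
    qed
    then show ?thesis
      using E E0 by blast
  qed
  finally show ?thesis .
qed

end


section \<open>Products of varieties\<close>

locale variety =
  fixes X :: "'a funsp"
  assumes space_with_functions: "space_with_functions X"
    and irreducible_spc: "irreducible_space (spc X)"
    and affine_cover: "x \<in> pts X \<Longrightarrow> \<exists>U. affine_open X U \<and> x \<in> U"
begin

lemma reg_algebra: "opn X U \<Longrightarrow> function_algebra U (reg X U)"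
  using space_with_functions by (simp add: space_with_functions_def function_algebra_def)

lemma reg_nonvan_open: "opn X U \<Longrightarrow> h \<in> reg X U \<Longrightarrow> opn X (nonvan h)"
  using space_with_functions unfolding space_with_functions_def by blast

sublocale function_space X
proof
  show "h x = 0" if "opn X U" "h \<in> reg X U" "x \<notin> U" for U h x
    using function_algebra.vanishes[OF reg_algebra] that by metis
  show "res V h \<in> reg X V" if "opn X U" "opn X V" "V \<subseteq> U" "h \<in> reg X U" for U V h
  proof -
    have "\<forall>U V h. opn X U \<longrightarrow> opn X V \<longrightarrow> V \<subseteq> U \<longrightarrow> h \<in> reg X U \<longrightarrow> res V h \<in> reg X V"
      using space_with_functions unfolding space_with_functions_def by (elim conjE)
    then show ?thesis
      using that by simp
  qed
qed (rule irreducible_spc)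

end

lemma (in variety) clear_denominator:
  assumes U: "affine_open X U" "h \<in> reg X U" and W: "opn X W" "nonvan h \<subseteq> W" "a \<in> reg X W"
  shows "\<exists>N. \<forall>n\<ge>N. h ^ n * a \<in> reg X U"
proof -
  interpret A: function_algebra U "reg X U"
    using U(1) by (rule affine_open_function_algebra)
  have "res (nonvan h) a \<in> localization (reg X U) h"
    using reg_restrict[OF W(1) nonvan_open(1)[OF U] W(2,3)] affine_openD(3)[OF U] by simp
  then obtain m where m: "\<And>n. m \<le> n \<Longrightarrow> h ^ n * res (nonvan h) a \<in> reg X U"
    using A.clear_denominator[OF U(2)] by blast
  \<comment> \<open>As \<open>n > 0\<close>, the power kills \<open>a\<close> outside
    \<open>nonvan h\<close>, where \<open>res\<close> does the same.\<close>
  have "h ^ n * a \<in> reg X U" if "Suc m \<le> n" for n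
  proof -
    have "h ^ n * a = h ^ n * res (nonvan h) a"
      using that by (auto simp: fun_eq_iff res_apply mem_nonvan power_fun_apply)
    then show ?thesis
      using m[of n] that by (simp only: Suc_leD)
  qed
  then show ?thesis
    by blast
qed

lemma variety_if_integral: "integral_complex_variety X \<Longrightarrow> variety X"
  unfolding integral_complex_variety_def by unfold_locales blast+

locale variety_pair = X: variety X + Y: variety Y
  for X :: "'a funsp" and Y :: "'b funsp"
begin

abbreviation P :: "('a \<times> 'b) funsp" where
  "P \<equiv> prod_space X Y"

abbreviation T :: "'a set \<Rightarrow> 'b set \<Rightarrow> ('a \<times> 'b \<Rightarrow> complex) set" where
  "T U V \<equiv> tensor_alg (reg X U) (reg Y V)"

lemma tensor_algebras: "opn X U \<Longrightarrow> opn Y V \<Longrightarrow> tensor_algebras U (reg X U) V (reg Y V)"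
  by (simp add: tensor_algebras_def X.reg_algebra Y.reg_algebra)

lemma opn_P_iff:
  "opn P W \<longleftrightarrow> generate_topology_on {nonvan t | t U V. opn X U \<and> opn Y V \<and> t \<in> T U V} W"
  by (simp add: prod_space_def openin_topology_generated_by_iff)

lemma reg_P_iff:
  "h \<in> reg P W \<longleftrightarrow> (\<forall>p. p \<notin> W \<longrightarrow> h p = 0) \<and>
    (\<forall>p\<in>W. \<exists>U V t u. opn X U \<and> opn Y V \<and> t \<in> T U V \<and> u \<in> T U V \<and>
      p \<in> nonvan u \<and> nonvan u \<subseteq> W \<and> (\<forall>q\<in>nonvan u. h q = t q / u q))"
  by (simp add: prod_space_def)

lemma nonvan_open_P: "opn X U \<Longrightarrow> opn Y V \<Longrightarrow> t \<in> T U V \<Longrightarrow> opn P (nonvan t)"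
  unfolding opn_P_iff by (intro generate_topology_on.Basis) blast

lemma nonvan_tensor_subset: "opn X U \<Longrightarrow> opn Y V \<Longrightarrow> t \<in> T U V \<Longrightarrow> nonvan t \<subseteq> U \<times> V"
proof -
  assume *: "opn X U" "opn Y V" "t \<in> T U V"
  interpret tensor_algebras U "reg X U" V "reg Y V"
    using *(1,2) by (rule tensor_algebras)
  show ?thesis
    using *(3) by (rule T.nonvan_subset)
qed

text \<open>Tensors on arbitrary open sets are moved to the given affine ones near a point: the
  factors become fractions on \<open>nonvan h\<close> and \<open>nonvan k\<close>, whose
  denominators a power of \<open>tensor_fun h k\<close> clears.\<close>

lemma refine:
  assumes U: "affine_open X U" "x \<in> U" and V: "affine_open Y V" "y \<in> V"
    and U': "opn X U'" "x \<in> U'" and V': "opn Y V'" "y \<in> V'"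
  obtains h k where "h \<in> reg X U" "k \<in> reg Y V" "h x \<noteq> 0" "k y \<noteq> 0"
    "nonvan h \<subseteq> U'" "nonvan k \<subseteq> V'"
    "\<And>t. t \<in> T U' V' \<Longrightarrow> \<exists>N. \<forall>n\<ge>N. tensor_fun h k ^ n * t \<in> T U V"
proof -
  obtain h where h: "h \<in> reg X U" "x \<in> nonvan h" "nonvan h \<subseteq> U'"
    using X.basic_open[OF U(1) U'(1) U(2) U'(2)] .
  obtain k where k: "k \<in> reg Y V" "y \<in> nonvan k" "nonvan k \<subseteq> V'"
    using Y.basic_open[OF V(1) V'(1) V(2) V'(2)] .
  have "\<exists>N. \<forall>n\<ge>N. tensor_fun h k ^ n * t \<in> T U V" if "t \<in> T U' V'" for t
    using that
  proof (induction t rule: tensor_alg_induct)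
    case zero
    then show ?case
      by (simp only: mult_zero_right zero_in_tensor_alg simp_thms)
  next
    case (add t a b)
    obtain N where N: "\<And>n. N \<le> n \<Longrightarrow> tensor_fun h k ^ n * t \<in> T U V"
      using add.IH by blast
    obtain L where L: "\<And>n. L \<le> n \<Longrightarrow> h ^ n * a \<in> reg X U"
      using X.clear_denominator[OF U(1) h(1) U'(1) h(3) add.hyps(2)] by blast
    obtain M where M: "\<And>n. M \<le> n \<Longrightarrow> k ^ n * b \<in> reg Y V"
      using Y.clear_denominator[OF V(1) k(1) V'(1) k(3) add.hyps(3)] by blast
    have "tensor_fun h k ^ n * (t + tensor_fun a b) \<in> T U V" if "N + L + M \<le> n" for n
    proof -
      have "tensor_fun h k ^ n * tensor_fun a b = tensor_fun (h ^ n * a) (k ^ n * b)"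
        by (auto simp: fun_eq_iff power_fun_apply power_mult_distrib)
      then have "tensor_fun h k ^ n * (t + tensor_fun a b) = tensor_fun h k ^ n * t + tensor_fun (h ^ n * a) (k ^ n * b)"
        by (simp only: ring_distribs)
      then show ?thesis
        using tensor_alg_add_tensor_fun[OF N L M, of n n n] that by simp
    qed
    then show ?case
      by blast
  qed
  then show ?thesis
    using that h k by (auto simp: mem_nonvan)
qed

text \<open>A quotient does not change when numerator and denominator are multiplied by the same
  power of \<open>tensor_fun h k\<close> at points where it is nonzero, and for a large exponent
  both lie in \<open>T U V\<close>.\<close>

lemma refine_nonvan:
  assumes U: "affine_open X U" "x \<in> U" and V: "affine_open Y V" "y \<in> V"
    and U': "opn X U'" and V': "opn Y V'" and t: "t \<in> T U' V'" and u: "u \<in> T U' V'" "u (x, y) \<noteq> 0"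
  obtains s v w where "s \<in> T U V" "v \<in> T U V" "(x, y) \<in> nonvan v" "nonvan v \<subseteq> nonvan u"
    "\<And>q. q \<in> nonvan v \<Longrightarrow> t q / u q = s q / v q"
proof -
  have xy: "x \<in> U'" "y \<in> V'"
    using nonvan_tensor_subset[OF U' V' u(1)] u(2) by (auto simp: nonvan_def)
  obtain h k where "h \<in> reg X U" "k \<in> reg Y V" and hk: "h x \<noteq> 0" "k y \<noteq> 0"
    and "nonvan h \<subseteq> U'" "nonvan k \<subseteq> V'"
    and clear: "\<And>t. t \<in> T U' V' \<Longrightarrow> \<exists>N. \<forall>n\<ge>N. tensor_fun h k ^ n * t \<in> T U V"
    by (rule refine[OF U V U' xy(1) V' xy(2)]) (rule that; assumption)
  obtain N where N: "\<And>n. N \<le> n \<Longrightarrow> tensor_fun h k ^ n * t \<in> T U V"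
    using clear[OF t] by blast
  obtain M where M: "\<And>n. M \<le> n \<Longrightarrow> tensor_fun h k ^ n * u \<in> T U V"
    using clear[OF u(1)] by blast
  define n where "n = N + M"
  show ?thesis
    using u(2) hk by (intro that[of "tensor_fun h k ^ n * t" "tensor_fun h k ^ n * u"] N M)
      (auto simp: n_def mem_nonvan power_fun_apply)
qed

text \<open>Finite intersections are no obstacle, since the product of two functions is nonzero
  exactly on the intersection; \<open>refine_nonvan\<close> brings the generating sets to
  \<open>U\<close> and \<open>V\<close>.\<close>

lemma basic_open_P:
  assumes "opn P W" "(x, y) \<in> W" and U: "affine_open X U" "x \<in> U" and V: "affine_open Y V" "y \<in> V"
  shows "\<exists>t\<in>T U V. (x, y) \<in> nonvan t \<and> nonvan t \<subseteq> W"
proof -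
  interpret tensor_algebras U "reg X U" V "reg Y V"
    using X.affine_openD(1)[OF U(1)] Y.affine_openD(1)[OF V(1)] by (rule tensor_algebras)
  have "generate_topology_on {nonvan t | t U V. opn X U \<and> opn Y V \<and> t \<in> T U V} W"
    using assms(1) by (simp add: opn_P_iff)
  then show ?thesis
    using assms(2)
  proof (induction rule: generate_topology_on.induct)
    case (Int a b)
    then obtain s t where "s \<in> T U V" "t \<in> T U V" "(x, y) \<in> nonvan s" "nonvan s \<subseteq> a" "(x, y) \<in> nonvan t" "nonvan t \<subseteq> b"
      by blast
    then show ?case
      by (intro bexI[of _ "s * t"] T.mult_closed) (auto simp: nonvan_def)
  next
    case (UN K)
    then obtain k where k: "k \<in> K" "(x, y) \<in> k"
      by blast
    then obtain t where "t \<in> T U V" "(x, y) \<in> nonvan t" "nonvan t \<subseteq> k"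
      using UN.IH by blast
    then show ?case
      using k(1) by blast
  next
    case (Basis s)
    then obtain t U' V' where t: "s = nonvan t" "opn X U'" "opn Y V'" "t \<in> T U' V'"
      by blast
    then have "t (x, y) \<noteq> 0"
      using Basis.prems by (simp add: nonvan_def)
    then show ?case
      unfolding t(1) using refine_nonvan[OF U V t(2,3,4,4)] by metis
  qed simp
qed

lemma local_fraction:
  assumes r: "r \<in> reg P W" and p: "(x, y) \<in> W" and U: "affine_open X U" "x \<in> U" and V: "affine_open Y V" "y \<in> V"
  obtains t u where "t \<in> T U V" "u \<in> T U V" "(x, y) \<in> nonvan u" "nonvan u \<subseteq> W"
    "\<And>q. q \<in> nonvan u \<Longrightarrow> r q = t q / u q"
proof -
  obtain U' V' t u where t: "opn X U'" "opn Y V'" "t \<in> T U' V'" "u \<in> T U' V'"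
    and u: "(x, y) \<in> nonvan u" "nonvan u \<subseteq> W" "\<And>q. q \<in> nonvan u \<Longrightarrow> r q = t q / u q"
    using r p unfolding reg_P_iff by metis
  obtain s v where "s \<in> T U V" "v \<in> T U V" "(x, y) \<in> nonvan v" "nonvan v \<subseteq> nonvan u"
    "\<And>q. q \<in> nonvan v \<Longrightarrow> t q / u q = s q / v q"
    using refine_nonvan[OF U V t] u(1) by (metis mem_nonvan)
  then show ?thesis
    using that[of s v] u by (metis subsetD subset_trans)
qed

lemma reg_PI:
  assumes "\<And>p. p \<notin> W \<Longrightarrow> r p = 0"
    and "\<And>x y. (x, y) \<in> W \<Longrightarrow> \<exists>U V t u. affine_open X U \<and> affine_open Y V \<and> t \<in> T U V \<and> u \<in> T U V \<and>
      (x, y) \<in> nonvan u \<and> nonvan u \<subseteq> W \<and> (\<forall>q\<in>nonvan u. r q = t q / u q)"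
  shows "r \<in> reg P W"
  unfolding reg_P_iff
proof (intro conjI allI ballI impI assms(1))
  fix p assume "p \<in> W"
  then show "\<exists>U V t u. opn X U \<and> opn Y V \<and> t \<in> T U V \<and> u \<in> T U V \<and>
      p \<in> nonvan u \<and> nonvan u \<subseteq> W \<and> (\<forall>q\<in>nonvan u. r q = t q / u q)"
    using assms(2)[of "fst p" "snd p"] X.affine_openD(1) Y.affine_openD(1) by (metis prod.collapse)
qed

lemma topspace_P: "pts P = pts X \<times> pts Y"
proof
  have "pts P = \<Union>{nonvan t | t U V. opn X U \<and> opn Y V \<and> t \<in> T U V}"
    by (simp add: prod_space_def)
  moreover have "nonvan t \<subseteq> pts X \<times> pts Y" if "opn X U" "opn Y V" "t \<in> T U V" for t U V
    using nonvan_tensor_subset[OF that] openin_subset[OF that(1)] openin_subset[OF that(2)] by blast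
  ultimately show "pts P \<subseteq> pts X \<times> pts Y"
    by blast
next
  interpret tensor_algebras "pts X" "reg X (pts X)" "pts Y" "reg Y (pts Y)"
    by (rule tensor_algebras) auto
  have "opn P (nonvan (cst (pts X \<times> pts Y) 1))"
    by (intro nonvan_open_P[of "pts X" "pts Y"] T.cst_closed) auto
  moreover have "nonvan (cst (pts X \<times> pts Y) 1) = pts X \<times> pts Y"
    by (auto simp: nonvan_def cst_apply)
  ultimately show "pts X \<times> pts Y \<subseteq> pts P"
    using openin_subset by metis
qed

lemma affine_at:
  assumes "opn P W" "(x, y) \<in> W"
  obtains U V where "affine_open X U" "x \<in> U" "affine_open Y V" "y \<in> V"
proof -
  have "(x, y) \<in> pts P"
    using assms openin_subset by blast
  then show ?thesis
    using that X.affine_cover Y.affine_cover unfolding topspace_P by blast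
qed

text \<open>The projections of the two sets to \<open>Y\<close> are unions of nonvanishing sets of
  slices, hence open, and meet in some \<open>y\<close>. The slices at this \<open>y\<close> have
  nonempty open nonvanishing sets in \<open>X\<close>, which meet as well.\<close>

lemma nonvan_Int_nonempty:
  assumes U1: "opn X U1" "opn Y V1" "t1 \<in> T U1 V1" "t1 \<noteq> 0"
    and U2: "opn X U2" "opn Y V2" "t2 \<in> T U2 V2" "t2 \<noteq> 0"
  shows "nonvan t1 \<inter> nonvan t2 \<noteq> {}"
proof -
  have S: "opn Y (\<Union>x. nonvan (\<lambda>y. t (x, y))) \<and> (\<Union>x. nonvan (\<lambda>y. t (x, y))) \<noteq> {}"
    if t: "opn X U" "opn Y V" "t \<in> T U V" "t \<noteq> 0" for t U V
  proof -
    interpret tensor_algebras U "reg X U" V "reg Y V"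
      using t(1,2) by (rule tensor_algebras)
    have "opn Y (nonvan (\<lambda>y. t (x, y)))" for x
      by (rule Y.reg_nonvan_open[OF t(2) slice_right[OF t(3)]])
    then have "opn Y (\<Union>x. nonvan (\<lambda>y. t (x, y)))"
      by (intro openin_Union) auto
    moreover obtain p where "t p \<noteq> 0"
      using t(4) by (auto simp: fun_eq_iff)
    then have "snd p \<in> (\<Union>x. nonvan (\<lambda>y. t (x, y)))"
      by (auto simp: mem_nonvan intro!: exI[of _ "fst p"])
    ultimately show ?thesis
      by blast
  qed
  obtain y where y: "y \<in> (\<Union>x. nonvan (\<lambda>y. t1 (x, y)))" "y \<in> (\<Union>x. nonvan (\<lambda>y. t2 (x, y)))"
    using Y.open_Int_nonempty S[OF U1] S[OF U2] by blast
  have R: "opn X (nonvan (\<lambda>x. t (x, y)))" if t: "opn X U" "opn Y V" "t \<in> T U V" for t U V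
  proof -
    interpret tensor_algebras U "reg X U" V "reg Y V"
      using t(1,2) by (rule tensor_algebras)
    show ?thesis
      by (rule X.reg_nonvan_open[OF t(1) slice_left[OF t(3)]])
  qed
  have "nonvan (\<lambda>x. t1 (x, y)) \<inter> nonvan (\<lambda>x. t2 (x, y)) \<noteq> {}"
    using y by (intro X.open_Int_nonempty R[OF U1(1-3)] R[OF U2(1-3)]) (auto simp: nonvan_def)
  then show ?thesis
    by (auto simp: nonvan_def)
qed

lemma irreducible_P: "irreducible_space (spc P)"
  unfolding irreducible_space_def
proof (intro conjI allI impI)
  show "pts P \<noteq> {}"
    using X.irreducible Y.irreducible by (simp add: topspace_P irreducible_space_def)
next
  have basic: "\<exists>U V t. opn X U \<and> opn Y V \<and> t \<in> T U V \<and> t \<noteq> 0 \<and> nonvan t \<subseteq> W" if W: "opn P W" "W \<noteq> {}" for W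
  proof -
    obtain x y where xy: "(x, y) \<in> W"
      using W(2) by auto
    obtain U V where UV: "affine_open X U" "x \<in> U" "affine_open Y V" "y \<in> V"
      using affine_at[OF W(1) xy] .
    then obtain t where "t \<in> T U V" "(x, y) \<in> nonvan t" "nonvan t \<subseteq> W"
      using basic_open_P[OF W(1) xy] by blast
    moreover from this have "t \<noteq> 0"
      by (auto simp: nonvan_def)
    ultimately show ?thesis
      using X.affine_openD(1)[OF UV(1)] Y.affine_openD(1)[OF UV(3)] by blast
  qed
  fix W1 W2 assume "opn P W1" "opn P W2" "W1 \<noteq> {}" "W2 \<noteq> {}"
  then show "W1 \<inter> W2 \<noteq> {}"
    using basic[of W1] basic[of W2] nonvan_Int_nonempty by blast
qed

sublocale P: function_space P
proof
  show "h p = 0" if "h \<in> reg P W" "p \<notin> W" for W h p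
    using that unfolding reg_P_iff by blast
  show "res W' r \<in> reg P W'" if W: "opn P W" "opn P W'" "W' \<subseteq> W" "r \<in> reg P W" for W W' r
  proof (rule reg_PI)
    fix x y assume xy: "(x, y) \<in> W'"
    obtain U V where U: "affine_open X U" "x \<in> U" and V: "affine_open Y V" "y \<in> V"
      using affine_at[OF W(2) xy] .
    interpret tensor_algebras U "reg X U" V "reg Y V"
      using X.affine_openD(1)[OF U(1)] Y.affine_openD(1)[OF V(1)] by (rule tensor_algebras)
    have "(x, y) \<in> W"
      using xy W(3) by blast
    then obtain t u where t: "t \<in> T U V" "u \<in> T U V" "(x, y) \<in> nonvan u" "nonvan u \<subseteq> W"
      "\<And>q. q \<in> nonvan u \<Longrightarrow> r q = t q / u q"
      using local_fraction[OF W(4) _ U V] by blast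
    obtain s where s: "s \<in> T U V" "(x, y) \<in> nonvan s" "nonvan s \<subseteq> W'"
      using basic_open_P[OF W(2) xy U V] by blast
    have "\<forall>q\<in>nonvan (u * s). res W' r q = (t * s) q / (u * s) q"
      using t(5) s(3) by (auto simp: mem_nonvan res_apply subset_iff)
    moreover have "(x, y) \<in> nonvan (u * s)" "nonvan (u * s) \<subseteq> W'"
      using t(3) s(2,3) by (auto simp: nonvan_def)
    ultimately show "\<exists>U V t u. affine_open X U \<and> affine_open Y V \<and> t \<in> T U V \<and> u \<in> T U V \<and>
        (x, y) \<in> nonvan u \<and> nonvan u \<subseteq> W' \<and> (\<forall>q\<in>nonvan u. res W' r q = t q / u q)"
      using U(1) V(1) T.mult_closed[OF t(1) s(1)] T.mult_closed[OF t(2) s(1)] by blast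
  qed (simp add: res_apply)
qed (rule irreducible_P)

text \<open>For a regular \<open>r\<close> the \<open>k\<close> with \<open>k * r\<close> in the
  localization form an ideal. It contains the squares of local denominators of \<open>r\<close>,
  hence 1 by the Nullstellensatz on \<open>nonvan w\<close>.\<close>

lemma reg_P_nonvan:
  assumes U: "affine_open X U" and V: "affine_open Y V" and w: "w \<in> T U V"
  shows "reg P (nonvan w) = localization (T U V) w"
proof -
  obtain G H where "affine_algebra U (reg X U) G" "affine_algebra V (reg Y V) H"
    using X.affine_open_algebra[OF U] Y.affine_open_algebra[OF V] by metis
  then obtain K where "affine_algebra (U \<times> V) (T U V) K"
    using affine_algebra_tensor by blast
  then interpret T: affine_algebra "U \<times> V" "T U V" K .
  obtain K' where "affine_algebra (nonvan w) (localization (T U V) w) K'"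
    using T.affine_algebra_localization[OF w] by blast
  then interpret L: affine_algebra "nonvan w" "localization (T U V) w" K' .
  show ?thesis
  proof (intro equalityI subsetI)
    fix r assume "r \<in> localization (T U V) w"
    then obtain t n where t: "t \<in> T U V" "r = fraction w t n"
      by (auto simp: localization_def)
    show "r \<in> reg P (nonvan w)"
    proof (rule reg_PI)
      show "r p = 0" if "p \<notin> nonvan w" for p
        using that by (simp add: t(2) fraction_apply mem_nonvan)
    next
      fix x y assume "(x, y) \<in> nonvan w"
      \<comment> \<open>The fraction is expanded by \<open>w\<close>, so that also for
        \<open>n = 0\<close> the denominator is in \<open>T U V\<close> and vanishes exactly outside
        \<open>nonvan w\<close>.\<close>
      moreover have "w ^ n * w \<in> T U V" "w * t \<in> T U V"
        using w t(1) by (auto intro: T.power_mult_closed T.mult_closed simp del: times_fun_apply)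
      moreover have "\<forall>q\<in>nonvan (w ^ n * w). r q = (w * t) q / (w ^ n * w) q"
        by (auto simp: t(2) fraction_apply mem_nonvan power_fun_apply)
      moreover have "nonvan (w ^ n * w) = nonvan w"
        by (auto simp: nonvan_def power_fun_apply)
      ultimately show "\<exists>U V t u. affine_open X U \<and> affine_open Y V \<and> t \<in> T U V \<and> u \<in> T U V \<and>
          (x, y) \<in> nonvan u \<and> nonvan u \<subseteq> nonvan w \<and> (\<forall>q\<in>nonvan u. r q = t q / u q)"
        using U V by (metis order_refl)
    qed
  next
    fix r assume r: "r \<in> reg P (nonvan w)"
    define J where "J = {k \<in> localization (T U V) w. k * r \<in> localization (T U V) w}"
    have "function_ideal (localization (T U V) w) J"
      unfolding function_ideal_def
    proof (intro conjI ballI)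
      show "0 \<in> J"
        using L.zero_closed by (simp add: J_def del: zero_fun_apply times_fun_apply)
      show "h + k \<in> J" if "h \<in> J" "k \<in> J" for h k
        using that unfolding J_def
        by (simp add: L.add_closed ring_distribs del: plus_fun_apply times_fun_apply)
      show "a * h \<in> J" if "a \<in> localization (T U V) w" "h \<in> J" for a h
        using that unfolding J_def by (simp add: L.mult_closed mult.assoc del: times_fun_apply)
    qed (auto simp: J_def)
    moreover have "\<exists>k\<in>J. k p \<noteq> 0" if p: "p \<in> nonvan w" for p
    proof -
      obtain x y where xy: "p = (x, y)"
        by (cases p)
      have "(x, y) \<in> U \<times> V"
        using p T.nonvan_subset[OF w] unfolding xy by blast
      then obtain t u where t: "t \<in> T U V" "u \<in> T U V" "p \<in> nonvan u" "nonvan u \<subseteq> nonvan w"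
        "\<And>q. q \<in> nonvan u \<Longrightarrow> r q = t q / u q"
        using local_fraction[OF r _ U _ V] p unfolding xy by blast
      \<comment> \<open>The identity \<open>u r = t\<close> may fail where \<open>u\<close> is 0 and
        \<open>t\<close> is not; the second factor \<open>u\<close> repairs this.\<close>
      have "res (nonvan w) (u * u) * r = res (nonvan w) (u * t)"
      proof
        fix q
        show "(res (nonvan w) (u * u) * r) q = res (nonvan w) (u * t) q"
          using t(5)[of q] by (cases "u q = 0") (auto simp: res_apply mem_nonvan)
      qed
      then have "res (nonvan w) (u * u) * r \<in> localization (T U V) w"
        using T.res_in_localization[OF T.mult_closed[OF t(2,1)]] by metis
      then have "res (nonvan w) (u * u) \<in> J"
        using T.res_in_localization[OF T.mult_closed[OF t(2,2)]] by (simp add: J_def del: times_fun_apply)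
      moreover have "res (nonvan w) (u * u) p \<noteq> 0"
        using t(3,4) by (auto simp: res_apply mem_nonvan)
      ultimately show ?thesis
        by blast
    qed
    ultimately have "cst (nonvan w) 1 \<in> J"
      by (rule L.weak_nullstellensatz)
    moreover have "cst (nonvan w) 1 * r = r"
      using r by (auto simp: reg_P_iff fun_eq_iff cst_apply)
    ultimately show "r \<in> localization (T U V) w"
      by (simp add: J_def del: times_fun_apply)
  qed
qed

lemma reg_P_product:
  assumes U: "affine_open X U" and V: "affine_open Y V"
  shows "reg P (U \<times> V) = T U V"
proof -
  interpret tensor_algebras U "reg X U" V "reg Y V"
    using X.affine_openD(1)[OF U] Y.affine_openD(1)[OF V] by (rule tensor_algebras)
  have "nonvan (cst (U \<times> V) 1) = U \<times> V"
    by (auto simp: nonvan_def cst_apply)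
  then have "reg P (U \<times> V) = localization (T U V) (cst (U \<times> V) 1)"
    using reg_P_nonvan[OF U V T.cst_closed[of 1]] by simp
  also have "\<dots> = T U V"
  proof -
    have "fraction (cst (U \<times> V) 1) t n = t" if "t \<in> T U V" for t n
      using T.vanishes[OF that] by (auto simp: fun_eq_iff fraction_apply cst_apply)
    then show ?thesis
      unfolding localization_def by (auto, metis)
  qed
  finally show ?thesis .
qed

text \<open>Homomorphisms are evaluations at points by \<open>affine_algebra_tensor\<close>. The
  points are unique because \<open>a \<otimes> 1\<close> and \<open>1 \<otimes> b\<close> separate
  them, as functions on \<open>U\<close> and \<open>V\<close> do.\<close>

lemma affine_open_product:
  assumes U: "affine_open X U" and V: "affine_open Y V"
  shows "affine_open P (U \<times> V)"
  unfolding affine_open_def reg_P_product[OF U V]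
proof (intro conjI allI impI ballI)
  obtain G H where "affine_algebra U (reg X U) G" "affine_algebra V (reg Y V) H"
    using X.affine_open_algebra[OF U] Y.affine_open_algebra[OF V] by metis
  then obtain K where "affine_algebra (U \<times> V) (T U V) K"
    using affine_algebra_tensor by blast
  then interpret T: affine_algebra "U \<times> V" "T U V" K .
  note U_open = X.affine_openD(1)[OF U] and V_open = Y.affine_openD(1)[OF V]
  interpret tensor_algebras U "reg X U" V "reg Y V"
    using U_open V_open by (rule tensor_algebras)
  have "nonvan (cst (U \<times> V) 1) = U \<times> V"
    by (auto simp: nonvan_def cst_apply)
  then show "opn P (U \<times> V)"
    using nonvan_open_P[OF U_open V_open T.cst_closed[of 1]] by simp
  show "\<exists>K. finite K \<and> T U V = alg_gen (U \<times> V) K"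
    using T.generated T.finite_generators by blast
  show "\<exists>!p. p \<in> U \<times> V \<and> (\<forall>t\<in>T U V. \<phi> t = t p)" if \<phi>: "alg_hom_to_complex (U \<times> V) (T U V) \<phi>" for \<phi>
  proof (rule ex_ex1I)
    show "\<exists>p. p \<in> U \<times> V \<and> (\<forall>t\<in>T U V. \<phi> t = t p)"
      using T.points[OF \<phi>] by blast
  next
    fix p q assume p: "p \<in> U \<times> V \<and> (\<forall>t\<in>T U V. \<phi> t = t p)" and q: "q \<in> U \<times> V \<and> (\<forall>t\<in>T U V. \<phi> t = t q)"
    obtain x y x' y' where xy: "p = (x, y)" "q = (x', y')"
      by (cases p, cases q)
    have mem: "x \<in> U" "y \<in> V" "x' \<in> U" "y' \<in> V"
      using p q by (auto simp: xy)
    have t: "t (x, y) = t (x', y')" if "t \<in> T U V" for t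
      using p q that unfolding xy by metis
    have "a x = a x'" if "a \<in> reg X U" for a
      using t[OF tensor_fun_in_tensor_alg[OF that B.cst_closed[of 1]]] mem by (simp add: cst_apply)
    moreover have "alg_hom_to_complex U (reg X U) (\<lambda>a. a x)"
      using mem by (simp add: alg_hom_to_complex_def cst_apply)
    then have "\<exists>!z. z \<in> U \<and> (\<forall>a\<in>reg X U. a x = a z)"
      by (rule X.affine_open_point[OF U])
    ultimately have "x = x'"
      using mem by metis
    have "b y = b y'" if "b \<in> reg Y V" for b
      using t[OF tensor_fun_in_tensor_alg[OF A.cst_closed[of 1] that]] mem by (simp add: cst_apply)
    moreover have "alg_hom_to_complex V (reg Y V) (\<lambda>b. b y)"
      using mem by (simp add: alg_hom_to_complex_def cst_apply)
    then have "\<exists>!z. z \<in> V \<and> (\<forall>b\<in>reg Y V. b y = b z)"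
      by (rule Y.affine_open_point[OF V])
    ultimately have "y = y'"
      using mem by metis
    then show "p = q"
      using \<open>x = x'\<close> by (simp add: xy)
  qed
  show "opn P W \<longleftrightarrow> (\<exists>H\<subseteq>T U V. W = (\<Union>h\<in>H. nonvan h))" if W: "W \<subseteq> U \<times> V" for W
  proof
    assume "opn P W"
    then have "\<forall>p\<in>W. \<exists>t\<in>T U V. p \<in> nonvan t \<and> nonvan t \<subseteq> W"
      using basic_open_P[OF _ _ U _ V] W by fast
    then show "\<exists>H\<subseteq>T U V. W = (\<Union>h\<in>H. nonvan h)"
      by (intro exI[of _ "{t \<in> T U V. nonvan t \<subseteq> W}"]) blast
  next
    assume "\<exists>H\<subseteq>T U V. W = (\<Union>h\<in>H. nonvan h)"
    then obtain H where H: "H \<subseteq> T U V" "W = (\<Union>h\<in>H. nonvan h)"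
      by blast
    show "opn P W"
      unfolding H(2) using H(1) nonvan_open_P[OF U_open V_open] by (intro openin_Union) auto
  qed
  show "reg P (nonvan h) = localization (T U V) h" if "h \<in> T U V" for h
    using reg_P_nonvan[OF U V that] .
qed

end


section \<open>Tensor products of divisors\<close>

context variety_pair
begin

text \<open>The sections of \<open>tensor_div\<close> are multiples of some
  \<open>f' \<otimes> g'\<close> near each point. There \<open>f'\<close> and \<open>g'\<close> are
  multiples of the given \<open>f\<close> and \<open>g\<close>, and the denominators of the
  multipliers are absorbed into \<open>t\<close> and \<open>u\<close>.\<close>

lemma tensor_div_local:
  assumes U: "affine_open X U" and f: "local_equation X D U f"
    and V: "affine_open Y V" and g: "local_equation Y E V g"
    and W: "W \<subseteq> U \<times> V" and h: "h \<in> tensor_div X Y D E W" and p: "(x, y) \<in> W"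
  shows "\<exists>t u. t \<in> T U V \<and> u \<in> T U V \<and> (x, y) \<in> nonvan u \<and> nonvan u \<subseteq> W \<and>
    (\<forall>q\<in>nonvan u. h q = tensor_fun f g q * (t q / u q))"
proof -
  have xy: "x \<in> U" "y \<in> V"
    using p W by auto
  interpret tensor_algebras U "reg X U" V "reg Y V"
    using X.affine_openD(1)[OF U] Y.affine_openD(1)[OF V] by (rule tensor_algebras)
  obtain U' V' f' g' W' k where U': "affine_open X U'" "local_equation X D U' f'"
    and V': "affine_open Y V'" "local_equation Y E V' g'"
    and W': "opn P W'" "(x, y) \<in> W'" "W' \<subseteq> W \<inter> (U' \<times> V')"
    and k: "k \<in> reg P W'" "res W' h = res W' (tensor_fun f' g') * k"
    using h p unfolding tensor_div_def by blast
  have xy': "x \<in> U'" "y \<in> V'"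
    using W' by auto
  obtain t0 u0 where t0: "t0 \<in> T U V" "u0 \<in> T U V" "(x, y) \<in> nonvan u0" "nonvan u0 \<subseteq> W'"
    "\<And>q. q \<in> nonvan u0 \<Longrightarrow> k q = t0 q / u0 q"
    using local_fraction[OF k(1) W'(2) U xy(1) V xy(2)] by blast
  obtain a where a: "a \<in> reg X U" "x \<in> nonvan a" "nonvan a \<subseteq> U'"
    using X.basic_open[OF U X.affine_openD(1)[OF U'(1)] xy(1) xy'(1)] .
  obtain b where b: "b \<in> reg Y V" "y \<in> nonvan b" "nonvan b \<subseteq> V'"
    using Y.basic_open[OF V Y.affine_openD(1)[OF V'(1)] xy(2) xy'(2)] .
  obtain c where c: "c \<in> localization (reg X U) a" "res (nonvan a) f' = c * res (nonvan a) f"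
    using X.local_equation_compare[OF U f U'(2) a(1,3)] X.affine_openD(3)[OF U a(1)] by auto
  obtain d where d: "d \<in> localization (reg Y V) b" "res (nonvan b) g' = d * res (nonvan b) g"
    using Y.local_equation_compare[OF V g V'(2) b(1,3)] Y.affine_openD(3)[OF V b(1)] by auto
  obtain c1 c2 where c12: "c1 \<in> reg X U" "c2 \<in> reg X U" "\<And>z. a z \<noteq> 0 \<Longrightarrow> c1 z \<noteq> 0" "\<And>z. a z \<noteq> 0 \<Longrightarrow> c1 z * c z = c2 z"
    using A.localization_witness[OF c(1) a(1)] by metis
  obtain d1 d2 where d12: "d1 \<in> reg Y V" "d2 \<in> reg Y V" "\<And>z. b z \<noteq> 0 \<Longrightarrow> d1 z \<noteq> 0" "\<And>z. b z \<noteq> 0 \<Longrightarrow> d1 z * d z = d2 z"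
    using B.localization_witness[OF d(1) b(1)] by metis
  \<comment> \<open>The factors \<open>a\<close> and \<open>b\<close> confine
    \<open>nonvan u\<close> to the set where \<open>f' = c f\<close> and \<open>g' = d g\<close>
    hold.\<close>
  define t where "t = t0 * tensor_fun (a * c2) (b * d2)"
  define u where "u = u0 * tensor_fun (a * c1) (b * d1)"
  have "h q = tensor_fun f g q * (t q / u q)" if q: "q \<in> nonvan u" for q
  proof -
    obtain v w where vw: "q = (v, w)"
      by (cases q)
    have nz: "u0 (v, w) \<noteq> 0" "a v \<noteq> 0" "c1 v \<noteq> 0" "b w \<noteq> 0" "d1 w \<noteq> 0"
      using q by (auto simp: u_def vw mem_nonvan)
    have "h (v, w) = f' v * g' w * k (v, w)"
      using fun_cong[OF k(2), of "(v, w)"] t0(4) nz(1) by (auto simp: res_apply mem_nonvan subset_iff)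
    also have "k (v, w) = t0 (v, w) / u0 (v, w)"
      using t0(5) nz(1) by (simp add: mem_nonvan)
    also have "f' v = c v * f v"
      using fun_cong[OF c(2), of v] nz by (simp add: res_apply mem_nonvan)
    also have "c v = c2 v / c1 v"
      using nz c12(4)[of v] by (simp add: eq_divide_eq mult.commute)
    also have "g' w = d w * g w"
      using fun_cong[OF d(2), of w] nz by (simp add: res_apply mem_nonvan)
    also have "d w = d2 w / d1 w"
      using nz d12(4)[of w] by (simp add: eq_divide_eq mult.commute)
    finally show ?thesis
      using nz by (simp add: vw t_def u_def mult_ac)
  qed
  moreover have "(x, y) \<in> nonvan u"
    using t0(3) a(2) b(2) c12(3)[of x] d12(3)[of y] by (simp add: u_def mem_nonvan)
  moreover have "nonvan u \<subseteq> W"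
    using t0(4) W'(3) by (auto simp: u_def nonvan_def)
  moreover have "t \<in> T U V"
    unfolding t_def
    by (intro T.mult_closed tensor_fun_in_tensor_alg A.mult_closed B.mult_closed t0 a b c12 d12)
  moreover have "u \<in> T U V"
    unfolding u_def
    by (intro T.mult_closed tensor_fun_in_tensor_alg A.mult_closed B.mult_closed t0 a b c12 d12)
  ultimately show ?thesis
    by blast
qed

text \<open>A section \<open>h\<close> is locally \<open>F\<close> times a fraction. As
  \<open>F\<close> is nonzero and the product irreducible, these fractions agree on overlaps and
  form one regular function.\<close>

lemma local_equation_tensor:
  assumes U: "affine_open X U" and f: "local_equation X D U f"
    and V: "affine_open Y V" and g: "local_equation Y E V g"
  shows "local_equation P (tensor_div X Y D E) (U \<times> V) (tensor_fun f g)"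
proof -
  define F where "F = tensor_fun f g"
  note U_open = X.affine_openD(1)[OF U] and V_open = Y.affine_openD(1)[OF V]
  interpret tensor_algebras U "reg X U" V "reg Y V"
    using U_open V_open by (rule tensor_algebras)
  have F: "F \<in> T U V"
    unfolding F_def using f g by (intro tensor_fun_in_tensor_alg) (auto simp: local_equation_def)
  obtain x0 y0 where "f x0 \<noteq> 0" "g y0 \<noteq> 0"
    using f g by (auto simp: local_equation_def fun_eq_iff)
  then have F0: "F (x0, y0) \<noteq> 0"
    by (simp add: F_def)
  have "tensor_div X Y D E W = {res W F * k | k. k \<in> reg P W}" if W: "W \<subseteq> U \<times> V" "opn P W" for W
  proof (intro equalityI subsetI)
    fix h assume h: "h \<in> tensor_div X Y D E W"
    have "\<exists>t u. t \<in> T U V \<and> u \<in> T U V \<and> p \<in> nonvan u \<and> nonvan u \<subseteq> W \<and>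
      (\<forall>q\<in>nonvan u. h q = F q * (t q / u q))" if "p \<in> W" for p
      using tensor_div_local[OF U f V g W(1) h, of "fst p" "snd p"] that by (simp add: F_def)
    then obtain t u where t: "\<And>p. p \<in> W \<Longrightarrow> t p \<in> T U V" and u: "\<And>p. p \<in> W \<Longrightarrow> u p \<in> T U V"
      and up: "\<And>p. p \<in> W \<Longrightarrow> p \<in> nonvan (u p)" "\<And>p. p \<in> W \<Longrightarrow> nonvan (u p) \<subseteq> W"
      and hq: "\<And>p q. p \<in> W \<Longrightarrow> q \<in> nonvan (u p) \<Longrightarrow> h q = F q * (t p q / u p q)"
      by metis
    define k where "k = res W (\<lambda>p. t p p / u p p)"
    have k: "k q = t p q / u p q" if p: "p \<in> W" and q: "q \<in> nonvan (u p)" for p q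
    proof -
      have qW: "q \<in> W"
        using up(2)[OF p] q by blast
      \<comment> \<open>Otherwise this difference, \<open>F\<close> and both denominators are all
        nonzero at some \<open>z\<close>. There the two expressions for \<open>h z\<close>, divided
        by \<open>F z\<close>, show that the difference is 0.\<close>
      have "t p * u q - t q * u p = 0"
      proof (rule ccontr)
        assume "t p * u q - t q * u p \<noteq> 0"
        then have 1: "opn P (nonvan (t p * u q - t q * u p))" "nonvan (t p * u q - t q * u p) \<noteq> {}"
          using T.diff_closed[OF T.mult_closed[OF t[OF p] u[OF qW]] T.mult_closed[OF t[OF qW] u[OF p]]]
          by (simp_all only: nonvan_open_P[OF U_open V_open] nonvan_eq_empty simp_thms)
        have 2: "opn P (nonvan F)" "nonvan F \<noteq> {}"
          using nonvan_open_P[OF U_open V_open F] F0 by (auto simp: nonvan_def)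
        have 3: "opn P (nonvan (u p) \<inter> nonvan (u q))" "nonvan (u p) \<inter> nonvan (u q) \<noteq> {}"
          using nonvan_open_P[OF U_open V_open u[OF p]] nonvan_open_P[OF U_open V_open u[OF qW]] q up(1)[OF qW]
          by (auto intro: openin_Int)
        have "nonvan F \<inter> (nonvan (u p) \<inter> nonvan (u q)) \<noteq> {}"
          using P.open_Int_nonempty 2 3 by blast
        then obtain z where z: "z \<in> nonvan (t p * u q - t q * u p)" "z \<in> nonvan F" "z \<in> nonvan (u p)" "z \<in> nonvan (u q)"
          using P.open_Int_nonempty[OF 1(1) openin_Int[OF 2(1) 3(1)] 1(2)] by blast
        have "F z * (t p z / u p z) = F z * (t q z / u q z)"
          using hq[OF p z(3)] hq[OF qW z(4)] by simp
        then show False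
          using z by (simp add: mem_nonvan frac_eq_eq)
      qed
      then have "t p q * u q q = t q q * u p q"
        by (metis (no_types, lifting) eq_iff_diff_eq_0 minus_apply times_fun_apply zero_fun_apply)
      then show ?thesis
        using q up(1)[OF qW] qW by (simp add: k_def res_apply mem_nonvan frac_eq_eq)
    qed
    have "k \<in> reg P W"
    proof (rule reg_PI)
      fix x y assume xy: "(x, y) \<in> W"
      have "\<forall>q\<in>nonvan (u (x, y)). k q = t (x, y) q / u (x, y) q"
        using k[OF xy] by blast
      then show "\<exists>U V t u. affine_open X U \<and> affine_open Y V \<and> t \<in> T U V \<and> u \<in> T U V \<and>
          (x, y) \<in> nonvan u \<and> nonvan u \<subseteq> W \<and> (\<forall>q\<in>nonvan u. k q = t q / u q)"
        using U V t[OF xy] u[OF xy] up[OF xy]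
        by (intro exI[of _ U] exI[of _ V] exI[of _ "t (x, y)"] exI[of _ "u (x, y)"] conjI)
    qed (simp add: k_def res_apply)
    moreover have "h = res W F * k"
    proof
      fix p
      show "h p = (res W F * k) p"
      proof (cases "p \<in> W")
        case True
        then show ?thesis
          using hq[OF True up(1)[OF True]] by (simp add: k_def res_apply)
      next
        case False
        have "h \<in> reg P W"
          using h by (simp add: tensor_div_def)
        then show ?thesis
          using P.reg_vanishes[OF W(2) _ False] False by (simp add: res_apply)
      qed
    qed
    ultimately show "h \<in> {res W F * k | k. k \<in> reg P W}"
      by blast
  next
    fix h assume "h \<in> {res W F * k | k. k \<in> reg P W}"
    then obtain k where k: "k \<in> reg P W" "h = res W F * k"
      by blast
    have "h \<in> reg P W"
    proof (rule reg_PI)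
      fix x y assume xy: "(x, y) \<in> W"
      then have "x \<in> U" "y \<in> V"
        using W(1) by auto
      then obtain t u where t: "t \<in> T U V" "u \<in> T U V" "(x, y) \<in> nonvan u" "nonvan u \<subseteq> W"
        "\<And>q. q \<in> nonvan u \<Longrightarrow> k q = t q / u q"
        using local_fraction[OF k(1) xy U _ V] by blast
      have "\<forall>q\<in>nonvan u. h q = (F * t) q / u q"
        using t(4,5) by (auto simp: k(2) res_apply)
      then show "\<exists>U V t u. affine_open X U \<and> affine_open Y V \<and> t \<in> T U V \<and> u \<in> T U V \<and>
          (x, y) \<in> nonvan u \<and> nonvan u \<subseteq> W \<and> (\<forall>q\<in>nonvan u. h q = t q / u q)"
        using U V t(2-4) T.mult_closed[OF F t(1)] by blast
    qed (simp add: k(2) res_apply)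
    moreover have "res W h = res W (tensor_fun f g) * k"
      by (auto simp: k(2) F_def res_apply)
    ultimately show "h \<in> tensor_div X Y D E W"
      unfolding tensor_div_def using U f V g W k(1)
      by (intro CollectI conjI ballI exI[of _ U] exI[of _ V] exI[of _ f] exI[of _ g] exI[of _ W]) auto
  qed
  moreover have "opn P (U \<times> V)"
    using affine_open_product[OF U V] by (simp add: affine_open_def)
  moreover have "F \<noteq> 0"
    using F0 by (auto simp: fun_eq_iff)
  ultimately show ?thesis
    using F unfolding local_equation_def F_def[symmetric] reg_P_product[OF U V] by blast
qed

lemma affine_equations_tensor:
  assumes E1: "affine_equations X D E1" and E2: "affine_equations Y E E2"
  shows "affine_equations P (tensor_div X Y D E)
    ((\<lambda>((U, f), (V, g)). (U \<times> V, tensor_fun f g)) ` (E1 \<times> E2))"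
  unfolding affine_equations_def
proof (intro conjI)
  show "\<forall>(W, h)\<in>(\<lambda>((U, f), (V, g)). (U \<times> V, tensor_fun f g)) ` (E1 \<times> E2).
      affine_open P W \<and> local_equation P (tensor_div X Y D E) W h"
    using E1 E2 local_equation_tensor affine_open_product unfolding affine_equations_def by fast
  have "(\<Union>(W, h)\<in>(\<lambda>((U, f), (V, g)). (U \<times> V, tensor_fun f g)) ` (E1 \<times> E2). W) =
      (\<Union>(U, f)\<in>E1. U) \<times> (\<Union>(V, g)\<in>E2. V)"
    by auto
  then show "(\<Union>(W, h)\<in>(\<lambda>((U, f), (V, g)). (U \<times> V, tensor_fun f g)) ` (E1 \<times> E2). W) = pts P"
    using E1 E2 by (simp add: affine_equations_def topspace_P)
qed

end

section \<open>Passage to the least common multiples\<close>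

lemma affine_equations_exist:
  assumes "effective_cartier_divisor X D"
  shows "affine_equations X D {(U, f). affine_open X U \<and> local_equation X D U f}"
  unfolding affine_equations_def
proof (intro conjI equalityI subsetI)
  fix x assume "x \<in> (\<Union>(U, f)\<in>{(U, f). affine_open X U \<and> local_equation X D U f}. U)"
  then obtain U where "affine_open X U" "x \<in> U"
    by blast
  then show "x \<in> pts X"
    using openin_subset[of "spc X" U] by (auto simp: affine_open_def)
next
  fix x assume "x \<in> pts X"
  then obtain U f where "x \<in> U" "affine_open X U" "local_equation X D U f"
    using assms unfolding effective_cartier_divisor_def by blast
  then show "x \<in> (\<Union>(U, f)\<in>{(U, f). affine_open X U \<and> local_equation X D U f}. U)"
    by blast
qed auto

text \<open>\<open>Lcm\<close> commutes with multiplication by a fixed polynomial up to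
  normalization, which is used for one factor at a time. Nonemptiness matters because the
  \<open>Lcm\<close> of the empty set is 1.\<close>

lemma Lcm_mult_dvd_iff:
  fixes S T :: "complex poly set"
  assumes "S \<noteq> {}" "T \<noteq> {}"
  shows "Lcm S * Lcm T dvd c \<longleftrightarrow> (\<forall>a\<in>S. \<forall>b\<in>T. a * b dvd c)"
proof -
  have left: "(\<forall>b\<in>T. a * b dvd c) \<longleftrightarrow> Lcm T * a dvd c" for a
    using Lcm_dvd_iff[of "(*) a ` T" c] Lcm_mult[OF assms(2), of a] by (simp add: mult.commute)
  have "(\<forall>a\<in>S. Lcm T * a dvd c) \<longleftrightarrow> Lcm S * Lcm T dvd c"
    using Lcm_dvd_iff[of "(*) (Lcm T) ` S" c] Lcm_mult[OF assms(1), of "Lcm T"] by (simp add: mult.commute)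
  then show ?thesis
    by (simp only: left)
qed

theorem theorem1p3:
  fixes X1 :: "'a funsp" and X2 :: "'b funsp"
    and D1 :: "'a set \<Rightarrow> ('a \<Rightarrow> complex) set" and D2 :: "'b set \<Rightarrow> ('b \<Rightarrow> complex) set"
  assumes "integral_complex_variety X1" and "nonsingular X1"
    and "integral_complex_variety X2" and "nonsingular X2"
    and "effective_cartier_divisor X1 D1" and "nonzero_cartier_divisor X1 D1"
    and "effective_cartier_divisor X2 D2" and "nonzero_cartier_divisor X2 D2"
  shows "bs_poly_div X1 D1 * bs_poly_div X2 D2
    = bs_poly_div (prod_space X1 X2) (tensor_div X1 X2 D1 D2)"
proof -
  interpret variety_pair X1 X2
    using assms(1,3) by (simp add: variety_pair_def variety_if_integral)
  define E1 where "E1 = (SOME E. affine_equations X1 D1 E)"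
  define E2 where "E2 = (SOME E. affine_equations X2 D2 E)"
  have E1: "affine_equations X1 D1 E1"
    unfolding E1_def using affine_equations_exist[OF assms(5)] by (rule someI)
  have E2: "affine_equations X2 D2 E2"
    unfolding E2_def using affine_equations_exist[OF assms(7)] by (rule someI)
  define S1 where "S1 = (\<lambda>(U, f). bs_poly (reg X1 U) f) ` E1"
  define S2 where "S2 = (\<lambda>(U, f). bs_poly (reg X2 U) f) ` E2"
  have div: "bs_poly_div X1 D1 = Lcm S1" "bs_poly_div X2 D2 = Lcm S2"
    by (simp_all add: bs_poly_div_def S1_def S2_def flip: E1_def E2_def)
  \<comment> \<open>Irreducible spaces have points, so the coverings and the sets of local
    polynomials are nonempty, as \<open>Lcm_mult_dvd_iff\<close> demands.\<close>
  have "pts X1 \<noteq> {}" "pts X2 \<noteq> {}"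
    using X.irreducible Y.irreducible by (simp_all only: irreducible_space_def simp_thms)
  then have "E1 \<noteq> {}" "E2 \<noteq> {}"
    using E1 E2 unfolding affine_equations_def by blast+
  then have ne: "S1 \<noteq> {}" "S2 \<noteq> {}"
    by (simp_all add: S1_def S2_def)
  have local_dvd: "bs_poly (reg X1 U) f * bs_poly (reg X2 V) g dvd c \<longleftrightarrow>
      c \<in> bs_ideal (reg P (U \<times> V)) (tensor_fun f g)" if "(U, f) \<in> E1" "(V, g) \<in> E2" for U f V g c
  proof -
    have U: "affine_open X1 U" "f \<in> reg X1 U" "f \<noteq> 0" and V: "affine_open X2 V" "g \<in> reg X2 V" "g \<noteq> 0"
      using that E1 E2 by (auto simp: affine_equations_def local_equation_def)
    obtain G where "affine_algebra U (reg X1 U) G"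
      using X.affine_open_algebra[OF U(1)] .
    then interpret A: affine_algebra U "reg X1 U" G .
    obtain H where "affine_algebra V (reg X2 V) H"
      using Y.affine_open_algebra[OF V(1)] .
    then interpret B: affine_algebra V "reg X2 V" H .
    interpret tensor_algebras U "reg X1 U" V "reg X2 V" ..
    show ?thesis
      unfolding reg_P_product[OF U(1) V(1)]
      by (rule bs_poly_tensor_dvd_iff[OF A.generated A.finite_generators B.generated B.finite_generators U(2,3) V(2,3)])
  qed
  have "Lcm S1 * Lcm S2 dvd c \<longleftrightarrow> bs_poly_div P (tensor_div X1 X2 D1 D2) dvd c" for c
  proof -
    have "Lcm S1 * Lcm S2 dvd c \<longleftrightarrow>
        (\<forall>(U, f)\<in>E1. \<forall>(V, g)\<in>E2. bs_poly (reg X1 U) f * bs_poly (reg X2 V) g dvd c)"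
      unfolding Lcm_mult_dvd_iff[OF ne] by (auto simp: S1_def S2_def)
    also have "\<dots> \<longleftrightarrow> (\<forall>(U, f)\<in>E1. \<forall>(V, g)\<in>E2. c \<in> bs_ideal (reg P (U \<times> V)) (tensor_fun f g))"
      using local_dvd by fast
    also have "\<dots> \<longleftrightarrow> bs_poly_div P (tensor_div X1 X2 D1 D2) dvd c"
      unfolding P.bs_poly_div_dvd_iff[OF affine_equations_tensor[OF E1 E2]] by fastforce
    finally show ?thesis .
  qed
  \<comment> \<open>Both sides have the same multiples. Being normalized, they are equal and not
    just associated.\<close>
  then have "Lcm S1 * Lcm S2 dvd bs_poly_div P (tensor_div X1 X2 D1 D2)"
    "bs_poly_div P (tensor_div X1 X2 D1 D2) dvd Lcm S1 * Lcm S2"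
    by (metis dvd_refl)+
  then show ?thesis
    unfolding div
    by (rule associated_eqI) (simp_all add: normalize_mult bs_poly_div_def Let_def)
qed

end
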